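(* Let $d\geq5$ and $2\leq r\leq d-3$ be integers, let $X=\{x_1,\dots,x_d\}$, $P=\prod_{\ell\in\mathbb{N}}\mathrm{Alt}(X^\ell)$, let $G_{\mathcal{A}(d,r)}\leq P$ be the group of the telescope $\mathcal{A}(d,r)$, and let $\epsilon=(\epsilon_1,\epsilon_2,\epsilon_3,\dots)\in P$ be the element of order two with $\epsilon_\ell=\delta\times\cdots\times\delta\in\mathrm{Alt}(X^\ell)$ (acting by $\delta$ on every letter of a word), where $\delta=(x_1,x_d)(x_2,x_{d-1})\in\mathrm{Alt}(X)$. Then the group $$N=\langle G_{\mathcal{A}(d,r)},\ \epsilon^{-1}G_{\mathcal{A}(d,r)}\epsilon\rangle\leq P$$ is a $4$-generated residually finite group with $\widehat N= P$ (via the map induced by the inclusion $N \to P$). Let $\tau$ be the automorphism of $N$ induced by conjugation with $\epsilon$. Then $\tau$ is not an inner automorphism of $N$, but the induced automorphism $\widehat\tau$ on $\widehat N=P$ is inner. In particular, for $G=N\rtimes\langle\tau\rangle$ (a finitely generated, residually finite group with finitely generated normal subgroup $N$), the image of $\widehat N$ in $\widehat G$ under the map induced by the inclusion $N\to G$ is a direct factor of $\widehat G$, but $N$ is not a direct factor of $G$.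
   Context: $\widehat{\ \cdot\ }$ denotes profinite completion; a group is $4$-generated if it can be generated by four elements. The telescope $\mathcal{A}(d,r)$: let $X^\ell$ be the set of words of length $\ell$ over $X$. For $\ell\geq1$ put $\Omega_\ell=\mathrm{Alt}(X^\ell)$ and for $\ell\leq k$ let $\iota_{\ell,k}\colon\Omega_\ell\to\Omega_k$ be the embedding $\iota_{\ell,k}(\sigma)(vw)=\sigma(v)w$ for $v\in X^\ell$, $w\in X^{k-\ell}$. Let $B=\mathrm{Alt}(\{x_1,\dots,x_r\}\times X)$, viewed as the subgroup of $\Omega_2$ fixing all words $x_ix_j$ with $i>r$. For $\ell\geq2$ define $\phi_\ell\colon B\to\Omega_\ell$ by $\phi_\ell(\sigma)(vxy)=v\,\sigma(xy)$ if $v=x_d^{\ell-2}$ and $\phi_\ell(\sigma)(vxy)=vxy$ otherwise, for $v\in X^{\ell-2}$, $x,y\in X$. The group of the telescope: let $\pi_\ell\colon P\to\Omega_\ell$ be the projections and $\Delta_1\colon\Omega_1\to P$, $\Delta_1(\omega)=(\omega,\iota_{1,2}(\omega),\iota_{1,3}(\omega),\dots)$. For $g\in B$ let $\tilde g^{[1]}\in P$ be given by $\pi_1(\tilde g^{[1]})=1$ and $\pi_i(\tilde g^{[1]})=\prod_{k=2}^{i}\iota_{k,i}(\phi_k(g))$ for $i>1$ (the factors commute), and $C^{[1]}=\{\tilde g^{[1]}\mid g\in B\}$. Then $G_{\mathcal{A}(d,r)}=\langle\Delta_1(\Omega_1),C^{[1]}\rangle\leq P$. *)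

theory Defs
  imports "HOL-Algebra.Algebra" "HOL-Analysis.Function_Topology"
begin

section \<open>Generation, residual finiteness, inner automorphisms, direct factors\<close>

definition generated_by_at_most :: "nat \<Rightarrow> ('a, 'b) monoid_scheme \<Rightarrow> bool" where
  "generated_by_at_most k G \<longleftrightarrow>
     (\<exists>S. S \<subseteq> carrier G \<and> finite S \<and> card S \<le> k \<and> generate G S = carrier G)"

definition finitely_generated_group :: "('a, 'b) monoid_scheme \<Rightarrow> bool" where
  "finitely_generated_group G \<longleftrightarrow>
     group G \<and> (\<exists>S. S \<subseteq> carrier G \<and> finite S \<and> generate G S = carrier G)"

definition finite_index_normal :: "('a, 'b) monoid_scheme \<Rightarrow> 'a set set" where
  "finite_index_normal G = {K. K \<lhd> G \<and> finite (rcosets\<^bsub>G\<^esub> K)}"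

definition residually_finite :: "('a, 'b) monoid_scheme \<Rightarrow> bool" where
  "residually_finite G \<longleftrightarrow>
     group G \<and> (\<forall>g \<in> carrier G. g \<noteq> \<one>\<^bsub>G\<^esub> \<longrightarrow> (\<exists>K \<in> finite_index_normal G. g \<notin> K))"

definition is_inner :: "('a, 'b) monoid_scheme \<Rightarrow> ('a \<Rightarrow> 'a) \<Rightarrow> bool" where
  "is_inner G f \<longleftrightarrow>
     (\<exists>a \<in> carrier G. \<forall>x \<in> carrier G. f x = a \<otimes>\<^bsub>G\<^esub> x \<otimes>\<^bsub>G\<^esub> inv\<^bsub>G\<^esub> a)"

definition direct_complement :: "('a, 'b) monoid_scheme \<Rightarrow> 'a set \<Rightarrow> 'a set \<Rightarrow> bool" where
  "direct_complement G H K \<longleftrightarrow>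
     H \<lhd> G \<and> K \<lhd> G \<and> H \<inter> K = {\<one>\<^bsub>G\<^esub>} \<and> H <#>\<^bsub>G\<^esub> K = carrier G"

definition direct_factor :: "('a, 'b) monoid_scheme \<Rightarrow> 'a set \<Rightarrow> bool" where
  "direct_factor G H \<longleftrightarrow> (\<exists>K. direct_complement G H K)"

text \<open>In a compact Hausdorff group, an internal direct decomposition into closed subgroups is a
  decomposition as a product of topological groups.\<close>

definition closed_direct_factor ::
    "('a, 'b) monoid_scheme \<Rightarrow> 'a topology \<Rightarrow> 'a set \<Rightarrow> bool" where
  "closed_direct_factor G T H \<longleftrightarrow>
     closedin T H \<and> (\<exists>K. closedin T K \<and> direct_complement G H K)"

section \<open>Profinite completion\<close>

text \<open>The inverse limit of the finite quotients \<open>G / K\<close>. For \<open>K \<subseteq> L\<close> the canonical map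
  \<open>G / K \<rightarrow> G / L\<close> sends a coset of \<open>K\<close> to the unique coset of \<open>L\<close> containing it, so that
  compatibility of a family of cosets reads \<open>x K \<subseteq> x L\<close>.\<close>

definition profinite_completion :: "('a, 'b) monoid_scheme \<Rightarrow> ('a set \<Rightarrow> 'a set) monoid" where
  "profinite_completion G =
     (product_group (finite_index_normal G) (\<lambda>K. G Mod K))
       \<lparr>carrier := {x \<in> \<Pi>\<^sub>E K \<in> finite_index_normal G. carrier (G Mod K).
          \<forall>K \<in> finite_index_normal G. \<forall>L \<in> finite_index_normal G. K \<subseteq> L \<longrightarrow> x K \<subseteq> x L}\<rparr>"

definition completion_topology :: "('a, 'b) monoid_scheme \<Rightarrow> ('a set \<Rightarrow> 'a set) topology" where
  "completion_topology G =
     subtopology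
       (product_topology (\<lambda>K. discrete_topology (carrier (G Mod K))) (finite_index_normal G))
       (carrier (profinite_completion G))"

definition to_completion :: "('a, 'b) monoid_scheme \<Rightarrow> 'a \<Rightarrow> 'a set \<Rightarrow> 'a set" where
  "to_completion G g = (\<lambda>K \<in> finite_index_normal G. K #>\<^bsub>G\<^esub> g)"

text \<open>The homomorphism of completions induced by \<open>f : G \<rightarrow> H\<close>: its \<open>L\<close>-coordinate is the
  \<open>f\<inverse>(L)\<close>-coordinate followed by \<open>G / f\<inverse>(L) \<rightarrow> H / L\<close>, \<open>c \<mapsto> L f(c)\<close>.\<close>

definition completion_map ::
    "('a, 'c) monoid_scheme \<Rightarrow> ('b, 'd) monoid_scheme \<Rightarrow> ('a \<Rightarrow> 'b)
       \<Rightarrow> ('a set \<Rightarrow> 'a set) \<Rightarrow> ('b set \<Rightarrow> 'b set)" where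
  "completion_map G H f x =
     (\<lambda>L \<in> finite_index_normal H. L <#>\<^bsub>H\<^esub> (f ` x {g \<in> carrier G. f g \<in> L}))"

text \<open>For a homomorphism \<open>f\<close> from \<open>G\<close> to a profinite group \<open>Q\<close> with topology \<open>T\<close>, the induced map is
  the continuous homomorphism on the completion of \<open>G\<close> extending \<open>f\<close>; it is unique (on the
  carrier) because the image of \<open>G\<close> is dense and \<open>T\<close> is Hausdorff.\<close>

definition induced_on_completion ::
    "('a, 'c) monoid_scheme \<Rightarrow> ('b, 'd) monoid_scheme \<Rightarrow> 'b topology \<Rightarrow> ('a \<Rightarrow> 'b)
       \<Rightarrow> (('a set \<Rightarrow> 'a set) \<Rightarrow> 'b) \<Rightarrow> bool" where
  "induced_on_completion G Q T f F \<longleftrightarrow>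
     F \<in> hom (profinite_completion G) Q \<and>
     continuous_map (completion_topology G) T F \<and>
     (\<forall>g \<in> carrier G. F (to_completion G g) = f g)"

section \<open>Semidirect products\<close>

definition semidirect_product ::
    "('a, 'c) monoid_scheme \<Rightarrow> ('b, 'd) monoid_scheme \<Rightarrow> ('b \<Rightarrow> 'a \<Rightarrow> 'a) \<Rightarrow> ('a \<times> 'b) monoid" where
  "semidirect_product N Q act =
     \<lparr>carrier = carrier N \<times> carrier Q,
      monoid.mult = (\<lambda>(n, q) (n', q'). (n \<otimes>\<^bsub>N\<^esub> act q n', q \<otimes>\<^bsub>Q\<^esub> q')),
      one = (\<one>\<^bsub>N\<^esub>, \<one>\<^bsub>Q\<^esub>)\<rparr>"

section \<open>The telescope\<close>

text \<open>The letter \<open>x\<^sub>i\<close> is the number \<open>i\<close>, and words are lists. A permutation of a set of words is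
  a function on all lists that is the identity outside that set; thus the alternating group on a
  subset of \<open>X\<^sup>2\<close> is literally a subgroup of the one on \<open>X\<^sup>2\<close>.\<close>

definition Alt :: "'a set \<Rightarrow> ('a \<Rightarrow> 'a) monoid" where
  "Alt S = \<lparr>carrier = {p. p permutes S \<and> evenperm p}, monoid.mult = (\<circ>), one = id\<rparr>"

definition words :: "nat \<Rightarrow> nat \<Rightarrow> nat list set" where
  "words d l = {w. length w = l \<and> set w \<subseteq> {1..d}}"

definition Omega :: "nat \<Rightarrow> nat \<Rightarrow> (nat list \<Rightarrow> nat list) monoid" where
  "Omega d l = Alt (words d l)"

definition P_group :: "nat \<Rightarrow> (nat \<Rightarrow> nat list \<Rightarrow> nat list) monoid" where
  "P_group d = product_group {1..} (Omega d)"

definition P_topology :: "nat \<Rightarrow> (nat \<Rightarrow> nat list \<Rightarrow> nat list) topology" where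
  "P_topology d = product_topology (\<lambda>l. discrete_topology (carrier (Omega d l))) {1..}"

definition iota :: "nat \<Rightarrow> nat \<Rightarrow> nat \<Rightarrow> (nat list \<Rightarrow> nat list) \<Rightarrow> nat list \<Rightarrow> nat list" where
  "iota d l k \<sigma> u = (if u \<in> words d k then \<sigma> (take l u) @ drop l u else u)"

definition B_group :: "nat \<Rightarrow> nat \<Rightarrow> (nat list \<Rightarrow> nat list) monoid" where
  "B_group d r = Alt {[i, j] |i j. i \<in> {1..r} \<and> j \<in> {1..d}}"

definition phi :: "nat \<Rightarrow> nat \<Rightarrow> (nat list \<Rightarrow> nat list) \<Rightarrow> nat list \<Rightarrow> nat list" where
  "phi d l \<sigma> u =
     (if u \<in> words d l \<and> take (l - 2) u = replicate (l - 2) d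
      then take (l - 2) u @ \<sigma> (drop (l - 2) u) else u)"

definition Delta1 :: "nat \<Rightarrow> (nat list \<Rightarrow> nat list) \<Rightarrow> nat \<Rightarrow> nat list \<Rightarrow> nat list" where
  "Delta1 d \<omega> = (\<lambda>i \<in> {1..}. iota d 1 i \<omega>)"

text \<open>The product over \<open>k = 2, \<dots>, i\<close> is taken in increasing order of \<open>k\<close> (the factors commute when
  \<open>r < d\<close>); it is empty for \<open>i = 1\<close>.\<close>

definition g_tilde :: "nat \<Rightarrow> (nat list \<Rightarrow> nat list) \<Rightarrow> nat \<Rightarrow> nat list \<Rightarrow> nat list" where
  "g_tilde d g = (\<lambda>i \<in> {1..}. foldr (\<circ>) (map (\<lambda>k. iota d k i (phi d k g)) [2..<Suc i]) id)"

definition telescope_group :: "nat \<Rightarrow> nat \<Rightarrow> (nat \<Rightarrow> nat list \<Rightarrow> nat list) set" where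
  "telescope_group d r =
     generate (P_group d) (Delta1 d ` carrier (Omega d 1) \<union> g_tilde d ` carrier (B_group d r))"

definition delta :: "nat \<Rightarrow> nat \<Rightarrow> nat" where
  "delta d = transpose 1 d \<circ> transpose 2 (d - 1)"

definition epsilon :: "nat \<Rightarrow> nat \<Rightarrow> nat list \<Rightarrow> nat list" where
  "epsilon d = (\<lambda>l \<in> {1..}. \<lambda>w. if w \<in> words d l then map (delta d) w else w)"

section \<open>The groups of the theorem\<close>

definition N_set :: "nat \<Rightarrow> nat \<Rightarrow> (nat \<Rightarrow> nat list \<Rightarrow> nat list) set" where
  "N_set d r =
     generate (P_group d)
       (telescope_group d r \<union>
        (\<lambda>g. inv\<^bsub>P_group d\<^esub> (epsilon d) \<otimes>\<^bsub>P_group d\<^esub> g \<otimes>\<^bsub>P_group d\<^esub> epsilon d) ` telescope_group d r)"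

definition N_group :: "nat \<Rightarrow> nat \<Rightarrow> (nat \<Rightarrow> nat list \<Rightarrow> nat list) monoid" where
  "N_group d r = (P_group d)\<lparr>carrier := N_set d r\<rparr>"

text \<open>Elements of the library's automorphism group are extensional functions, hence the
  restriction to \<open>N\<close>.\<close>

definition tau :: "nat \<Rightarrow> nat \<Rightarrow>
    (nat \<Rightarrow> nat list \<Rightarrow> nat list) \<Rightarrow> (nat \<Rightarrow> nat list \<Rightarrow> nat list)" where
  "tau d r =
     (\<lambda>n \<in> N_set d r. inv\<^bsub>P_group d\<^esub> (epsilon d) \<otimes>\<^bsub>P_group d\<^esub> n \<otimes>\<^bsub>P_group d\<^esub> epsilon d)"

definition tau_group :: "nat \<Rightarrow> nat \<Rightarrow>
    ((nat \<Rightarrow> nat list \<Rightarrow> nat list) \<Rightarrow> (nat \<Rightarrow> nat list \<Rightarrow> nat list)) monoid" where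
  "tau_group d r =
     (AutoGroup (N_group d r))\<lparr>carrier := generate (AutoGroup (N_group d r)) {tau d r}\<rparr>"

definition G_group :: "nat \<Rightarrow> nat \<Rightarrow>
    ((nat \<Rightarrow> nat list \<Rightarrow> nat list) \<times>
     ((nat \<Rightarrow> nat list \<Rightarrow> nat list) \<Rightarrow> (nat \<Rightarrow> nat list \<Rightarrow> nat list))) monoid" where
  "G_group d r = semidirect_product (N_group d r) (tau_group d r) (\<lambda>q n. q n)"

definition N_incl :: "nat \<Rightarrow> nat \<Rightarrow> (nat \<Rightarrow> nat list \<Rightarrow> nat list) \<Rightarrow>
    (nat \<Rightarrow> nat list \<Rightarrow> nat list) \<times>
    ((nat \<Rightarrow> nat list \<Rightarrow> nat list) \<Rightarrow> (nat \<Rightarrow> nat list \<Rightarrow> nat list))" where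
  "N_incl d r n = (n, \<one>\<^bsub>tau_group d r\<^esub>)"

end

theory Submission
  imports Defs "HOL-Analysis.T1_Spaces"
begin

text \<open>Throughout, an element of \<open>P\<close> is \<^emph>\<open>uniform from level \<open>k\<close>\<close> if a single length-preserving map of words
describes its action at all levels \<open>\<ge> k\<close>, while it is trivial below. The generators of the
telescope group and \<open>\<epsilon>\<close> are uniform from level 1, so most computations in \<open>P\<close> are computations with
maps of words.

\<^bold>\<open>The commutator trick.\<close> For \<open>g \<in> B\<close> the generator belonging to \<open>g\<close> skips the leading letters \<open>d\<close> of a
word and applies \<open>g\<close> to the two letters that follow. Its part behind the prefix \<open>d\<^sup>k\<^sup>-\<^sup>1\<close>, called
\<open>tail d k g\<close>, is the product of the block \<open>E k g\<close>, which moves only words beginning with \<open>d\<^sup>k\<^sup>-\<^sup>1 x\<close> for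
some \<open>x \<le> r\<close>, and of \<open>tail d (k+1) g\<close>, which lives behind \<open>d\<^sup>k\<close>. As \<open>r \<le> d - 3\<close>, some 3-cycle \<open>\<omega>\<close> of
words of length \<open>k\<close> moves \<open>d\<^sup>k\<close> and fixes all \<open>d\<^sup>k\<^sup>-\<^sup>1 x\<close> with \<open>x \<le> r\<close>. Conjugation by \<open>\<Delta>\<^sub>k(\<omega>)\<close> keeps the
block of \<open>tail d k h\<close> and moves the rest of it away, and so the commutator of \<open>tail d k g\<close> with this
conjugate is the single block \<open>E k [g,h]\<close>; this is \<open>tail_comm\<close>. The group \<open>B\<close> is perfect, so all blocks
\<open>E k g\<close> lie in the telescope group; their conjugates generate \<open>\<Delta>\<^sub>k\<^sub>+\<^sub>1(Alt(X\<^sup>k\<^sup>+\<^sup>1))\<close>. By induction the telescope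
group contains all \<open>\<Delta>\<^sub>k(Alt(X\<^sup>k))\<close> and therefore every factor of \<open>P\<close>
(\<open>single_in\<close>). In particular \<open>N\<close> is dense in \<open>P\<close> and has trivial centralizer there.

\<^bold>\<open>The completion of N.\<close> Let \<open>K\<close> be normal of finite index in \<open>N\<close>. For large \<open>k\<close> there are more
3-cycles \<open>(p q z)\<close> in \<open>Alt(X\<^sup>k)\<close> than cosets of \<open>K\<close>; two of them agree modulo \<open>K\<close>, their quotient is again a
3-cycle, and so \<open>\<Delta>\<^sub>k(Alt(X\<^sup>k)) \<subseteq> K\<close>. The element \<open>\<Delta>\<^sub>k(\<omega>)\<close> of the commutator trick is now trivial modulo
\<open>K\<close>, as is \<open>E k [g,h]\<close>; hence the tails from level \<open>k\<close> on commute modulo \<open>K\<close>, and they lie in \<open>K\<close> because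
\<open>B\<close> is perfect. It follows that \<open>K\<close> contains all elements of \<open>N\<close> that are trivial at the first levels
(\<open>level_kernel_cofinal\<close>), and with density this identifies the completion of \<open>N\<close> with \<open>P\<close>.

\<^bold>\<open>Generators.\<close> The group \<open>N\<close> is generated by the first factor \<open>Alt(X)\<close>, by \<open>\<Delta>\<^sub>2(Alt(X\<^sup>2))\<close>, and by the tails
from level 2 on together with their conjugates under \<open>\<epsilon>\<close>. The first two commute, and so do the last
two. Two elements generate a product of two alternating groups (\<open>Alt_product_two_generators\<close>),
which makes four generators in total.

\<^bold>\<open>Inner and not inner.\<close> A generator of \<open>N\<close> changes at most two letters of a word whereas \<open>\<epsilon>\<close> may change all
of them, so \<open>\<epsilon> \<notin> N\<close> (\<open>eps_notin_N\<close>). If \<open>a \<in> N\<close> induced \<open>\<tau>\<close>, then \<open>a\<^sup>-\<^sup>1\<epsilon>\<close> would centralize \<open>N\<close>, and \<open>a\<close> would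
be \<open>\<epsilon>\<close>. The same argument shows that no element \<open>(m,\<tau>)\<close> of \<open>G\<close> centralizes \<open>N\<close>, hence \<open>N\<close> has no direct
complement in \<open>G\<close>. In the completion of \<open>G\<close>, however, the limit of elements \<open>(e,\<tau>)\<close> with \<open>e \<in> N\<close> tending
to \<open>\<epsilon>\<close> is central of order two and generates a complement.\<close>

section \<open>Alternating groups and 3-cycles\<close>

text \<open>Here \<open>inv\<close> denotes inversion in a group, so the inverse of a permutation gets a name of its own.\<close>

abbreviation pinv :: "('a \<Rightarrow> 'b) \<Rightarrow> 'b \<Rightarrow> 'a" where "pinv \<equiv> inv_into UNIV"

definition cyc3 :: "'a \<Rightarrow> 'a \<Rightarrow> 'a \<Rightarrow> 'a \<Rightarrow> 'a" where
  "cyc3 a b c = transpose a b \<circ> transpose b c"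

lemma Alt_simps [simp]:
  "carrier (Alt S) = {p. p permutes S \<and> evenperm p}"
  "x \<otimes>\<^bsub>Alt S\<^esub> y = x \<circ> y" "\<one>\<^bsub>Alt S\<^esub> = id"
  by (auto simp: Alt_def)

lemma even_comp: "finite S \<Longrightarrow> p permutes S \<Longrightarrow> q permutes S \<Longrightarrow> evenperm (p \<circ> q) \<longleftrightarrow> (evenperm p \<longleftrightarrow> evenperm q)"
  by (metis evenperm_comp permutation_permutes)

lemma even_inv: "finite S \<Longrightarrow> p permutes S \<Longrightarrow> evenperm (pinv p) \<longleftrightarrow> evenperm p"
  by (metis evenperm_inv permutation_permutes)

lemma group_Alt: "finite S \<Longrightarrow> group (Alt S)"
proof (rule groupI)
  fix x assume S: "finite S" and "x \<in> carrier (Alt S)"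
  then show "\<exists>y\<in>carrier (Alt S). y \<otimes>\<^bsub>Alt S\<^esub> x = \<one>\<^bsub>Alt S\<^esub>"
    by (intro bexI[of _ "pinv x"]) (auto simp: even_inv permutes_inv permutes_inv_o)
qed (auto simp: even_comp permutes_compose o_assoc permutes_id)

lemma inv_Alt: "finite S \<Longrightarrow> p \<in> carrier (Alt S) \<Longrightarrow> inv\<^bsub>Alt S\<^esub> p = pinv p"
  by (rule group.inv_equality[OF group_Alt]) (auto simp: even_inv permutes_inv permutes_inv_o)

lemma cyc3_apply:
  "distinct [a,b,c] \<Longrightarrow> cyc3 a b c x = (if x = a then b else if x = b then c else if x = c then a else x)"
  by (auto simp: cyc3_def transpose_def)

lemma cyc3_permutes: "{a,b,c} \<subseteq> S \<Longrightarrow> cyc3 a b c permutes S"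
  unfolding cyc3_def by (intro permutes_compose permutes_swap_id) auto

lemma cyc3_Alt: "distinct [a,b,c] \<Longrightarrow> {a,b,c} \<subseteq> S \<Longrightarrow> finite S \<Longrightarrow> cyc3 a b c \<in> carrier (Alt S)"
  using cyc3_permutes[of a b c S] unfolding cyc3_def
  by (auto simp: evenperm_comp permutation_swap_id evenperm_swap)

lemma cyc3_inv: "distinct [a,b,c] \<Longrightarrow> pinv (cyc3 a b c) = cyc3 c b a"
proof (rule inv_unique_comp; rule ext)
  fix x assume d: "distinct [a,b,c]"
  then have d': "distinct [c,b,a]" by auto
  show "(cyc3 a b c \<circ> cyc3 c b a) x = id x" "(cyc3 c b a \<circ> cyc3 a b c) x = id x"
    using d by (auto simp: cyc3_apply[OF d] cyc3_apply[OF d'])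
qed

lemma cyc3_sq: "distinct [a,b,c] \<Longrightarrow> cyc3 a b c \<circ> cyc3 a b c = cyc3 c b a"
  by (auto simp: fun_eq_iff cyc3_apply)

lemma cyc3_rot: "distinct [a,b,c] \<Longrightarrow> cyc3 a b c = cyc3 b c a"
  by (auto simp: fun_eq_iff cyc3_apply)

lemma cyc3_conj: "bij f \<Longrightarrow> distinct [a,b,c] \<Longrightarrow> f \<circ> cyc3 a b c \<circ> pinv f = cyc3 (f a) (f b) (f c)"
proof
  fix x assume f: "bij f" and d: "distinct [a,b,c]"
  have d': "distinct [f a, f b, f c]" using f d by (auto simp: bij_def inj_eq)
  have "f (pinv f x) = x" using f by (simp add: bij_is_surj surj_f_inv_f)
  moreover have "pinv f x = y \<longleftrightarrow> x = f y" for y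
    using f by (metis bij_inv_eq_iff)
  ultimately show "(f \<circ> cyc3 a b c \<circ> pinv f) x = cyc3 (f a) (f b) (f c) x"
    using f by (auto simp: cyc3_apply[OF d] cyc3_apply[OF d'])
qed

text \<open>Induction on the support: a product of the given 3-cycles brings the image of a point back to that
point, and the only even permutation of \<open>{p, q}\<close> is the identity.\<close>

lemma Alt_generated_by_cyc3:
  assumes fin: "finite S" and H: "subgroup H (Alt S)" and pq: "p \<in> S" "q \<in> S" "p \<noteq> q"
    and cyc: "\<And>z. z \<in> S \<Longrightarrow> z \<noteq> p \<Longrightarrow> z \<noteq> q \<Longrightarrow> cyc3 p q z \<in> H"
  shows "H = carrier (Alt S)"
proof -
  interpret H: subgroup H "Alt S" by fact
  have cl: "x \<circ> y \<in> H" if "x \<in> H" "y \<in> H" for x y using H.m_closed[OF that] by simp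
  have iv: "pinv x \<in> H" if "x \<in> H" for x
    using group.subgroupE(3)[OF group_Alt[OF fin] H that] H.mem_carrier[OF that] inv_Alt[OF fin] by metis
  have "finite F \<Longrightarrow> F \<subseteq> S - {p,q} \<Longrightarrow> s permutes (F \<union> {p,q}) \<Longrightarrow> evenperm s \<Longrightarrow> s \<in> H" for F s
  proof (induction F arbitrary: s rule: finite_induct)
    case empty
    then have "s permutes {p,q}" by simp
    then have "s = id \<or> s = transpose p q" by (simp add: permutes_doubleton_iff)
    with empty pq have "s = id" by (auto simp: evenperm_swap)
    then show ?case using H.one_closed unfolding Alt_simps by metis
  next
    case (insert x F)
    have fF: "finite (F \<union> {p,q})" "finite (insert x F \<union> {p,q})" using insert by auto
    have x: "x \<in> S" "x \<noteq> p" "x \<noteq> q" using insert by auto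
    have red: "\<exists>c\<in>H. c permutes (insert x F \<union> {p,q}) \<and> evenperm c \<and> c (s x) = x"
    proof -
      let ?A = "insert x F \<union> {p,q}"
      have y: "s x \<in> ?A" using permutes_in_image[OF insert.prems(2), of x] by simp
      have X: "cyc3 p q x \<in> H" "cyc3 p q x \<in> carrier (Alt ?A)" using cyc[of x] x pq fF
        by (auto simp del: Alt_simps intro!: cyc3_Alt)
      consider "s x = x" | "s x = q" | "s x = p" | "s x \<in> F" "s x \<noteq> p" "s x \<noteq> q" "s x \<noteq> x" using y by auto
      then show ?thesis
      proof cases
        case 1 then show ?thesis using H.one_closed by (intro bexI[of _ id]) (auto simp: permutes_id)
      next
        case 2 then show ?thesis using X x pq by (intro bexI[of _ "cyc3 p q x"]) (auto simp: cyc3_apply)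
      next
        case 3 then show ?thesis using X x pq cl[OF X(1) X(1)] fF
          by (intro bexI[of _ "cyc3 p q x \<circ> cyc3 p q x"])
            (auto simp: cyc3_apply even_comp[of ?A] intro!: permutes_compose)
      next
        case 4
        let ?c = "cyc3 p q (s x)"
        have Y: "?c \<in> H" "?c \<in> carrier (Alt ?A)" using cyc[of "s x"] 4 pq fF insert.prems
          by (auto simp del: Alt_simps intro!: cyc3_Alt)
        show ?thesis using X Y x pq 4 cl[OF cl[OF X(1) X(1)] Y(1)] fF
          by (intro bexI[of _ "cyc3 p q x \<circ> cyc3 p q x \<circ> ?c"])
            (auto simp: cyc3_apply even_comp[of ?A] permutes_compose)
      qed
    qed
    then obtain c where c: "c \<in> H" "c permutes (insert x F \<union> {p,q})" "evenperm c" "c (s x) = x" by blast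
    let ?t = "c \<circ> s"
    have t: "?t permutes (insert x F \<union> {p,q})" using c(2) insert.prems(2) by (rule permutes_compose[rotated])
    have "?t permutes (F \<union> {p,q})"
      by (rule permutes_superset[OF t]) (use c(4) in auto)
    moreover have "evenperm ?t" using c insert.prems fF by (auto simp: even_comp[of "insert x F \<union> {p,q}"])
    ultimately have "?t \<in> H" using insert by auto
    from cl[OF iv[OF c(1)] this] have "pinv c \<circ> (c \<circ> s) \<in> H" .
    moreover have "pinv c \<circ> (c \<circ> s) = s" using permutes_inv_o(2)[OF c(2)] by (simp add: o_assoc)
    ultimately show ?case by simp
  qed
  from this[of "S - {p,q}"] have "s permutes S \<Longrightarrow> evenperm s \<Longrightarrow> s \<in> H" for s
    using fin pq by (simp add: insert_absorb Un_commute)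
  then show ?thesis using H.subset by auto
qed

lemma subgroup_hom_preimage:
  assumes "group G" "group G'" "f \<in> hom G G'" "subgroup H G'"
  shows "subgroup {x \<in> carrier G. f x \<in> H} G"
proof -
  interpret group_hom G G' f using assms by (simp add: group_hom_def group_hom_axioms_def)
  show ?thesis using assms(4)
    by unfold_locales (auto simp: subgroup.m_closed subgroup.one_closed subgroup.m_inv_closed)
qed

text \<open>Two 3-cycles whose supports share exactly one point have a 3-cycle as their commutator. This is
what makes alternating groups on at least five points perfect.\<close>

lemma three_cycle_is_commutator:
  assumes "distinct [a,b,c,e,f]"
  shows "\<exists>g h. g \<in> carrier (Alt {a,b,c,e,f}) \<and> h \<in> carrier (Alt {a,b,c,e,f}) \<and>
    cyc3 a b c = g \<circ> h \<circ> pinv g \<circ> pinv h"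
proof -
  have "cyc3 a b c x = (cyc3 a b e \<circ> cyc3 a c f \<circ> cyc3 e b a \<circ> cyc3 f c a) x" for x
  proof -
    consider "x = a" | "x = b" | "x = c" | "x = e" | "x = f" | "x \<notin> {a,b,c,e,f}" by blast
    then show ?thesis using assms by cases (simp_all add: cyc3_apply eq_commute)
  qed
  then have "cyc3 a b c = cyc3 a b e \<circ> cyc3 a c f \<circ> cyc3 e b a \<circ> cyc3 f c a" by (rule ext)
  then show ?thesis using assms
    by (intro exI[of _ "cyc3 a b e"] exI[of _ "cyc3 a c f"])
     (simp add: cyc3_inv cyc3_Alt del: Alt_simps)
qed

text \<open>A 3-cycle is a square, so a multiplicative map sends it to a square, which is even. This decides
the parity of all permutations below without counting transpositions.\<close>

lemma even_image:
  assumes fin: "finite S" "finite T" and two: "p \<in> S" "q \<in> S" "p \<noteq> q"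
    and perm: "\<And>x. x \<in> carrier (Alt S) \<Longrightarrow> f x permutes T"
    and mult: "\<And>x y. x \<in> carrier (Alt S) \<Longrightarrow> y \<in> carrier (Alt S) \<Longrightarrow> f (x \<circ> y) = f x \<circ> f y"
    and x: "x \<in> carrier (Alt S)"
  shows "evenperm (f x)"
proof -
  let ?H = "{x \<in> carrier (Alt S). evenperm (f x)}"
  have G: "group (Alt S)" using fin by (simp add: group_Alt)
  have id: "f id = id"
  proof -
    have i: "(id::'a\<Rightarrow>'a) \<in> carrier (Alt S)" by (simp add: permutes_id)
    have "f id \<circ> f id = f id" using mult[OF i i] by simp
    then have "pinv (f id) \<circ> (f id \<circ> f id) = pinv (f id) \<circ> f id" by simp
    then show ?thesis using permutes_inv_o(2)[OF perm[OF i]] by (simp add: o_assoc)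
  qed
  have "subgroup ?H (Alt S)"
  proof (rule group.subgroupI[OF G])
    show "?H \<noteq> {}" using id by (auto simp: permutes_id intro!: exI[of _ id])
  next
    fix a assume a: "a \<in> ?H"
    then have a': "pinv a \<in> carrier (Alt S)" using fin by (auto simp: even_inv permutes_inv)
    have "f (a \<circ> pinv a) = f a \<circ> f (pinv a)" using a a' mult by blast
    then have "f a \<circ> f (pinv a) = id" using a id by (auto simp: permutes_inv_o)
    then have "evenperm (f a \<circ> f (pinv a))" by simp
    then have "evenperm (f (pinv a))" using a a' perm fin(2) even_comp[of T "f a" "f (pinv a)"] by auto
    then show "inv\<^bsub>Alt S\<^esub> a \<in> ?H" using a a' fin by (auto simp: inv_Alt)
  next
    fix a b assume "a \<in> ?H" "b \<in> ?H"
    then show "a \<otimes>\<^bsub>Alt S\<^esub> b \<in> ?H"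
      using fin perm[of a] perm[of b] mult by (auto simp: even_comp[of S] even_comp[of T] permutes_compose)
  qed auto
  then have "?H = carrier (Alt S)"
  proof (rule Alt_generated_by_cyc3[OF fin(1) _ two])
    fix z assume z: "z \<in> S" "z \<noteq> p" "z \<noteq> q"
    let ?c = "cyc3 z q p"
    have c: "?c \<in> carrier (Alt S)" "cyc3 p q z \<in> carrier (Alt S)" using z two fin by (auto simp del: Alt_simps intro!: cyc3_Alt)
    have "cyc3 p q z = ?c \<circ> ?c" using z two by (subst cyc3_sq) auto
    then have "f (cyc3 p q z) = f ?c \<circ> f ?c" using mult c by simp
    then show "cyc3 p q z \<in> ?H" using even_comp[OF fin(2) perm[OF c(1)] perm[OF c(1)]] c by simp
  qed
  then show ?thesis using x by blast
qed

text \<open>A cycle through all points of \<open>T\<close>, built by inserting the points one at a time. Transitivity is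
expressed through invariant sets because it is used to show that some property spreads along the
cycle.\<close>

lemma transitive_permutation_exists:
  assumes "finite T" "T \<noteq> {}"
  shows "\<exists>c. c permutes T \<and> (\<forall>A. A \<inter> T \<noteq> {} \<longrightarrow> (\<forall>z\<in>A \<inter> T. c z \<in> A) \<longrightarrow> T \<subseteq> A)"
  using assms
proof (induction T rule: finite_ne_induct)
  case (singleton x) then show ?case by (intro exI[of _ id]) (auto simp: permutes_id)
next
  case (insert x F)
  then obtain c where c: "c permutes F" and tr: "\<And>A. A \<inter> F \<noteq> {} \<Longrightarrow> (\<forall>z\<in>A \<inter> F. c z \<in> A) \<Longrightarrow> F \<subseteq> A" by blast
  obtain z where z: "z \<in> F" using insert by blast
  let ?c = "c \<circ> transpose z x"
  have xz: "x \<noteq> z" using z insert by auto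
  have cx: "c x = x" using c insert(3) by (simp add: permutes_not_in)
  have cF: "c y \<in> F" if "y \<in> F" for y using c that by (simp add: permutes_in_image)
  have "insert x F \<subseteq> A" if A: "A \<inter> insert x F \<noteq> {}" and cl: "\<forall>y\<in>A \<inter> insert x F. ?c y \<in> A" for A
  proof -
    have zx: "x \<in> A" if "z \<in> A" using cl that z cx xz by force
    have xcz: "c z \<in> A" if "x \<in> A" using cl that xz by force
    have "c y \<in> A" if "y \<in> A \<inter> F" for y
    proof (cases "y = z")
      case True then show ?thesis using zx xcz that by auto
    next
      case False
      then have "?c y = c y" using that insert(3) by (auto simp: transpose_def)
      then show ?thesis using cl that by (metis Int_iff insertCI)
    qed
    moreover have "A \<inter> F \<noteq> {}" using A xcz cF[OF z] by auto
    ultimately have "F \<subseteq> A" using tr by blast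
    then show ?thesis using zx z by auto
  qed
  moreover have "?c permutes insert x F"
    by (intro permutes_compose permutes_swap_id permutes_subset[OF c]) (use z in auto)
  ultimately show ?case by blast
qed

lemma cyc3_quotient:
  assumes "distinct [p,q,z,z']"
  shows "cyc3 p q z \<circ> pinv (cyc3 p q z') = cyc3 p z' z"
proof
  fix x
  have d: "distinct [p,q,z]" "distinct [z',q,p]" "distinct [p,z',z]" "distinct [p,q,z']" using assms by auto
  consider "x = p" | "x = q" | "x = z" | "x = z'" | "x \<notin> {p,q,z,z'}" by blast
  then show "(cyc3 p q z \<circ> pinv (cyc3 p q z')) x = cyc3 p z' z x"
    unfolding cyc3_inv[OF d(4)]
    using assms by cases (auto simp: cyc3_apply)
qed

lemma subgroup_Alt_closed:
  assumes "finite S" "subgroup H (Alt S)" "x \<in> H" "y \<in> H"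
  shows "x \<circ> y \<in> H" "pinv x \<in> H"
  using subgroup.m_closed[OF assms(2-4)] group.subgroupE(3)[OF group_Alt[OF assms(1)] assms(2,3)]
    inv_Alt[OF assms(1) subgroup.mem_carrier[OF assms(2,3)]] by simp_all

lemma Alt_closed:
  assumes "finite S" "x \<in> carrier (Alt S)" "y \<in> carrier (Alt S)"
  shows "x \<circ> y \<in> carrier (Alt S)" "pinv x \<in> carrier (Alt S)"
  using subgroup_Alt_closed[OF assms(1) group.subgroup_self[OF group_Alt[OF assms(1)]] assms(2,3)] by blast+

text \<open>Conjugation by \<open>(c w v)\<close> turns \<open>(a b c)\<close> into \<open>(a b w)\<close>; a fifth point \<open>v\<close> makes room for this.\<close>

lemma normal_subgroup_with_cyc3:
  assumes fin: "finite S" and card: "5 \<le> card S" and H: "subgroup H (Alt S)"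
    and conj: "\<And>h t. h \<in> H \<Longrightarrow> t \<in> carrier (Alt S) \<Longrightarrow> t \<circ> h \<circ> pinv t \<in> H"
    and abc: "{a,b,c} \<subseteq> S" "distinct [a,b,c]" "cyc3 a b c \<in> H"
  shows "H = carrier (Alt S)"
proof (rule Alt_generated_by_cyc3[OF fin H, of a b])
  fix w assume w: "w \<in> S" "w \<noteq> a" "w \<noteq> b"
  show "cyc3 a b w \<in> H"
  proof (cases "w = c")
    case False
    have "card {a,b,c,w} = 4" using abc(2) w False by auto
    then have "\<not> S \<subseteq> {a,b,c,w}" using card card_mono[of "{a,b,c,w}" S] by auto
    then obtain v where v: "v \<in> S" "v \<notin> {a,b,c,w}" by blast
    have d: "distinct [c,w,v]" using False v by auto
    have t: "cyc3 c w v \<in> carrier (Alt S)" using abc w v by (intro cyc3_Alt[OF d]) (auto simp: fin)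
    have "cyc3 c w v \<circ> cyc3 a b c \<circ> pinv (cyc3 c w v) \<in> H" by (rule conj[OF abc(3) t])
    also have "cyc3 c w v \<circ> cyc3 a b c \<circ> pinv (cyc3 c w v) = cyc3 a b w"
      using t v w abc(2) by (subst cyc3_conj) (auto simp: permutes_bij cyc3_apply[OF d])
    finally show ?thesis .
  qed (use abc in simp)
qed (use abc in auto)

definition Alt_generating_pair :: "'a set \<Rightarrow> ('a \<Rightarrow> 'a) \<Rightarrow> ('a \<Rightarrow> 'a) \<Rightarrow> bool" where
  "Alt_generating_pair S a b \<longleftrightarrow>
     (\<forall>H. subgroup H (Alt S) \<and> a \<in> H \<and> b \<in> H \<longrightarrow> H = carrier (Alt S))"

text \<open>The first generator is a 3-cycle \<open>(p q z)\<close>, the second one a cycle on the points other than \<open>p\<close> and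
\<open>q\<close>, corrected by the transposition of \<open>p\<close> and \<open>q\<close> if that cycle is odd. In both cases the second
generator preserves \<open>{p, q}\<close>, so the conjugates of \<open>(p q z)\<close> under its powers are, up to inversion, all \<open>(p q w)\<close>.

The exponent 6 serves the product theorem below: the sixth power of the 3-cycle is trivial, whereas
the sixth power of the second generator fixes \<open>p\<close> and \<open>q\<close> and moves \<open>z\<close> if the cycle has more than six
points; its commutator with \<open>(p q z)\<close> is then a 3-cycle again.\<close>

lemma Alt_two_generators:
  assumes fin: "finite S" and card: "3 \<le> card S"
  shows "\<exists>a\<in>carrier (Alt S). \<exists>b\<in>carrier (Alt S). a \<circ> a \<circ> a = id \<and>
    Alt_generating_pair S a b \<and>
    (9 \<le> card S \<longrightarrow> (\<exists>x y z. {x,y,z} \<subseteq> S \<and> distinct [x,y,z] \<and>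
      (b ^^ 6) \<circ> a \<circ> pinv (b ^^ 6) \<circ> pinv a = cyc3 x y z))"
proof -
  obtain p q z where S: "p \<in> S" "q \<in> S" "z \<in> S" "distinct [p,q,z]"
  proof -
    obtain T where "T \<subseteq> S" "card T = 3" using card by (meson obtain_subset_with_card_n)
    then obtain x y z where "T = {x,y,z}" "x \<noteq> y" "x \<noteq> z" "y \<noteq> z" by (auto simp: card_3_iff)
    then show ?thesis using that[of x y z] \<open>T \<subseteq> S\<close> by auto
  qed
  let ?T = "S - {p,q}"
  obtain c where c: "c permutes ?T" and tr: "\<And>A. A \<inter> ?T \<noteq> {} \<Longrightarrow> (\<forall>z\<in>A \<inter> ?T. c z \<in> A) \<Longrightarrow> ?T \<subseteq> A"
    using transitive_permutation_exists[of ?T] fin S by auto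
  have cS: "c permutes S" by (rule permutes_subset[OF c]) auto
  \<comment> \<open>The transposition corrects the parity and still preserves \<open>{p, q}\<close>.\<close>
  define b where "b = (if evenperm c then c else c \<circ> transpose p q)"
  have tS: "transpose p q permutes S" using S by (intro permutes_swap_id) auto
  have b: "b \<in> carrier (Alt S)" using cS tS fin S
    by (auto simp: b_def even_comp[of S] evenperm_swap intro!: permutes_compose)
  have bT: "b y = c y" "c y \<in> ?T" if "y \<in> ?T" for y
    using that permutes_in_image[OF c, of y] by (auto simp: b_def transpose_def)
  have bpq: "{b p, b q} = {p,q}" using c by (auto simp: b_def transpose_def permutes_def)
  have a: "cyc3 p q z \<in> carrier (Alt S)" using S fin by (intro cyc3_Alt) auto
  have gen: "Alt_generating_pair S (cyc3 p q z) b"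
    unfolding Alt_generating_pair_def
  proof (intro allI impI, elim conjE)
    fix H assume H: "subgroup H (Alt S)" "cyc3 p q z \<in> H" "b \<in> H"
    interpret H: subgroup H "Alt S" by fact
    have cl: "x \<circ> y \<in> H" if "x \<in> H" "y \<in> H" for x y using H.m_closed[OF that] by simp
    have iv: "pinv x \<in> H" if "x \<in> H" for x
      using group.subgroupE(3)[OF group_Alt[OF fin] H(1) that] H.mem_carrier[OF that] inv_Alt[OF fin] by metis
    have bb: "bij b" using b by (auto simp: permutes_bij)
    have "?T \<subseteq> {y. cyc3 p q y \<in> H}"
    proof (rule tr)
      show "{y. cyc3 p q y \<in> H} \<inter> ?T \<noteq> {}" using H(2) S by auto
      show "\<forall>y\<in>{y. cyc3 p q y \<in> H} \<inter> ?T. c y \<in> {y. cyc3 p q y \<in> H}"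
      proof
        fix y assume y: "y \<in> {y. cyc3 p q y \<in> H} \<inter> ?T"
        have "b \<circ> cyc3 p q y \<circ> pinv b \<in> H" using H(3) y by (auto intro!: cl iv)
        then have 1: "cyc3 (b p) (b q) (c y) \<in> H" using y S(4) bT(1)[of y] by (subst (asm) cyc3_conj[OF bb]) auto
        have cy: "c y \<noteq> p" "c y \<noteq> q" using bT(2)[of y] y by auto
        from bpq S(4) have "b p = p \<and> b q = q \<or> b p = q \<and> b q = p" by (auto simp: doubleton_eq_iff)
        then show "c y \<in> {y. cyc3 p q y \<in> H}"
        proof
          assume "b p = q \<and> b q = p"
          then have "pinv (cyc3 q p (c y)) \<in> H" using 1 iv by auto
          also have "pinv (cyc3 q p (c y)) = cyc3 p q (c y)" using cy S(4)
            by (subst cyc3_inv) (auto intro: cyc3_rot)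
          finally show ?thesis by simp
        qed (use 1 in auto)
      qed
    qed
    then show "H = carrier (Alt S)" using S by (intro Alt_generated_by_cyc3[OF fin H(1), of p q]) auto
  qed
  have three: "cyc3 p q z \<circ> cyc3 p q z \<circ> cyc3 p q z = id"
    using S(4) by (auto simp: fun_eq_iff cyc3_apply)
  have "\<exists>x y w. {x,y,w} \<subseteq> S \<and> distinct [x,y,w] \<and>
      (b ^^ 6) \<circ> cyc3 p q z \<circ> pinv (b ^^ 6) \<circ> pinv (cyc3 p q z) = cyc3 x y w" if nine: "9 \<le> card S"
  proof -
    have z: "z \<in> ?T" using S by auto
    have iter: "(b ^^ n) z = (c ^^ n) z \<and> (c ^^ n) z \<in> ?T" for n
    proof (induction n)
      case 0 show ?case using z by simp
    next
      case (Suc n) then show ?case using bT[of "(c ^^ n) z"] by simp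
    qed
    let ?w = "(c ^^ 6) z"
    have w: "?w \<noteq> z"
    proof
      assume e: "?w = z"
      let ?A = "(\<lambda>n. (c ^^ n) z) ` {..<6}"
      have "?T \<subseteq> ?A"
      proof (rule tr)
        show "?A \<inter> ?T \<noteq> {}" using iter[of 0] by (metis (no_types, lifting) IntI empty_iff funpow_0 image_eqI lessThan_iff zero_less_numeral)
        show "\<forall>y\<in>?A \<inter> ?T. c y \<in> ?A"
        proof
          fix y assume "y \<in> ?A \<inter> ?T"
          then obtain n where n: "n < 6" "y = (c ^^ n) z" by auto
          have cy: "c y = (c ^^ Suc n) z" using n by simp
          show "c y \<in> ?A"
          proof (cases "Suc n = 6")
            case True
            then have "c y = (c ^^ 0) z" using cy e by simp
            then show ?thesis by (intro image_eqI[of _ _ 0]) auto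
          next
            case False
            then show ?thesis using cy n by (intro image_eqI[of _ _ "Suc n"]) auto
          qed
        qed
      qed
      then have "card ?T \<le> card ?A" by (intro card_mono) auto
      also have "\<dots> \<le> 6" using card_image_le[of "{..<6::nat}" "\<lambda>n. (c ^^ n) z"] by simp
      finally have "card ?T \<le> 6" .
      moreover have "card ?T = card S - 2" using S fin by (subst card_Diff_subset) auto
      ultimately show False using nine by linarith
    qed
    have b2: "b (b p) = p" "b (b q) = q"
    proof -
      from bpq S(4) have "b p = p \<and> b q = q \<or> b p = q \<and> b q = p" by (auto simp: doubleton_eq_iff)
      then show "b (b p) = p" "b (b q) = q" by auto
    qed
    have b6: "(b ^^ 6) p = p" "(b ^^ 6) q = q" using b2 by (simp_all add: numeral_eq_Suc)
    have bb: "bij (b ^^ 6)" using b by (intro bij_fn) (auto simp: permutes_bij)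
    have wT: "?w \<in> ?T" using iter by blast
    have "(b ^^ 6) \<circ> cyc3 p q z \<circ> pinv (b ^^ 6) = cyc3 p q ?w"
      using cyc3_conj[OF bb S(4)] b6 iter[of 6] by metis
    moreover have "cyc3 p q ?w \<circ> pinv (cyc3 p q z) = cyc3 p z ?w"
      using w wT S(4) by (intro cyc3_quotient) auto
    ultimately show ?thesis using S w wT by (intro exI[of _ p] exI[of _ z] exI[of _ ?w]) auto
  qed
  then show ?thesis using a b gen three by blast
qed

text \<open>Take the generating pairs \<open>(s, g)\<close> and \<open>(s', g')\<close> of the previous lemma crosswise. Since \<open>s\<^sup>6\<close> is
trivial, the commutator of \<open>(s, g')\<^sup>6\<close> with \<open>(g, s')\<close> is a 3-cycle in the second factor. The projection to
the second factor is onto, so conjugation makes that factor, and then the first one, available.\<close>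

lemma Alt_product_two_generators:
  assumes S: "finite S" "3 \<le> card S" and S': "finite S'" "9 \<le> card S'"
  shows "\<exists>s\<in>carrier (Alt S). \<exists>g\<in>carrier (Alt S). \<exists>s'\<in>carrier (Alt S'). \<exists>g'\<in>carrier (Alt S').
    \<forall>U. subgroup U (Alt S \<times>\<times> Alt S') \<and> (s,g') \<in> U \<and> (g,s') \<in> U \<longrightarrow> U = carrier (Alt S \<times>\<times> Alt S')"
proof -
  let ?A = "Alt S" and ?B = "Alt S'"
  have S'5: "5 \<le> card S'" "3 \<le> card S'" using S'(2) by auto
  obtain s g where sg: "s \<in> carrier ?A" "g \<in> carrier ?A" "s \<circ> s \<circ> s = id" "Alt_generating_pair S s g"
    using Alt_two_generators[OF S] by blast
  obtain s' g' where sg': "s' \<in> carrier ?B" "g' \<in> carrier ?B" "Alt_generating_pair S' s' g'"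
    and ex: "\<exists>x y z. {x,y,z} \<subseteq> S' \<and> distinct [x,y,z] \<and> (g' ^^ 6) \<circ> s' \<circ> pinv (g' ^^ 6) \<circ> pinv s' = cyc3 x y z"
    using Alt_two_generators[OF S'(1) S'5(2)] S'(2) by blast
  from ex obtain x y z where xyz: "{x,y,z} \<subseteq> S'" "distinct [x,y,z]"
    "(g' ^^ 6) \<circ> s' \<circ> pinv (g' ^^ 6) \<circ> pinv s' = cyc3 x y z" by (elim exE conjE)
  have GA: "group ?A" and GB: "group ?B" using S S' group_Alt by auto
  have "U = carrier (?A \<times>\<times> ?B)"
    if U: "subgroup U (?A \<times>\<times> ?B)" and u: "(s,g') \<in> U" and v: "(g,s') \<in> U" for U
  proof -
    interpret U: subgroup U "?A \<times>\<times> ?B" by fact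
    have car: "a \<in> carrier ?A \<and> b \<in> carrier ?B" if "(a,b) \<in> U" for a b
      using U.mem_carrier[OF that] by (simp add: DirProd_def)
    have mul: "(a \<circ> a', b \<circ> b') \<in> U" if "(a,b) \<in> U" "(a',b') \<in> U" for a b a' b'
      using U.m_closed[OF that] by simp
    have inv: "(pinv a, pinv b) \<in> U" if "(a,b) \<in> U" for a b
    proof -
      have "inv\<^bsub>?A \<times>\<times> ?B\<^esub> (a,b) = (pinv a, pinv b)"
        using car[OF that] inv_DirProd[OF GA GB] inv_Alt[OF S(1)] inv_Alt[OF S'(1)] by metis
      then show ?thesis using group.subgroupE(3)[OF DirProd_group[OF GA GB] U that] by metis
    qed
    have one: "(id, id) \<in> U" using U.one_closed by simp
    have "fst ` U = carrier ?A"
    proof -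
      have "group_hom (?A \<times>\<times> ?B) ?A fst"
        using GA GB by (auto simp: group_hom_def group_hom_axioms_def DirProd_group hom_def simp del: Alt_simps)
      then have "subgroup (fst ` U) ?A" using U group_hom.subgroup_img_is_subgroup by blast
      moreover have "s \<in> fst ` U" "g \<in> fst ` U" using u v by force+
      ultimately show ?thesis using sg(4) unfolding Alt_generating_pair_def by blast
    qed
    then have proj1: "\<exists>b. (a,b) \<in> U" if "a \<in> carrier ?A" for a using that by (metis imageE prod.collapse)
    have "snd ` U = carrier ?B"
    proof -
      have "group_hom (?A \<times>\<times> ?B) ?B snd"
        using GA GB by (auto simp: group_hom_def group_hom_axioms_def DirProd_group hom_def simp del: Alt_simps)
      then have "subgroup (snd ` U) ?B" using U group_hom.subgroup_img_is_subgroup by blast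
      moreover have "s' \<in> snd ` U" "g' \<in> snd ` U" using u v by force+
      ultimately show ?thesis using sg'(3) unfolding Alt_generating_pair_def by blast
    qed
    then have proj2: "\<exists>a. (a,b) \<in> U" if "b \<in> carrier ?B" for b using that by (metis imageE prod.collapse)
    let ?V = "{b \<in> carrier ?B. (id, b) \<in> U}"
    have V: "?V = carrier ?B"
    proof (rule normal_subgroup_with_cyc3[OF S'(1) S'5(1) _ _ xyz(1,2)])
      show "subgroup ?V ?B"
      proof (rule group.subgroupI[OF GB])
        show "?V \<noteq> {}" using one car by blast
        show "inv\<^bsub>?B\<^esub> a \<in> ?V" if "a \<in> ?V" for a
          using that inv[of id a] car[of id "pinv a"] inv_Alt[OF S'(1)] by (auto simp del: Alt_simps(1))
        show "a \<otimes>\<^bsub>?B\<^esub> b \<in> ?V" if "a \<in> ?V" "b \<in> ?V" for a b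
          using that mul[of id a id b] car[of id "a \<circ> b"] by (auto simp del: Alt_simps(1))
      qed auto
    next
      fix h t assume h: "h \<in> ?V" and t: "t \<in> carrier ?B"
      from proj2[OF t] obtain a where a: "(a,t) \<in> U" by blast
      have "(a \<circ> id \<circ> pinv a, t \<circ> h \<circ> pinv t) \<in> U" using h by (intro mul a inv) auto
      moreover have "a \<circ> id \<circ> pinv a = id" using car[OF a] by (auto simp: permutes_inv_o)
      ultimately show "t \<circ> h \<circ> pinv t \<in> ?V" using car by simp
    next
      \<comment> \<open>The sixth power kills the first component, in which only the 3-cycle \<open>s\<close> appears.\<close>
      have pow: "(s ^^ n, g' ^^ n) \<in> U" for n
      proof (induction n)
        case 0 show ?case using one by (simp only: funpow.simps)
      next
        case (Suc n) show ?case using mul[OF u Suc] by (simp only: funpow.simps)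
      qed
      have "s ^^ 6 = (s \<circ> s \<circ> s) \<circ> (s \<circ> s \<circ> s)" by (simp add: numeral_eq_Suc o_assoc)
      then have s6: "s ^^ 6 = id" using sg(3) by simp
      then have g6: "(id, g' ^^ 6) \<in> U" using pow[of 6] by metis
      have "(id \<circ> g \<circ> pinv id \<circ> pinv g, (g' ^^ 6) \<circ> s' \<circ> pinv (g' ^^ 6) \<circ> pinv s') \<in> U"
        by (intro mul inv g6 v)
      moreover have "id \<circ> g \<circ> pinv id \<circ> pinv g = id" using sg(2) by (auto simp: permutes_inv_o)
      ultimately show "cyc3 x y z \<in> ?V" using car xyz(3) by simp
    qed
    have "(a,b) \<in> U" if "a \<in> carrier ?A" "b \<in> carrier ?B" for a b
    proof -
      from proj1[OF that(1)] obtain b' where b': "(a,b') \<in> U" by blast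
      then have "pinv b' \<circ> b \<in> carrier ?B" using car[OF b'] that(2) Alt_closed[OF S'(1)] by blast
      then have "(id, pinv b' \<circ> b) \<in> U" using V by blast
      moreover have "b' \<circ> (pinv b' \<circ> b) = b" using car[OF b'] by (auto simp: fun_eq_iff permutes_inverses)
      ultimately show ?thesis using mul[OF b', of id "pinv b' \<circ> b"] by simp
    qed
    then show ?thesis using U.subset by (auto simp: DirProd_def simp del: Alt_simps)
  qed
  then show ?thesis using sg(1,2) sg'(1,2) by blast
qed

section \<open>Uniform elements of P\<close>

lemma finite_words [simp]: "finite (words d l)"
  unfolding words_def using finite_lists_length_eq[of "{1..d}" l] by (simp add: conj_commute)

lemma carrier_P: "p \<in> carrier (P_group d) \<longleftrightarrow>
    p \<in> extensional {1..} \<and> (\<forall>l\<ge>1. p l permutes words d l \<and> evenperm (p l))"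
  by (auto simp: P_group_def Omega_def PiE_iff)

lemma mult_P: "x \<otimes>\<^bsub>P_group d\<^esub> y = (\<lambda>i\<in>{1..}. x i \<circ> y i)"
  by (simp add: P_group_def Omega_def)

lemma one_P: "\<one>\<^bsub>P_group d\<^esub> = (\<lambda>i\<in>{1..}. id)"
  by (simp add: P_group_def Omega_def)

lemma group_Omega: "group (Omega d l)"
  by (simp add: Omega_def group_Alt)

lemma group_P: "group (P_group d)"
  by (simp add: P_group_def group_Omega)

lemma inv_P: "p \<in> carrier (P_group d) \<Longrightarrow> inv\<^bsub>P_group d\<^esub> p = (\<lambda>i\<in>{1..}. pinv (p i))"
  unfolding P_group_def
  by (subst inv_product_group)
    (auto simp: P_group_def Omega_def inv_Alt PiE_iff group_Alt intro!: restrict_ext simp del: Alt_simps)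

definition uniform :: "nat \<Rightarrow> nat \<Rightarrow> (nat list \<Rightarrow> nat list) \<Rightarrow> nat \<Rightarrow> nat list \<Rightarrow> nat list" where
  "uniform d k f = (\<lambda>l\<in>{1..}. \<lambda>u. if k \<le> l \<and> u \<in> words d l then f u else u)"

definition preserves :: "nat \<Rightarrow> nat \<Rightarrow> (nat list \<Rightarrow> nat list) \<Rightarrow> bool" where
  "preserves d k f \<longleftrightarrow> (\<forall>l\<ge>k. \<forall>u\<in>words d l. f u \<in> words d l)"

lemma presD: "preserves d k f \<Longrightarrow> k \<le> l \<Longrightarrow> u \<in> words d l \<Longrightarrow> f u \<in> words d l"
  by (auto simp: preserves_def)

lemma preserves_comp: "preserves d k f \<Longrightarrow> preserves d k g \<Longrightarrow> preserves d k (f \<circ> g)"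
  by (auto simp: preserves_def)

lemma uniform_cong:
  "(\<And>l u. k \<le> l \<Longrightarrow> 1 \<le> l \<Longrightarrow> u \<in> words d l \<Longrightarrow> f u = g u) \<Longrightarrow> uniform d k f = uniform d k g"
  by (auto simp: uniform_def fun_eq_iff)

lemma uniform_raise:
  "k \<le> k' \<Longrightarrow> (\<And>l u. k \<le> l \<Longrightarrow> l < k' \<Longrightarrow> u \<in> words d l \<Longrightarrow> f u = u) \<Longrightarrow> uniform d k f = uniform d k' f"
  by (auto simp: uniform_def fun_eq_iff)

lemma uniform_mult: "preserves d k g \<Longrightarrow> uniform d k f \<otimes>\<^bsub>P_group d\<^esub> uniform d k g = uniform d k (f \<circ> g)"
  by (auto simp: uniform_def fun_eq_iff mult_P dest: presD)

lemma uniform_id: "uniform d k id = \<one>\<^bsub>P_group d\<^esub>"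
  by (auto simp: uniform_def one_P fun_eq_iff)

text \<open>Maps with disjoint supports commute: \<open>f\<close> acts only on the region \<open>A\<close>, and \<open>g\<close> acts only outside it.\<close>

lemma uniform_commute:
  assumes "preserves d k f" "preserves d k g"
    and "\<And>u l. k \<le> l \<Longrightarrow> u \<in> words d l \<Longrightarrow> u \<notin> A \<Longrightarrow> f u = u \<and> g u \<notin> A"
    and "\<And>u l. k \<le> l \<Longrightarrow> u \<in> words d l \<Longrightarrow> u \<in> A \<Longrightarrow> f u \<in> A \<and> g u = u"
  shows "uniform d k f \<otimes>\<^bsub>P_group d\<^esub> uniform d k g = uniform d k g \<otimes>\<^bsub>P_group d\<^esub> uniform d k f"
proof -
  have "f (g u) = g (f u)" if kl: "k \<le> l" and u: "u \<in> words d l" for u l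
    using assms(3)[OF kl u] assms(4)[OF kl u] assms(3)[OF kl presD[OF assms(2) kl u]]
      assms(4)[OF kl presD[OF assms(1) kl u]] by (cases "u \<in> A") auto
  then show ?thesis using assms(1,2) by (auto simp: uniform_mult intro!: uniform_cong)
qed

text \<open>Bijectivity at each level follows from the image of the inverse element, and parity from
\<open>even_image\<close>; only multiplicativity on words has to be known.\<close>

lemma uniform_hom:
  assumes T: "finite T" "p \<in> T" "q \<in> T" "p \<noteq> q"
    and pr: "\<And>s. s \<in> carrier (Alt T) \<Longrightarrow> preserves d k (f s)"
    and mult: "\<And>s t l u. s \<in> carrier (Alt T) \<Longrightarrow> t \<in> carrier (Alt T) \<Longrightarrow> k \<le> l \<Longrightarrow> u \<in> words d l \<Longrightarrow> f (s \<circ> t) u = f s (f t u)"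
    and id: "\<And>l u. k \<le> l \<Longrightarrow> u \<in> words d l \<Longrightarrow> f id u = u"
  shows "(\<lambda>s. uniform d k (f s)) \<in> hom (Alt T) (P_group d)"
proof (rule homI)
  have per: "uniform d k (f s) l permutes words d l" if s: "s \<in> carrier (Alt T)" and l: "1 \<le> l" for s l
  proof (cases "k \<le> l")
    case True
    have s': "pinv s \<in> carrier (Alt T)" using s T(1) by (auto simp: even_inv permutes_inv)
    have "f (pinv s) (f s u) = u" if "u \<in> words d l" for u
      using mult[OF s' s True that] id[OF True that] s by (auto simp: permutes_inv_o)
    then have "inj_on (f s) (words d l)" by (metis inj_onI)
    moreover have "f s ` words d l \<subseteq> words d l" using presD[OF pr[OF s] True] by auto
    ultimately have "bij_betw (f s) (words d l) (words d l)"
      by (simp add: bij_betw_def endo_inj_surj)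
    then have "bij_betw (uniform d k (f s) l) (words d l) (words d l)"
      using True l by (subst bij_betw_cong[where g = "f s"]) (auto simp: uniform_def)
    then show ?thesis by (rule bij_imp_permutes) (use l in \<open>auto simp: uniform_def\<close>)
  next
    case False then have "uniform d k (f s) l = id" using l by (auto simp: uniform_def)
    then show ?thesis by (simp add: permutes_id)
  qed
  have comp: "uniform d k (f (s \<circ> t)) l = uniform d k (f s) l \<circ> uniform d k (f t) l"
    if "s \<in> carrier (Alt T)" "t \<in> carrier (Alt T)" "1 \<le> l" for s t l
    using that mult[OF that(1,2)] presD[OF pr[OF that(2)]] by (auto simp: uniform_def fun_eq_iff)
  have "evenperm (uniform d k (f s) l)" if s: "s \<in> carrier (Alt T)" and l: "1 \<le> l" for s l
    by (rule even_image[OF T(1) finite_words T(2-4) _ _ s, where f = "\<lambda>s. uniform d k (f s) l"])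
      (use per comp l in auto)
  then show "uniform d k (f s) \<in> carrier (P_group d)" if "s \<in> carrier (Alt T)" for s
    using that per by (auto simp: carrier_P uniform_def)
  show "uniform d k (f (s \<otimes>\<^bsub>Alt T\<^esub> t)) = uniform d k (f s) \<otimes>\<^bsub>P_group d\<^esub> uniform d k (f t)"
    if st: "s \<in> carrier (Alt T)" "t \<in> carrier (Alt T)" for s t
    using mult[OF st] pr[OF st(2)] by (subst uniform_mult) (auto intro!: uniform_cong)
qed

section \<open>Blocks and telescopic maps\<close>

definition block :: "nat \<Rightarrow> (nat list \<Rightarrow> nat list) \<Rightarrow> nat list \<Rightarrow> nat list" where
  "block k s u = s (take k u) @ drop k u"

text \<open>The stable form of the products defining the generators of the telescope group: leading letters \<open>d\<close> are skipped
and \<open>g\<close> is applied once, to the first letter different from \<open>d\<close> and its successor.\<close>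

fun telescopic :: "nat \<Rightarrow> (nat list \<Rightarrow> nat list) \<Rightarrow> nat list \<Rightarrow> nat list" where
  "telescopic d g (x # y # w) = (if x = d then x # telescopic d g (y # w) else g [x,y] @ w)"
| "telescopic d g u = u"

definition tail_map :: "nat \<Rightarrow> nat \<Rightarrow> (nat list \<Rightarrow> nat list) \<Rightarrow> nat list \<Rightarrow> nat list" where
  "tail_map d k g u = (if take (k - 1) u = replicate (k - 1) d
     then replicate (k - 1) d @ telescopic d g (drop (k - 1) u) else u)"

text \<open>The homomorphism \<open>\<Delta>\<^sub>k\<close> from \<open>Alt(X\<^sup>k)\<close> to \<open>P\<close>.\<close>

abbreviation Delta :: "nat \<Rightarrow> nat \<Rightarrow> (nat list \<Rightarrow> nat list) \<Rightarrow> nat \<Rightarrow> nat list \<Rightarrow> nat list" where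
  "Delta d k s \<equiv> uniform d k (block k s)"

text \<open>The factors of the generator belonging to \<open>g\<close> whose index exceeds \<open>k\<close>; for \<open>k = 1\<close> these are all of them.\<close>

abbreviation tail :: "nat \<Rightarrow> nat \<Rightarrow> (nat list \<Rightarrow> nat list) \<Rightarrow> nat \<Rightarrow> nat list \<Rightarrow> nat list" where
  "tail d k g \<equiv> uniform d k (tail_map d k g)"

lemma take_words: "u \<in> words d l \<Longrightarrow> k \<le> l \<Longrightarrow> take k u \<in> words d k"
  by (auto simp: words_def dest: in_set_takeD)

lemma append_words: "u \<in> words d k \<Longrightarrow> v \<in> words d l \<Longrightarrow> u @ v \<in> words d (k + l)"
  by (auto simp: words_def)

lemma drop_words: "u \<in> words d l \<Longrightarrow> drop k u \<in> words d (l - k)"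
  by (auto simp: words_def dest: in_set_dropD)

lemma preserves_block: "s permutes words d k \<Longrightarrow> preserves d k (block k s)"
  unfolding preserves_def block_def
  by (metis append_words drop_words le_add_diff_inverse permutes_in_image take_words)

lemma Alt_mono: "T \<subseteq> S \<Longrightarrow> carrier (Alt T) \<subseteq> carrier (Alt S)"
  using permutes_subset by fastforce

lemma permutes_wordsD: "s permutes words d k \<Longrightarrow> u \<in> words d k \<Longrightarrow> length (s u) = k"
  using permutes_in_image[of s "words d k" u] by (auto simp: words_def)

lemma block_comp: "s permutes words d k \<Longrightarrow> t permutes words d k \<Longrightarrow> k \<le> l \<Longrightarrow> u \<in> words d l \<Longrightarrow>
    block k (s \<circ> t) u = block k s (block k t u)"
  by (simp add: block_def take_words permutes_wordsD)

lemma Delta_hom: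
  assumes "T \<subseteq> words d k" "p \<in> T" "q \<in> T" "p \<noteq> q"
  shows "Delta d k \<in> hom (Alt T) (P_group d)"
proof -
  have T: "finite T" using assms(1) finite_words finite_subset by blast
  have *: "s permutes words d k" if "s \<in> carrier (Alt T)" for s
    using Alt_mono[OF assms(1)] that by auto
  show ?thesis
    proof (rule uniform_hom[OF T assms(2-4)])
    fix s t l u assume "s \<in> carrier (Alt T)" "t \<in> carrier (Alt T)" "k \<le> l" "u \<in> words d l"
    then show "block k (s \<circ> t) u = block k s (block k t u)" using * block_comp by blast
  qed (use * preserves_block in \<open>auto simp: block_def\<close>)
qed

locale telescope =
  fixes d r :: nat
  assumes d5: "5 \<le> d" and r2: "2 \<le> r" and rd: "r \<le> d - 3"
begin

definition Bset :: "nat list set" where "Bset = {[i, j] |i j. i \<in> {1..r} \<and> j \<in> {1..d}}"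

abbreviation P where "P \<equiv> P_group d"

abbreviation N where "N \<equiv> N_group d r"

abbreviation Omega_carrier ("\<Omega>") where "\<Omega> k \<equiv> carrier (Alt (words d k))"

abbreviation B_carrier ("\<B>") where "\<B> \<equiv> carrier (Alt Bset)"

lemma B_group_eq: "B_group d r = Alt Bset" by (simp add: B_group_def Bset_def)

lemma Bset_words: "Bset \<subseteq> words d 2" using rd d5 by (auto simp: Bset_def words_def)

lemma finite_Bset [simp]: "finite Bset" using Bset_words finite_words finite_subset by blast

lemma Bset_two: "[1,1] \<in> Bset" "[1,2] \<in> Bset" "[1,1] \<noteq> [1,2::nat]" using d5 r2 by (auto simp: Bset_def)

lemma B_in: "g \<in> \<B> \<Longrightarrow> x \<in> {1..r} \<Longrightarrow> y \<in> {1..d} \<Longrightarrow>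
   \<exists>x' y'. g [x,y] = [x',y'] \<and> x' \<in> {1..r} \<and> y' \<in> {1..d}"
  using permutes_in_image[of g Bset "[x,y]"] by (auto simp: Bset_def)

lemma B_out: "g \<in> \<B> \<Longrightarrow> x \<notin> {1..r} \<Longrightarrow> g [x,y] = [x,y]"
  by (auto simp: permutes_def Bset_def)

lemma B_shape: assumes g: "g \<in> \<B>" and "x \<noteq> d" "x \<in> {1..d}" "y \<in> {1..d}"
  obtains x' y' where "g [x,y] = [x',y']" "x' \<noteq> d" "x' \<in> {1..d}" "y' \<in> {1..d}" "x \<in> {1..r} \<longleftrightarrow> x' \<in> {1..r}"
proof (cases "x \<in> {1..r}")
  case True with B_in[OF g this assms(4)] that rd d5 show ?thesis by fastforce
next
  case False with B_out[OF g this, of y] that assms show ?thesis by auto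
qed

lemma telescopic_set: "g \<in> \<B> \<Longrightarrow> set u \<subseteq> {1..d} \<Longrightarrow>
   length (telescopic d g u) = length u \<and> set (telescopic d g u) \<subseteq> {1..d}"
proof (induction u rule: induct_list012)
  case (3 x y w) then show ?case
  proof (cases "x = d")
    case False
    then obtain x' y' where "g [x,y] = [x',y']" "x' \<in> {1..d}" "y' \<in> {1..d}"
      using B_shape[of g x y] 3 by (metis insert_subset list.simps(15))
    then show ?thesis using 3 False by auto
  qed auto
qed auto

lemma telescopic_id: "telescopic d id u = u"
  by (induction u rule: induct_list012) auto

lemma telescopic_comp: "g \<in> \<B> \<Longrightarrow> h \<in> \<B> \<Longrightarrow> set u \<subseteq> {1..d} \<Longrightarrow>
   telescopic d (g \<circ> h) u = telescopic d g (telescopic d h u)"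
proof (induction u rule: induct_list012)
  case (3 x y w) show ?case
  proof (cases "x = d")
    case True
    obtain y' w' where "telescopic d h (y # w) = y' # w'"
      using telescopic_set[of h "y # w"] 3 by (cases "telescopic d h (y # w)") auto
    then show ?thesis using 3 True by auto
  next
    case False
    then obtain x' y' where "h [x,y] = [x',y']" "x' \<noteq> d"
      using B_shape[of h x y] 3 by (metis insert_subset list.simps(15))
    then show ?thesis using False by auto
  qed
qed auto

lemma replicate_words: "replicate k d \<in> words d k"
  using d5 by (auto simp: words_def)

lemma preserves_tail_map: assumes g: "g \<in> \<B>" shows "preserves d k (tail_map d j g)"
  unfolding preserves_def
proof (intro allI impI ballI)
  fix l u assume "k \<le> l" "u \<in> words d l"
  moreover have "set (drop (j-1) u) \<subseteq> {1..d}" using \<open>u \<in> words d l\<close> by (auto simp: words_def dest: in_set_dropD)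
  moreover have "length (take (j - 1) u) = length (replicate (j - 1) d) \<Longrightarrow> j - 1 \<le> length u" by simp
  ultimately show "tail_map d j g u \<in> words d l"
    using telescopic_set[OF g, of "drop (j-1) u"] d5 unfolding words_def tail_map_def
    by (auto simp del: length_take)
qed

lemma tail_map_comp:
  assumes g: "g \<in> \<B>" and h: "h \<in> \<B>" and u: "u \<in> words d l"
  shows "tail_map d j (g \<circ> h) u = tail_map d j g (tail_map d j h u)"
  using telescopic_comp[OF g h, of "drop (j-1) u"] u by (auto simp: tail_map_def words_def dest: in_set_dropD)

lemma tail_map_id: "tail_map d j id u = u"
  by (simp add: tail_map_def telescopic_id) (metis append_take_drop_id)

lemma tail_hom: "tail d k \<in> hom (Alt Bset) P"
  by (rule uniform_hom[OF finite_Bset Bset_two])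
   (use preserves_tail_map tail_map_comp tail_map_id in \<open>auto simp del: Alt_simps\<close>)

lemma tail_raise: "g \<in> \<B> \<Longrightarrow> tail d k g = uniform d (k + 1) (tail_map d k g)"
proof (rule uniform_raise)
  fix l u assume l: "k \<le> l" "l < k + 1" "u \<in> words d l"
  show "tail_map d k g u = u"
  proof (cases "take (k - 1) u = replicate (k - 1) d")
    case True
    define v where "v = drop (k - 1) u"
    have "length v \<le> 1" using l by (auto simp: words_def v_def)
    then have "telescopic d g v = v" by (cases v rule: remdups_adj.cases) simp_all
    then have "telescopic d g (drop (k - 1) u) = drop (k - 1) u" by (simp add: v_def)
    then show ?thesis using True by (simp add: tail_map_def) (metis append_take_drop_id)
  qed (simp add: tail_map_def)
qed simp

abbreviation emb :: "nat \<Rightarrow> (nat list \<Rightarrow> nat list) \<Rightarrow> nat list \<Rightarrow> nat list" where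
  "emb k g \<equiv> phi d (k + 1) g"

lemma emb_apply: "1 \<le> k \<Longrightarrow> u \<in> words d (k+1) \<Longrightarrow>
   emb k g u = (if take (k - 1) u = replicate (k - 1) d then replicate (k - 1) d @ g (drop (k - 1) u) else u)"
  by (auto simp: phi_def)

lemma emb_words: assumes g: "g \<in> \<B>" and k: "1 \<le> k" and u: "u \<in> words d (k+1)"
  shows "emb k g u \<in> words d (k+1)"
proof -
  have "g permutes words d 2" using Alt_mono[OF Bset_words] g by auto
  moreover have "drop (k - 1) u \<in> words d 2" using drop_words[OF u, of "k-1"] k by (simp add: numeral_2_eq_2 Suc_diff_le)
  ultimately have "g (drop (k - 1) u) \<in> words d 2" by (simp add: permutes_in_image)
  then have "replicate (k - 1) d @ g (drop (k - 1) u) \<in> words d (k - 1 + 2)"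
    using append_words replicate_words by blast
  then show ?thesis using emb_apply[OF k u] u k by (auto simp: numeral_2_eq_2)
qed

lemma emb_hom:
  assumes k: "1 \<le> k" shows "emb k \<in> hom (Alt Bset) (Omega d (k+1))"
proof -
  have comp: "emb k (g \<circ> h) = emb k g \<circ> emb k h" if g: "g \<in> \<B>" and h: "h \<in> \<B>" for g h
  proof
    fix u show "emb k (g \<circ> h) u = (emb k g \<circ> emb k h) u"
    proof (cases "u \<in> words d (k+1)")
      case True
      show ?thesis using emb_apply[OF k emb_words[OF h k True]] emb_apply[OF k True] by auto
    qed (simp add: phi_def)
  qed
  have per: "emb k g permutes words d (k+1)" if g: "g \<in> \<B>" for g
  proof (rule bij_imp_permutes)
    have g': "pinv g \<in> \<B>" using g by (auto simp: even_inv[OF finite_Bset] permutes_inv)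
    have "pinv g \<circ> g = id" using g by (auto simp: permutes_inv_o)
    then have "emb k (pinv g) (emb k g u) = emb k id u" for u
      using comp[OF g' g] by (metis o_apply)
    moreover have "emb k id u = u" if "u \<in> words d (k+1)" for u
      using emb_apply[OF k that, of id] by (simp split: if_splits) (metis append_take_drop_id)
    ultimately have "emb k (pinv g) (emb k g u) = u" if "u \<in> words d (k+1)" for u using that by simp
    then have "inj_on (emb k g) (words d (k+1))" by (metis inj_onI)
    moreover have "emb k g ` words d (k+1) \<subseteq> words d (k+1)" using emb_words[OF g k] by auto
    ultimately show "bij_betw (emb k g) (words d (k+1)) (words d (k+1))"
      by (simp add: bij_betw_def endo_inj_surj)
  qed (auto simp: phi_def)
  have "evenperm (emb k g)" if g: "g \<in> \<B>" for g
    by (rule even_image[OF finite_Bset finite_words Bset_two _ _ g, where f = "emb k"]) (use per comp in auto)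
  then show ?thesis using per comp by (intro homI) (auto simp: Omega_def)
qed

text \<open>If the letter after the prefix \<open>d\<^sup>k\<^sup>-\<^sup>1\<close> is \<open>d\<close>, then the block does nothing because \<open>d\<close> exceeds \<open>r\<close>; otherwise
the remaining tail does nothing because it acts behind \<open>d\<^sup>k\<close>.\<close>

lemma tail_map_peel:
  assumes g: "g \<in> \<B>" and k: "1 \<le> k" and l: "k + 1 \<le> l" and u: "u \<in> words d l"
  shows "tail_map d k g u = block (k+1) (emb k g) (tail_map d (k+1) g u)"
proof (cases "take (k - 1) u = replicate (k - 1) d")
  case False
  have "take k u \<noteq> replicate k d"
  proof
    assume "take k u = replicate k d"
    then have "take (k-1) (take k u) = take (k-1) (replicate k d)" by simp
    with False k show False by (simp add: min_def)
  qed
  moreover have "take (k+1) u \<in> words d (k+1)" using take_words u l by blast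
  moreover have "take (k - 1) (take (k + 1) u) = take (k - 1) u" by (simp add: min_absorb1)
  ultimately have "tail_map d (k+1) g u = u" "emb k g (take (k+1) u) = take (k+1) u"
    using False k emb_apply[OF k, of "take (k+1) u"] by (auto simp: tail_map_def)
  then show ?thesis using False by (simp add: tail_map_def block_def)
next
  case True
  define v where "v = drop (k-1) u"
  have lv: "length v = l - (k - 1)" using u by (simp add: v_def words_def)
  obtain x y w where v: "v = x # y # w"
    using lv l k by (cases v rule: remdups_adj.cases) auto
  have uv: "u = replicate (k-1) d @ v" using True unfolding v_def by (metis append_take_drop_id)
  have su: "set u \<subseteq> {1..d}" using u by (simp add: words_def)
  then have xy: "x \<in> {1..d}" "y \<in> {1..d}" "set w \<subseteq> {1..d}" by (auto simp: uv v)
  have kk: "replicate (k-1) d @ [d] = replicate k d"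
    using k by (metis replicate_append_same replicate_Suc Suc_diff_1 less_le_trans zero_less_one)
  have tk: "take k u = replicate (k-1) d @ [x]" "drop k u = y # w" using k by (auto simp: uv v)
  have embx: "emb k g (replicate (k-1) d @ [a,b]) = replicate (k-1) d @ g [a,b]" if "a \<in> {1..d}" "b \<in> {1..d}" for a b
  proof -
    have "replicate (k-1) d @ [a,b] \<in> words d (k-1+2)"
      by (rule append_words[OF replicate_words]) (use that in \<open>auto simp: words_def\<close>)
    then show ?thesis using k by (subst emb_apply) auto
  qed
  have tk1: "take (k+1) (replicate (k-1) d @ a # b # c) = replicate (k-1) d @ [a,b]"
    "drop (k+1) (replicate (k-1) d @ a # b # c) = c" for a b c using k by (auto simp: Suc_diff_le)
  show ?thesis
  proof (cases "x = d")
    case True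
    obtain y' w' where t: "telescopic d g (y # w) = y' # w'"
      using telescopic_set[of g "y # w"] g xy by (cases "telescopic d g (y # w)") auto
    have y': "y' \<in> {1..d}" using telescopic_set[of g "y # w"] g xy t by auto
    have "tail_map d (k+1) g u = replicate (k-1) d @ d # y' # w'"
      using tk True kk t by (simp add: tail_map_def flip: kk)
    moreover have "tail_map d k g u = replicate (k-1) d @ d # y' # w'" using \<open>take (k - 1) u = _\<close> v True t v_def by (simp add: tail_map_def)
    moreover have "g [d,y'] = [d,y']" using B_out[OF g, of d] rd d5 by auto
    ultimately show ?thesis unfolding block_def using tk1 embx[of d y'] y' d5 by simp
  next
    case False
    have "tail_map d (k+1) g u = u" using tk False kk by (auto simp: tail_map_def simp flip: kk)
    moreover have "tail_map d k g u = replicate (k-1) d @ g [x,y] @ w" using \<open>take (k - 1) u = _\<close> v False v_def by (simp add: tail_map_def)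
    ultimately show ?thesis unfolding block_def uv v using tk1 embx[of x y] xy by simp
  qed
qed

lemma tail_peel:
  assumes g: "g \<in> \<B>" and k: "1 \<le> k"
  shows "tail d k g = Delta d (k+1) (emb k g) \<otimes>\<^bsub>P\<^esub> tail d (k+1) g"
  by (subst tail_raise[OF g], subst uniform_mult[OF preserves_tail_map[OF g]])
     (use tail_map_peel[OF g k] in \<open>auto intro!: uniform_cong\<close>)

text \<open>Evaluated from its last factor on, the product is a telescopic map at every stage, and each
further factor undoes one peeling step.\<close>

lemma g_tilde_eq: assumes g: "g \<in> \<B>" shows "g_tilde d g = tail d 1 g"
proof -
  have *: "j \<le> i \<Longrightarrow> foldr (\<circ>) (map (\<lambda>k. iota d k i (phi d k g)) [i - j + 1..<Suc i]) id u
     = (if u \<in> words d i then tail_map d (i - j) g u else u)" if "1 \<le> i - j" for i j u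
    using that
  proof (induction j)
    case 0
    have "tail d i g i u = uniform d (i+1) (tail_map d i g) i u" using tail_raise[OF g] by metis
    then show ?case using 0 by (auto simp: uniform_def split: if_splits)
  next
    case (Suc j)
    let ?k = "i - Suc j"
    have e: "[?k + 1..<Suc i] = (?k + 1) # [?k + 1 + 1..<Suc i]" using Suc.prems
      by (subst upt_conv_Cons) auto
    have kj: "i - j = ?k + 1" using Suc.prems by simp
    have IH: "foldr (\<circ>) (map (\<lambda>k. iota d k i (phi d k g)) [?k + 1 + 1..<Suc i]) id u
      = (if u \<in> words d i then tail_map d (?k + 1) g u else u)"
      by (rule Suc.IH[unfolded kj]) (use Suc.prems in simp_all)
    have "tail_map d (?k+1) g u \<in> words d i" if "u \<in> words d i" using presD[OF preserves_tail_map[OF g] order_refl that] by simp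
    then have step: "iota d (?k + 1) i (phi d (?k + 1) g) (if u \<in> words d i then tail_map d (?k + 1) g u else u)
        = (if u \<in> words d i then tail_map d ?k g u else u)"
      using tail_map_peel[OF g, of ?k i u] Suc.prems by (simp add: block_def iota_def)
    have peel: "foldr (\<circ>) (map F (x # L)) id u = F x (foldr (\<circ>) (map F L) id u)"
      for F :: "nat \<Rightarrow> nat list \<Rightarrow> nat list" and x L by simp
    show ?case unfolding e peel IH using step .
  qed
  show ?thesis
  proof (rule ext)
    fix i
    show "g_tilde d g i = tail d 1 g i"
    proof (cases "1 \<le> i")
      case True
      with *[of i "i - 1"] show ?thesis by (auto simp: g_tilde_def uniform_def fun_eq_iff numeral_2_eq_2)
    qed (simp add: g_tilde_def uniform_def)
  qed
qed

lemma Delta1_eq: "Delta1 d = Delta d 1"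
  by (auto simp: Delta1_def uniform_def iota_def block_def fun_eq_iff)

end

section \<open>The commutator trick\<close>

lemma Alt_generated_by_commutators:
  assumes fin: "finite S" and card: "5 \<le> card S" and H: "subgroup H (Alt S)"
    and comm: "\<And>g h. g \<in> carrier (Alt S) \<Longrightarrow> h \<in> carrier (Alt S) \<Longrightarrow> g \<circ> h \<circ> pinv g \<circ> pinv h \<in> H"
  shows "H = carrier (Alt S)"
proof -
  have "S \<noteq> {}" using card by auto
  then obtain p where p: "p \<in> S" by blast
  have "card (S - {p}) \<noteq> 0" using card p fin by (simp add: card_Diff_singleton)
  then obtain q where q: "q \<in> S" "p \<noteq> q" by (metis Diff_iff card.empty all_not_in_conv singletonI)
  show ?thesis
  proof (rule Alt_generated_by_cyc3[OF fin H p q])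
    fix z assume z: "z \<in> S" "z \<noteq> p" "z \<noteq> q"
    have "card (S - {p,q,z}) \<ge> 2" using card p q z fin by (subst card_Diff_subset) auto
    then obtain T where T: "T \<subseteq> S - {p,q,z}" "card T = 2" by (meson obtain_subset_with_card_n)
    then obtain e f where ef: "T = {e,f}" "e \<noteq> f" by (auto simp: card_2_iff)
    have "distinct [p,q,z,e,f]" and sub: "{p,q,z,e,f} \<subseteq> S" using T ef p q z by auto
    then obtain g h where "g \<in> carrier (Alt {p,q,z,e,f})" "h \<in> carrier (Alt {p,q,z,e,f})"
      "cyc3 p q z = g \<circ> h \<circ> pinv g \<circ> pinv h" using three_cycle_is_commutator by metis
    then show "cyc3 p q z \<in> H" using comm Alt_mono[OF sub] by (metis in_mono)
  qed
qed

lemma (in group) commutator_of_commuting_products: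
  assumes "a \<in> carrier G" "b \<in> carrier G" "x \<in> carrier G" "y \<in> carrier G"
    and "a \<otimes> y = y \<otimes> a" "b \<otimes> x = x \<otimes> b" "x \<otimes> y = y \<otimes> x" "a \<otimes> x = x \<otimes> a" "b \<otimes> y = y \<otimes> b"
  shows "(a \<otimes> x) \<otimes> (b \<otimes> y) \<otimes> inv ((b \<otimes> y) \<otimes> (a \<otimes> x)) = a \<otimes> b \<otimes> inv (b \<otimes> a)"
proof -
  have "(a \<otimes> x) \<otimes> (b \<otimes> y) = a \<otimes> (x \<otimes> b) \<otimes> y" using assms(1-4) by (simp add: m_assoc)
  also have "\<dots> = (a \<otimes> b) \<otimes> (x \<otimes> y)" using assms(1-4) by (simp add: m_assoc flip: assms(6))
  finally have 1: "(a \<otimes> x) \<otimes> (b \<otimes> y) = (a \<otimes> b) \<otimes> (x \<otimes> y)" .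
  have "(b \<otimes> y) \<otimes> (a \<otimes> x) = b \<otimes> (y \<otimes> a) \<otimes> x" using assms(1-4) by (simp add: m_assoc)
  also have "\<dots> = (b \<otimes> a) \<otimes> (y \<otimes> x)" using assms(1-4) by (simp add: m_assoc flip: assms(5))
  finally have 2: "(b \<otimes> y) \<otimes> (a \<otimes> x) = (b \<otimes> a) \<otimes> (x \<otimes> y)" by (simp only: assms(7))
  have 3: "(p \<otimes> q) \<otimes> inv (s \<otimes> q) = p \<otimes> inv s" if pqs: "p \<in> carrier G" "q \<in> carrier G" "s \<in> carrier G" for p q s
  proof -
    have "(p \<otimes> q) \<otimes> inv (s \<otimes> q) = p \<otimes> (q \<otimes> inv q) \<otimes> inv s"
      unfolding inv_mult_group[OF pqs(3,2)] using pqs by (simp only: m_assoc m_closed inv_closed)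
    then show ?thesis using pqs by simp
  qed
  show ?thesis unfolding 1 2 using assms(1-4) by (intro 3) auto
qed

context telescope
begin

sublocale P: group "P" by (rule group_P)

abbreviation pmult (infixl "\<cdot>" 70) where "x \<cdot> y \<equiv> x \<otimes>\<^bsub>P\<^esub> y"
abbreviation pinverse ("_\<^sup>-" [1000] 999) where "x\<^sup>- \<equiv> inv\<^bsub>P\<^esub> x"

lemma card_Bset: "9 \<le> card Bset" "5 \<le> card Bset"
proof -
  have "Bset = (\<lambda>(i,j). [i,j]) ` ({1..r} \<times> {1..d})" by (auto simp: Bset_def)
  then have "card Bset = r * d" by (simp add: card_image inj_on_def card_cartesian_product)
  moreover have "2 * 5 \<le> r * d" using r2 d5 by (intro mult_le_mono) auto
  ultimately show "9 \<le> card Bset" "5 \<le> card Bset" by simp_all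
qed

lemma words_split:
  assumes "u \<in> words d l" "1 \<le> k" "k + 1 \<le> l"
  obtains p x y w where "u = p @ x # y # w" "length p = k - 1" "x \<in> {1..d}" "y \<in> {1..d}"
proof -
  define v where "v = drop (k-1) u"
  have "length v \<ge> 2" using assms by (auto simp: v_def words_def)
  then obtain x y w where v: "v = x # y # w" by (cases v rule: remdups_adj.cases) auto
  have u: "u = take (k-1) u @ x # y # w" using v v_def by (metis append_take_drop_id)
  have lp: "length (take (k-1) u) = k - 1" using assms by (auto simp: words_def)
  have "set u \<subseteq> {1..d}" using assms by (simp add: words_def)
  moreover have "set (x # y # w) \<subseteq> set u" by (metis u set_append Un_upper2)
  ultimately have "x \<in> {1..d}" "y \<in> {1..d}" by auto
  then show ?thesis using that u lp by blast
qed

lemma emb_Omega: "1 \<le> k \<Longrightarrow> g \<in> \<B> \<Longrightarrow> emb k g \<in> \<Omega> (k+1)"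
  using emb_hom[of k] by (auto simp: hom_def Omega_def)

lemma words_two: "\<exists>p\<in>words d k. \<exists>q\<in>words d k. p \<noteq> q" if "1 \<le> k"
proof -
  have "replicate k 1 \<in> words d k" "replicate k 2 \<in> words d k" using d5 by (auto simp: words_def)
  moreover have "replicate k 1 \<noteq> replicate k (2::nat)" using that by (cases k) auto
  ultimately show ?thesis by blast
qed

lemma Delta_hom': "1 \<le> k \<Longrightarrow> Delta d k \<in> hom (Alt (words d k)) P"
  using words_two[of k] Delta_hom[of "words d k"] by blast

text \<open>The factor with index \<open>k + 1\<close> of the generator belonging to \<open>g\<close>: the permutation \<open>g\<close> of the two letters
after the prefix \<open>d\<^sup>k\<^sup>-\<^sup>1\<close>, at all levels above \<open>k\<close>.\<close>

abbreviation "E k g \<equiv> Delta d (k+1) (emb k g)"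

lemma E_hom: "1 \<le> k \<Longrightarrow> (\<lambda>g. E k g) \<in> hom (Alt Bset) P"
  using emb_hom[of k] Delta_hom'[of "k+1"] by (auto simp: hom_def Omega_def Pi_iff simp del: Alt_simps)

lemma block_emb_apply:
  assumes k: "1 \<le> k" and p: "length p = k - 1" and u: "p @ x # y # w \<in> words d l"
  shows "block (k+1) (emb k g) (p @ x # y # w) =
    (if p = replicate (k-1) d then p @ g [x,y] @ w else p @ x # y # w)"
proof -
  have t: "take (k+1) (p @ x # y # w) = p @ [x,y]" "drop (k+1) (p @ x # y # w) = w"
    using k p by (auto simp: Suc_diff_le)
  have "p @ [x,y] \<in> words d (k+1)" using u k p by (auto simp: words_def)
  then have "emb k g (p @ [x,y]) = (if p = replicate (k-1) d then p @ g [x,y] else p @ [x,y])"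
    using p by (subst emb_apply[OF k]) auto
  then show ?thesis unfolding block_def t by simp
qed

text \<open>The region of words that the block \<open>E k g\<close> moves; it contains no word that begins with \<open>d\<^sup>k\<close>.\<close>

definition row_prefixed :: "nat \<Rightarrow> nat list set" where
  "row_prefixed k = {u. \<exists>x\<in>{1..r}. take k u = replicate (k-1) d @ [x]}"

lemma take_split: "1 \<le> k \<Longrightarrow> length p = k - 1 \<Longrightarrow> take k (p @ x # w) = p @ [x]"
  by (auto simp: take_Cons')

lemma block_short: "s permutes words d j \<Longrightarrow> length u < j \<Longrightarrow> block j s u = u"
  by (auto simp: block_def permutes_def words_def)

lemma block_emb_row:
  assumes g: "g \<in> \<B>" and k: "1 \<le> k" and l: "k \<le> l" and u: "u \<in> words d l"
  shows "if u \<in> row_prefixed k then block (k+1) (emb k g) u \<in> row_prefixed k else block (k+1) (emb k g) u = u"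
proof (cases "l = k")
  case True
  then have "block (k+1) (emb k g) u = u" using u emb_Omega[OF k g] by (intro block_short) (auto simp: words_def)
  then show ?thesis by simp
next
  case False
  then obtain p x y w where s: "u = p @ x # y # w" "length p = k - 1" "x \<in> {1..d}" "y \<in> {1..d}"
    using words_split[OF u k] l by (metis Suc_eq_plus1 le_neq_implies_less Suc_leI)
  have iff: "p @ a # b \<in> row_prefixed k \<longleftrightarrow> p = replicate (k-1) d \<and> a \<in> {1..r}" for a b
    using take_split[OF k s(2)] s(2) by (auto simp: row_prefixed_def)
  show ?thesis
  proof (cases "u \<in> row_prefixed k")
    case True
    then obtain x' y' where "g [x,y] = [x',y']" "x' \<in> {1..r}" using B_in[OF g, of x y] s iff by blast
    then show ?thesis using True block_emb_apply[OF k s(2) u[unfolded s(1)]] s(1) iff by auto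
  next
    case F: False
    then have "p = replicate (k-1) d \<Longrightarrow> g [x,y] = [x,y]" using B_out[OF g] iff s(1) by blast
    then show ?thesis using F block_emb_apply[OF k s(2) u[unfolded s(1)]] s(1) by auto
  qed
qed

lemma E_low: assumes "g \<in> \<B>" "1 \<le> k" shows "E k g = uniform d k (block (k+1) (emb k g))"
proof (rule uniform_raise[symmetric])
  fix l u assume "k \<le> l" "l < k + 1" "u \<in> words d l"
  then show "block (k+1) (emb k g) u = u" using emb_Omega[OF assms(2,1)] by (intro block_short) (auto simp: words_def)
qed simp

lemma tail_low: assumes "g \<in> \<B>" shows "tail d (k+1) g = uniform d k (tail_map d (k+1) g)"
proof (rule uniform_raise[symmetric])
  fix l u assume "k \<le> l" "l < k + 1" "u \<in> words d l"
  then show "tail_map d (k+1) g u = u" by (auto simp: words_def tail_map_def)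
qed simp

lemma tail_map_take: "take k (tail_map d (k+1) g u) = take k u"
  by (auto simp: tail_map_def)

lemma tail_map_other: "take k u \<noteq> replicate k d \<Longrightarrow> tail_map d (k+1) g u = u"
  by (auto simp: tail_map_def)

lemma row_not_d: "u \<in> row_prefixed k \<Longrightarrow> 1 \<le> k \<Longrightarrow> take k u \<noteq> replicate k d"
proof
  assume "u \<in> row_prefixed k" "1 \<le> k" "take k u = replicate k d"
  then obtain x where "x \<in> {1..r}" "replicate k d = replicate (k-1) d @ [x]" by (auto simp: row_prefixed_def)
  then have "x = d" using \<open>1 \<le> k\<close> by (metis last_replicate last_snoc not_one_le_zero)
  then show False using \<open>x \<in> {1..r}\<close> rd d5 by auto
qed

text \<open>Both \<open>d - 1\<close> and \<open>d - 2\<close> are larger than \<open>r\<close>, so this 3-cycle moves \<open>d\<^sup>k\<close> away without touching any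
\<open>d\<^sup>k\<^sup>-\<^sup>1 x\<close> with \<open>x \<le> r\<close>.\<close>

definition corner_cycle :: "nat \<Rightarrow> nat list \<Rightarrow> nat list" where
  "corner_cycle k = cyc3 (replicate (k-1) d @ [d]) (replicate (k-1) d @ [d-1]) (replicate (k-1) d @ [d-2])"

lemma prefix_words: "1 \<le> k \<Longrightarrow> x \<in> {1..d} \<Longrightarrow> replicate (k-1) d @ [x] \<in> words d k"
  using d5 by (auto simp: words_def)

lemma corner_cycle_distinct: "distinct [replicate (k-1) d @ [d], replicate (k-1) d @ [d-1], replicate (k-1) d @ [d-2]]"
  using d5 by auto

lemma corner_cycle_Omega: assumes "1 \<le> k" shows "corner_cycle k \<in> \<Omega> k"
  unfolding corner_cycle_def by (rule cyc3_Alt[OF corner_cycle_distinct]) (use d5 prefix_words[OF assms] in auto)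

lemma replicate_snoc: "1 \<le> k \<Longrightarrow> replicate (k-1) d @ [d] = replicate k d"
  by (metis replicate_append_same replicate_Suc Suc_diff_1 less_le_trans zero_less_one)

lemma corner_cycle_row: "x \<in> {1..r} \<Longrightarrow> corner_cycle k (replicate (k-1) d @ [x]) = replicate (k-1) d @ [x]"
  unfolding corner_cycle_def using rd d5 by (subst cyc3_apply) auto

lemma corner_cycle_inv_d: "1 \<le> k \<Longrightarrow> pinv (corner_cycle k) (replicate k d) \<noteq> replicate k d"
  using d5 corner_cycle_distinct[of k]
  by (simp add: corner_cycle_def cyc3_inv cyc3_apply replicate_snoc[symmetric] del: One_nat_def)

lemma perm_take: "s permutes words d k \<Longrightarrow> u \<in> words d l \<Longrightarrow> k \<le> l \<Longrightarrow> take k (block k s u) = s (take k u)"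
  by (simp add: block_def take_words permutes_wordsD)

text \<open>Both factors split into a block and a rest. The blocks are not affected by \<open>\<Delta>\<^sub>k\<close> of the 3-cycle; the
rest of \<open>g\<close> acts behind \<open>d\<^sup>k\<close>, and the conjugated rest of \<open>h\<close> acts behind another word of length \<open>k\<close>. All cross terms
commute, so only the commutator of the blocks survives.\<close>

lemma tail_comm:
  assumes g: "g \<in> \<B>" and h: "h \<in> \<B>" and k: "1 \<le> k"
  defines "t \<equiv> Delta d k (corner_cycle k) \<cdot> tail d k h \<cdot> (Delta d k (corner_cycle k))\<^sup>-"
  shows "tail d k g \<cdot> t \<cdot> (t \<cdot> tail d k g)\<^sup>- = E k (g \<circ> h \<circ> pinv g \<circ> pinv h)"
proof -
  let ?w = "Delta d k (corner_cycle k)" let ?s = "corner_cycle k"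
  interpret D: group_hom "Alt (words d k)" "P" "Delta d k"
    using Delta_hom'[OF k] by (simp add: group_hom_def group_hom_axioms_def group_Alt group_P)
  interpret E: group_hom "Alt Bset" "P" "\<lambda>g. E k g"
    using E_hom[OF k] by (simp add: group_hom_def group_hom_axioms_def group_Alt group_P)
  have s: "?s permutes words d k" "?s \<in> \<Omega> k" using corner_cycle_Omega[OF k] by auto
  have si: "pinv ?s permutes words d k" using s permutes_inv by blast
  have w: "?w \<in> carrier P" and wi: "?w\<^sup>- = Delta d k (pinv ?s)"
    using D.hom_closed[OF s(2)] D.hom_inv[OF s(2)] s(2) by (auto simp: inv_Alt simp del: Alt_simps)
  have tl: "tail d (k+1) f \<in> carrier P" if "f \<in> \<B>" for f
    using hom_in_carrier[OF tail_hom that] .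
  have Ec: "E k f \<in> carrier P" if "f \<in> \<B>" for f
    using E.hom_closed[OF that] .
  have pE: "preserves d k (block (k+1) (emb k f))" if f: "f \<in> \<B>" for f
    unfolding preserves_def
  proof (intro allI impI ballI)
    fix l u assume l: "k \<le> l" "u \<in> words d l"
    show "block (k+1) (emb k f) u \<in> words d l"
    proof (cases "l = k")
      case True
      then have "block (k+1) (emb k f) u = u" using l emb_Omega[OF k f] by (intro block_short) (auto simp: words_def)
      then show ?thesis using l by simp
    next
      case False
      then show ?thesis using presD[OF preserves_block, of "emb k f" d "k+1" l u] emb_Omega[OF k f] l by auto
    qed
  qed
  have ER: "E k f \<cdot> tail d (k+1) f' = tail d (k+1) f' \<cdot> E k f"
    if f: "f \<in> \<B>" and f': "f' \<in> \<B>" for f f'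
    unfolding E_low[OF f k] tail_low[OF f']
  proof (rule uniform_commute[OF pE[OF f] preserves_tail_map[OF f'], where A = "row_prefixed k"])
    fix u l assume l: "k \<le> l" "u \<in> words d l"
    note row = block_emb_row[OF f k l]
    show "block (k+1) (emb k f) u = u \<and> tail_map d (k+1) f' u \<notin> row_prefixed k" if "u \<notin> row_prefixed k"
      using row that by (auto simp: row_prefixed_def tail_map_take[of k, simplified])
    show "block (k+1) (emb k f) u \<in> row_prefixed k \<and> tail_map d (k+1) f' u = u" if "u \<in> row_prefixed k"
      using row that tail_map_other row_not_d[OF that k] by auto
  qed
  have Ew: "E k f \<cdot> ?w = ?w \<cdot> E k f" if f: "f \<in> \<B>" for f
    unfolding E_low[OF f k]
  proof (rule uniform_commute[OF pE[OF f] preserves_block[OF s(1)], where A = "row_prefixed k"])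
    fix u l assume l: "k \<le> l" "u \<in> words d l"
    note row = block_emb_row[OF f k l]
    have inj: "?s a = ?s b \<longleftrightarrow> a = b" for a b using s(1) by (metis permutes_inj injD)
    show "block (k+1) (emb k f) u = u \<and> block k ?s u \<notin> row_prefixed k" if "u \<notin> row_prefixed k"
      using row that perm_take[OF s(1) l(2,1)] corner_cycle_row inj
      by (auto simp: row_prefixed_def) (metis Suc_le_eq atLeastAtMost_iff)
    show "block (k+1) (emb k f) u \<in> row_prefixed k \<and> block k ?s u = u" if "u \<in> row_prefixed k"
    proof -
      have "?s (take k u) = take k u" using that corner_cycle_row by (auto simp: row_prefixed_def)
      then show ?thesis using that row by (auto simp: block_def)
    qed
  qed
  define S where "S = ?w \<cdot> tail d (k+1) h \<cdot> ?w\<^sup>-"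
  have S: "S \<in> carrier P" using w tl[OF h] by (simp add: S_def)
  have Su: "S = uniform d k (block k ?s \<circ> tail_map d (k+1) h \<circ> block k (pinv ?s))"
    unfolding S_def wi tail_low[OF h]
    using preserves_tail_map[OF h] preserves_block[OF s(1)] preserves_block[OF si] by (simp add: uniform_mult preserves_comp)
  have RS: "tail d (k+1) g \<cdot> S = S \<cdot> tail d (k+1) g"
    unfolding Su tail_low[OF g]
  proof (rule uniform_commute[OF preserves_tail_map[OF g], where A = "{u. take k u = replicate k d}"])
    show "preserves d k (block k ?s \<circ> tail_map d (k+1) h \<circ> block k (pinv ?s))"
      using preserves_tail_map[OF h] preserves_block[OF s(1)] preserves_block[OF si] by (intro preserves_comp)
  next
    fix u l assume l: "k \<le> l" "u \<in> words d l"
    have w1: "block k (pinv ?s) u \<in> words d l" using presD[OF preserves_block[OF si] l] .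
    have w2: "tail_map d (k+1) h (block k (pinv ?s) u) \<in> words d l" using presD[OF preserves_tail_map[OF h] l(1) w1] .
    have "take k ((block k ?s \<circ> tail_map d (k+1) h \<circ> block k (pinv ?s)) u) = ?s (take k (block k (pinv ?s) u))"
      using perm_take[OF s(1) w2 l(1)] tail_map_take[of k h] by simp
    also have "\<dots> = take k u" using perm_take[OF si l(2,1)] s(1) by (simp add: permutes_inverses(1))
    finally have tk: "take k ((block k ?s \<circ> tail_map d (k+1) h \<circ> block k (pinv ?s)) u) = take k u" .
    show "tail_map d (k+1) g u = u \<and> (block k ?s \<circ> tail_map d (k+1) h \<circ> block k (pinv ?s)) u \<notin> {u. take k u = replicate k d}"
      if "u \<notin> {u. take k u = replicate k d}" using that tk tail_map_other[of k u] by auto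
    show "tail_map d (k+1) g u \<in> {u. take k u = replicate k d} \<and> (block k ?s \<circ> tail_map d (k+1) h \<circ> block k (pinv ?s)) u = u"
      if "u \<in> {u. take k u = replicate k d}"
    proof -
      have "take k (block k (pinv ?s) u) \<noteq> replicate k d"
        using perm_take[OF si l(2,1)] that corner_cycle_inv_d[OF k] by simp
      then have "tail_map d (k+1) h (block k (pinv ?s) u) = block k (pinv ?s) u" by (rule tail_map_other)
      then have "(block k ?s \<circ> tail_map d (k+1) h \<circ> block k (pinv ?s)) u = block k (?s \<circ> pinv ?s) u"
        using block_comp[OF s(1) si l] by simp
      then show ?thesis using that tail_map_take[of k g u] permutes_inv_o(1)[OF s(1)] by (simp add: block_def)
    qed
  qed
  have ES: "E k f \<cdot> S = S \<cdot> E k f" if f: "f \<in> \<B>" for f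
  proof -
    let ?R = "tail d (k+1) h"
    have wE: "?w\<^sup>- \<cdot> E k f = E k f \<cdot> ?w\<^sup>-" using Ew[OF f] w Ec[OF f]
      by (metis P.inv_closed P.inv_solve_left P.inv_solve_right P.m_assoc P.m_closed)
    have "E k f \<cdot> S = ((E k f \<cdot> ?w) \<cdot> ?R) \<cdot> ?w\<^sup>-"
      using w Ec[OF f] tl[OF h] by (simp add: S_def P.m_assoc)
    also have "\<dots> = ((?w \<cdot> E k f) \<cdot> ?R) \<cdot> ?w\<^sup>-" by (simp only: Ew[OF f])
    also have "\<dots> = ?w \<cdot> (E k f \<cdot> ?R) \<cdot> ?w\<^sup>-" using w Ec[OF f] tl[OF h] by (simp add: P.m_assoc)
    also have "\<dots> = ?w \<cdot> (?R \<cdot> E k f) \<cdot> ?w\<^sup>-" by (simp only: ER[OF f h])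
    also have "\<dots> = ?w \<cdot> ?R \<cdot> (E k f \<cdot> ?w\<^sup>-)" using w Ec[OF f] tl[OF h] by (simp add: P.m_assoc)
    also have "\<dots> = ?w \<cdot> ?R \<cdot> (?w\<^sup>- \<cdot> E k f)" by (simp only: wE)
    also have "\<dots> = S \<cdot> E k f" using w Ec[OF f] tl[OF h] by (simp add: S_def P.m_assoc)
    finally show ?thesis .
  qed
  have t: "t = E k h \<cdot> S"
  proof -
    have "t = ((?w \<cdot> E k h) \<cdot> tail d (k+1) h) \<cdot> ?w\<^sup>-"
      unfolding t_def tail_peel[OF h k] using w Ec[OF h] tl[OF h] by (simp add: P.m_assoc)
    also have "\<dots> = ((E k h \<cdot> ?w) \<cdot> tail d (k+1) h) \<cdot> ?w\<^sup>-" by (simp only: Ew[OF h])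
    finally show ?thesis using w Ec[OF h] tl[OF h] by (simp add: S_def P.m_assoc)
  qed
  have "tail d k g \<cdot> t \<cdot> (t \<cdot> tail d k g)\<^sup>- = E k g \<cdot> E k h \<cdot> (E k h \<cdot> E k g)\<^sup>-"
    unfolding t tail_peel[OF g k]
    by (rule P.commutator_of_commuting_products) (use Ec g h tl S ES ER RS in auto)
  also have "\<dots> = E k (g \<circ> h \<circ> pinv g \<circ> pinv h)"
  proof -
    have gi: "pinv g \<in> \<B>" "pinv h \<in> \<B>"
      using g h by (auto simp: even_inv[OF finite_Bset] permutes_inv)
    have m: "E k (a \<circ> b) = E k a \<cdot> E k b" "a \<circ> b \<in> \<B>"
      if "a \<in> \<B>" "b \<in> \<B>" for a b
      using E.hom_mult[OF that] E.G.m_closed[OF that] by (simp_all del: Alt_simps(1))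
    have "(E k g)\<^sup>- = E k (pinv g)" "(E k h)\<^sup>- = E k (pinv h)"
      using E.hom_inv[OF g] E.hom_inv[OF h] g h by (auto simp: inv_Alt simp del: Alt_simps)
    then show ?thesis using g h gi Ec m by (simp add: P.inv_mult_group P.m_assoc del: Alt_simps)
  qed
  finally show ?thesis .
qed

end

context telescope
begin

section \<open>Blocks inside the telescope group\<close>

lemma Delta_closed: "1 \<le> k \<Longrightarrow> s \<in> \<Omega> k \<Longrightarrow> Delta d k s \<in> carrier P"
  using hom_in_carrier[OF Delta_hom'] by blast

lemma tail_closed: "g \<in> \<B> \<Longrightarrow> tail d k g \<in> carrier P"
  using hom_in_carrier[OF tail_hom] by blast

lemma Delta_inv: "1 \<le> k \<Longrightarrow> s \<in> \<Omega> k \<Longrightarrow> (Delta d k s)\<^sup>- = Delta d k (pinv s)"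
  using group_hom.hom_inv[of "Alt (words d k)" "P" "Delta d k" s] Delta_hom'[of k]
  by (simp add: group_hom_def group_hom_axioms_def group_Alt group_P inv_Alt del: Alt_simps)

lemma subgroup_Delta: "1 \<le> k \<Longrightarrow> subgroup H P \<Longrightarrow> subgroup {s \<in> \<Omega> k. Delta d k s \<in> H} (Alt (words d k))"
  by (rule subgroup_hom_preimage[OF group_Alt group_P Delta_hom']) auto

lemma subgroup_E: "1 \<le> k \<Longrightarrow> subgroup H P \<Longrightarrow> subgroup {g \<in> \<B>. E k g \<in> H} (Alt Bset)"
  by (rule subgroup_hom_preimage[OF group_Alt group_P E_hom]) auto

lemma subgroup_tail: "subgroup H P \<Longrightarrow> subgroup {g \<in> \<B>. tail d k g \<in> H} (Alt Bset)"
  by (rule subgroup_hom_preimage[OF group_Alt group_P tail_hom]) auto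

lemma block_inj: "s permutes words d k \<Longrightarrow> k \<le> l \<Longrightarrow> u \<in> words d l \<Longrightarrow> v \<in> words d l \<Longrightarrow> block k s u = block k s v \<longleftrightarrow> u = v"
proof -
  assume s: "s permutes words d k" and l: "k \<le> l" and uv: "u \<in> words d l" "v \<in> words d l"
  have "block k (pinv s) (block k s x) = x" if "x \<in> words d l" for x
    using block_comp[OF permutes_inv[OF s] s l that] permutes_inv_o(2)[OF s] by (simp add: block_def)
  then show ?thesis using uv by metis
qed

lemma Delta_conj_cyc3:
  assumes s: "s \<in> \<Omega> k" and k: "1 \<le> k"
    and abc: "a \<in> words d (k+1)" "b \<in> words d (k+1)" "c \<in> words d (k+1)" "distinct [a,b,c]"
  shows "Delta d k s \<cdot> Delta d (k+1) (cyc3 a b c) \<cdot> (Delta d k s)\<^sup>-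
    = Delta d (k+1) (cyc3 (block k s a) (block k s b) (block k s c))"
proof -
  let ?f = "block k s"
  have sp: "s permutes words d k" using s by simp
  have fw: "?f u \<in> words d l" if "u \<in> words d l" "k \<le> l" for u l using presD[OF preserves_block[OF sp]] that by blast
  have d': "distinct [?f a, ?f b, ?f c]" using abc block_inj[OF sp, of "k+1"] by auto
  have c: "cyc3 a b c \<in> \<Omega> (k+1)"
    using abc by (intro cyc3_Alt) auto
  have c': "cyc3 (?f a) (?f b) (?f c) \<in> \<Omega> (k+1)"
    using abc fw by (intro cyc3_Alt[OF d']) auto
  have key: "?f (block (k+1) (cyc3 a b c) u) = block (k+1) (cyc3 (?f a) (?f b) (?f c)) (?f u)"
    if u: "u \<in> words d l" and l: "k \<le> l" for u l
  proof (cases "l = k")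
    case True
    have "length u < k + 1" "length (?f u) < k + 1" using u fw[OF u l] True by (auto simp: words_def)
    then show ?thesis using c c' by (simp add: block_short)
  next
    case False
    then have l1: "k + 1 \<le> l" using l by simp
    let ?p = "take (k+1) u" and ?q = "drop (k+1) u"
    have p: "?p \<in> words d (k+1)" using take_words[OF u l1] .
    have fa: "?f (v @ w) = ?f v @ w" if "v \<in> words d (k+1)" for v w
      using that by (auto simp: block_def words_def)
    have lf: "length (?f ?p) = k + 1" using fw[OF p] by (auto simp: words_def)
    have e: "cyc3 a b c ?p \<in> words d (k+1)" using c p by (simp add: permutes_in_image)
    have "?f (cyc3 a b c ?p) = cyc3 (?f a) (?f b) (?f c) (?f ?p)"
      using block_inj[OF sp, of "k+1"] p abc by (auto simp: cyc3_apply[OF abc(4)] cyc3_apply[OF d'])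
    moreover have "?f u = ?f ?p @ ?q" using fa[OF p, of ?q] by simp
    moreover have "block (k+1) t (v @ w) = t v @ w" if "length v = k + 1" for t v w
      using that by (simp add: block_def)
    moreover have "block (k+1) (cyc3 a b c) u = cyc3 a b c ?p @ ?q" by (simp add: block_def)
    ultimately show ?thesis using fa[OF e, of ?q] lf by metis
  qed
  have low: "Delta d (k+1) t = uniform d k (block (k+1) t)" if "t \<in> \<Omega> (k+1)" for t
  proof (rule uniform_raise[symmetric])
    fix l u assume "k \<le> l" "l < k + 1" "u \<in> words d l"
    then show "block (k+1) t u = u" using that by (intro block_short) (auto simp: words_def)
  qed simp
  have pr: "preserves d k (block (k+1) t)" if "t \<in> \<Omega> (k+1)" for t
    unfolding preserves_def
  proof (intro allI impI ballI)
    fix l u assume l: "k \<le> l" "u \<in> words d l"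
    show "block (k+1) t u \<in> words d l"
    proof (cases "l = k")
      case True
      then have "block (k+1) t u = u" using l that by (intro block_short) (auto simp: words_def)
      then show ?thesis using l by simp
    next
      case False then show ?thesis using presD[OF preserves_block, of t d "k+1" l u] that l by auto
    qed
  qed
  have "Delta d k s \<cdot> Delta d (k+1) (cyc3 a b c) = Delta d (k+1) (cyc3 (?f a) (?f b) (?f c)) \<cdot> Delta d k s"
    unfolding low[OF c] low[OF c'] uniform_mult[OF pr[OF c]] uniform_mult[OF preserves_block[OF sp]]
    using key by (intro uniform_cong) auto
  then show ?thesis using Delta_closed[OF k s] Delta_closed[OF _ c'] by (simp add: P.m_assoc)
qed

lemma emb_cyc3:
  assumes k: "1 \<le> k" and abc: "a \<in> Bset" "b \<in> Bset" "c \<in> Bset" "distinct [a,b,c]"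
  shows "emb k (cyc3 a b c) = cyc3 (replicate (k-1) d @ a) (replicate (k-1) d @ b) (replicate (k-1) d @ c)"
proof
  let ?p = "replicate (k-1) d"
  fix u
  have d': "distinct [?p @ a, ?p @ b, ?p @ c]" using abc by auto
  have w: "?p @ v \<in> words d (k+1)" if "v \<in> Bset" for v
    using append_words[OF replicate_words, of v 2 "k-1"] that Bset_words k by (auto simp: numeral_2_eq_2)
  show "emb k (cyc3 a b c) u = cyc3 (?p @ a) (?p @ b) (?p @ c) u"
  proof (cases "u \<in> words d (k+1)")
    case True
    show ?thesis
    proof (cases "take (k-1) u = ?p")
      case T: True
      then have u: "u = ?p @ drop (k-1) u" by (metis append_take_drop_id)
      have "cyc3 (?p @ a) (?p @ b) (?p @ c) (?p @ v) = ?p @ cyc3 a b c v" for v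
        using abc(4) by (simp add: cyc3_apply)
      then show ?thesis using emb_apply[OF k True] T u by metis
    next
      case False
      then have "u \<notin> {?p @ a, ?p @ b, ?p @ c}" by auto
      then show ?thesis using emb_apply[OF k True] False d' by (simp add: cyc3_apply)
    qed
  next
    case False
    then have "u \<notin> {?p @ a, ?p @ b, ?p @ c}" using w abc by auto
    then show ?thesis using False d' by (simp add: phi_def cyc3_apply)
  qed
qed

lemma card_words: "card (words d k) = d ^ k"
  using card_lists_length_eq[of "{1..d}" k] by (simp add: words_def conj_commute)

lemma card_words_5: assumes "1 \<le> k" shows "5 \<le> card (words d k)"
proof -
  have "d ^ 1 \<le> d ^ k" using assms d5 by (intro power_increasing) auto
  then show ?thesis using d5 by (simp add: card_words)
qed

lemma Alt_transitive_fixing: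
  assumes "finite S" "5 \<le> card S" "p \<in> S" "v \<in> S" "v' \<in> S" "v \<noteq> p" "v' \<noteq> p"
  shows "\<exists>s\<in>carrier (Alt S). s p = p \<and> s v' = v"
proof (cases "v = v'")
  case True then show ?thesis by (intro bexI[of _ id]) (auto simp: permutes_id)
next
  case False
  have "card (S - {p,v,v'}) \<ge> 2" using assms False by (subst card_Diff_subset) auto
  then have "S - {p,v,v'} \<noteq> {}" by (metis card.empty not_numeral_le_zero)
  then obtain t where "t \<in> S" "t \<noteq> p" "t \<noteq> v" "t \<noteq> v'" by blast
  then show ?thesis using assms False
    by (intro bexI[of _ "cyc3 v' v t"] cyc3_Alt conjI) (auto simp: cyc3_apply)
qed

text \<open>The commutator trick produces the blocks of all commutators in \<open>B\<close>, and \<open>B\<close> is perfect.\<close>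

lemma E_in_of_tail:
  assumes H: "subgroup H P" and k: "1 \<le> k"
    and D: "\<And>s. s \<in> \<Omega> k \<Longrightarrow> Delta d k s \<in> H"
    and C: "\<And>g. g \<in> \<B> \<Longrightarrow> tail d k g \<in> H"
    and g: "g \<in> \<B>"
  shows "E k g \<in> H"
proof -
  interpret H: subgroup H "P" by fact
  have "{g \<in> \<B>. E k g \<in> H} = \<B>"
  proof (rule Alt_generated_by_commutators[OF finite_Bset card_Bset(2) subgroup_E[OF k H]])
    fix g h assume g: "g \<in> \<B>" and h: "h \<in> \<B>"
    have gi: "pinv g \<in> \<B>" "pinv h \<in> \<B>"
      using g h by (auto simp: even_inv[OF finite_Bset] permutes_inv)
    have "g \<circ> h \<circ> pinv g \<circ> pinv h \<in> \<B>"
      using g h gi group.is_monoid[OF group_Alt[OF finite_Bset]] monoid.m_closed[of "Alt Bset"] by (metis Alt_simps(2))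
    moreover have "E k (g \<circ> h \<circ> pinv g \<circ> pinv h) \<in> H"
      unfolding tail_comm[OF g h k, symmetric] using D[OF corner_cycle_Omega[OF k]] C[OF g] C[OF h] by auto
    ultimately show "g \<circ> h \<circ> pinv g \<circ> pinv h \<in> {g \<in> \<B>. E k g \<in> H}" by blast
  qed
  then show ?thesis using g by blast
qed

lemma tail_in_Suc:
  assumes H: "subgroup H P" and k: "1 \<le> k"
    and D: "\<And>s. s \<in> \<Omega> k \<Longrightarrow> Delta d k s \<in> H"
    and C: "\<And>g. g \<in> \<B> \<Longrightarrow> tail d k g \<in> H"
    and g: "g \<in> \<B>"
  shows "tail d (k+1) g \<in> H"
proof -
  interpret H: subgroup H "P" by fact
  have "(E k g)\<^sup>- \<cdot> tail d k g \<in> H" using E_in_of_tail[OF assms] C[OF g] by auto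
  moreover have "(E k g)\<^sup>- \<cdot> tail d k g = tail d (k+1) g"
    unfolding tail_peel[OF g k]
    using Delta_closed[of "k+1" "emb k g"] emb_Omega[OF k g] tail_closed[OF g, of "k+1"]
    by (simp add: P.m_assoc[symmetric])
  ultimately show ?thesis by simp
qed

text \<open>The 3-cycles on words \<open>d\<^sup>k\<^sup>-\<^sup>1 x y\<close> with \<open>x \<le> 2\<close> are blocks. Conjugation by elements of \<open>\<Delta>\<^sub>k(Alt(X\<^sup>k))\<close> fixing the
prefix \<open>d\<^sup>k\<^sup>-\<^sup>1 1\<close> and moving \<open>d\<^sup>k\<^sup>-\<^sup>1 2\<close> turns them into 3-cycles with two fixed entries and an arbitrary third one.\<close>

lemma Delta_in_Suc:
  assumes H: "subgroup H P" and k: "1 \<le> k"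
    and D: "\<And>s. s \<in> \<Omega> k \<Longrightarrow> Delta d k s \<in> H"
    and C: "\<And>g. g \<in> \<B> \<Longrightarrow> tail d k g \<in> H"
    and s: "s \<in> \<Omega> (k+1)"
  shows "Delta d (k+1) s \<in> H"
proof -
  interpret H: subgroup H "P" by fact
  let ?p = "replicate (k-1) d"
  let ?P = "?p @ [1,1]" and ?Q = "?p @ [1,2]"
  have Bin: "[x,y] \<in> Bset" if "x \<in> {1,2}" "y \<in> {1..d}" for x y using that r2 by (auto simp: Bset_def)
  have emb3: "Delta d (k+1) (cyc3 ?P ?Q (?p @ [x,y])) \<in> H"
    if "x \<in> {1,2}" "y \<in> {1..d}" "[x,y] \<noteq> [1,1]" "[x,y] \<noteq> [1,2]" for x y
  proof -
    have dist: "distinct [[1,1],[1,2],[x,y]]" using that by auto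
    have "cyc3 [1,1] [1,2] [x,y] \<in> \<B>"
      using that Bset_two Bin by (intro cyc3_Alt[OF dist]) auto
    from E_in_of_tail[OF H k D C this] show ?thesis
      using emb_cyc3[OF k Bset_two(1,2) Bin[OF that(1,2)] dist] by simp
  qed
  have pw: "?p @ [x] \<in> words d k" if "x \<in> {1..d}" for x using prefix_words[OF k that] .
  have pw2: "?p @ [x,y] \<in> words d (k+1)" if "x \<in> {1..d}" "y \<in> {1..d}" for x y
    using append_words[OF replicate_words, of "[x,y]" 2 "k-1"] that k by (auto simp: words_def)
  have "{s \<in> \<Omega> (k+1). Delta d (k+1) s \<in> H} = \<Omega> (k+1)"
  proof (rule Alt_generated_by_cyc3[OF finite_words subgroup_Delta[OF _ H], of "k+1" ?P ?Q])
    show "?P \<in> words d (k+1)" "?Q \<in> words d (k+1)" using pw2 d5 by auto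
    fix Z assume Z: "Z \<in> words d (k+1)" "Z \<noteq> ?P" "Z \<noteq> ?Q"
    obtain v y where Zv: "Z = v @ [y]" "v \<in> words d k" "y \<in> {1..d}"
    proof -
      have "Z \<noteq> []" using Z by (auto simp: words_def)
      then have "Z = butlast Z @ [last Z]" by simp
      moreover have "butlast Z \<in> words d k" using Z(1) by (auto simp: words_def dest: in_set_butlastD)
      moreover have "last Z \<in> {1..d}" using Z(1) last_in_set[OF \<open>Z \<noteq> []\<close>] by (auto simp: words_def)
      ultimately show ?thesis using that by blast
    qed
    have cl: "cyc3 ?P ?Q Z \<in> \<Omega> (k+1)"
      using Z pw2 d5 by (intro cyc3_Alt) auto
    have "Delta d (k+1) (cyc3 ?P ?Q Z) \<in> H"
    proof (cases "v = ?p @ [1]")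
      case True
      then show ?thesis using emb3[of 1 y] Zv Z by auto
    next
      case False
      obtain t where t: "t \<in> \<Omega> k" "t (?p @ [1]) = ?p @ [1]" "t (?p @ [2]) = v"
        using Alt_transitive_fixing[OF finite_words card_words_5[OF k], of "?p @ [1]" v "?p @ [2]"]
          pw[of 1] pw[of 2] d5 Zv False by auto
      have dlt: "block k t (?p @ [x,y]) = t (?p @ [x]) @ [y]" for x y
        using k by (simp add: block_def take_Cons' Suc_diff_le)
      have "Delta d k t \<cdot> Delta d (k+1) (cyc3 ?P ?Q (?p @ [2,y])) \<cdot> (Delta d k t)\<^sup>- \<in> H"
        using D[OF t(1)] emb3[of 2 y] Zv by auto
      also have "Delta d k t \<cdot> Delta d (k+1) (cyc3 ?P ?Q (?p @ [2,y])) \<cdot> (Delta d k t)\<^sup>-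
         = Delta d (k+1) (cyc3 ?P ?Q Z)"
      proof -
        have "block k t ?P = ?P" "block k t ?Q = ?Q" "block k t (?p @ [2,y]) = Z"
          using Zv by (simp_all only: dlt t append_assoc append.simps)
        moreover have "?P \<in> words d (k+1)" "?Q \<in> words d (k+1)" "?p @ [2,y] \<in> words d (k+1)"
          using pw2[of 1 1] pw2[of 1 2] pw2[of 2 y] d5 Zv by (simp_all del: One_nat_def)
        moreover have "distinct [?P, ?Q, ?p @ [2,y]]" by simp
        ultimately show ?thesis using Delta_conj_cyc3[OF t(1) k, of ?P ?Q "?p @ [2,y]"] by (simp only:)
      qed
      finally show ?thesis .
    qed
    with cl show "cyc3 ?P ?Q Z \<in> {s \<in> \<Omega> (k+1). Delta d (k+1) s \<in> H}" by blast
  qed auto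
  then show ?thesis using s by blast
qed

lemma Delta_tail_in:
  assumes H: "subgroup H P" and k: "1 \<le> k"
    and D: "\<And>s. s \<in> \<Omega> 1 \<Longrightarrow> Delta d 1 s \<in> H"
    and C: "\<And>g. g \<in> \<B> \<Longrightarrow> tail d 1 g \<in> H"
  shows "(\<forall>s\<in>\<Omega> k. Delta d k s \<in> H) \<and> (\<forall>g\<in>\<B>. tail d k g \<in> H)"
  using k
proof (induction k rule: dec_induct)
  case (step k)
  then show ?case using Delta_in_Suc[OF H, of k] tail_in_Suc[OF H, of k] by (metis Suc_eq_plus1)
qed (use D C in auto)

definition single :: "nat \<Rightarrow> (nat list \<Rightarrow> nat list) \<Rightarrow> nat \<Rightarrow> nat list \<Rightarrow> nat list" where
  "single k s = (\<lambda>l\<in>{1..}. if l = k then s else id)"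

lemma Delta_level: "p \<in> carrier P \<Longrightarrow> 1 \<le> l \<Longrightarrow> p l \<in> \<Omega> l"
  by (simp add: carrier_P)

text \<open>Above level \<open>k\<close> a block of a lower level \<open>j\<close> is indistinguishable from a block of level \<open>k\<close>.\<close>

lemma Delta_trunc:
  assumes s: "s \<in> \<Omega> j" and j: "1 \<le> j" "j \<le> k"
  shows "Delta d j s k \<in> \<Omega> k"
    and "uniform d k (block j s) = Delta d k (Delta d j s k)"
proof -
  show "Delta d j s k \<in> \<Omega> k" using Delta_level[OF Delta_closed[OF j(1) s]] j by simp
  show "uniform d k (block j s) = Delta d k (Delta d j s k)"
  proof (rule uniform_cong)
    fix l u assume l: "k \<le> l" "u \<in> words d l"
    then have "take k u \<in> words d k" by (rule_tac take_words)
    then show "block j s u = block k (Delta d j s k) u"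
      using j l by (simp add: block_def uniform_def min_def) (metis append_take_drop_id drop_drop drop_take le_add_diff_inverse2)
  qed
qed

text \<open>An element of a single factor is the quotient of a block of level \<open>k\<close> by the restriction of that
block to the levels above \<open>k\<close>, which is a block of level \<open>k+1\<close>.\<close>

lemma single_in:
  assumes H: "subgroup H P" and k: "1 \<le> k"
    and D: "\<And>s. s \<in> \<Omega> 1 \<Longrightarrow> Delta d 1 s \<in> H"
    and C: "\<And>g. g \<in> \<B> \<Longrightarrow> tail d 1 g \<in> H"
    and s: "s \<in> \<Omega> k"
  shows "single k s \<in> H"
proof -
  interpret H: subgroup H "P" by fact
  have s': "pinv s \<in> \<Omega> k" using s by (auto simp: even_inv[OF finite_words] permutes_inv)
  let ?t = "Delta d k (pinv s) (k+1)"
  have t: "?t \<in> \<Omega> (k+1)" "uniform d (k+1) (block k (pinv s)) = Delta d (k+1) ?t"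
    using Delta_trunc[OF s' k, of "k+1"] by auto
  have "Delta d k s \<cdot> Delta d (k+1) ?t \<in> H"
    using Delta_tail_in[OF H _ D C] k s t(1) by (meson H.m_closed le_add2)
  also have "Delta d k s \<cdot> Delta d (k+1) ?t = single k s"
    unfolding t(2)[symmetric]
  proof (rule ext, rule ext)
    fix l u
    have sp: "s permutes words d k" "pinv s permutes words d k" using s s' by auto
    show "(Delta d k s \<cdot> uniform d (k+1) (block k (pinv s))) l u = single k s l u"
    proof (cases "1 \<le> l \<and> k + 1 \<le> l \<and> u \<in> words d l")
      case True
      then have l: "k \<le> l" by auto
      have "block k (pinv s) u \<in> words d l" using True l presD[OF preserves_block[OF sp(2)]] by blast
      moreover have "block k s (block k (pinv s) u) = u"
        using block_comp[OF sp(1,2) l] True sp(1) by (simp add: permutes_inv_o block_def)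
      ultimately show ?thesis using True l by (simp add: mult_P uniform_def single_def)
    next
      case False
      then show ?thesis using k sp(1)
        by (auto simp: mult_P uniform_def single_def block_def words_def permutes_def)
    qed
  qed
  finally show ?thesis .
qed

end

lemma (in group) conj_hom: "a \<in> carrier G \<Longrightarrow> (\<lambda>x. inv a \<otimes> x \<otimes> a) \<in> hom G G"
proof (rule homI)
  fix x y assume "a \<in> carrier G" "x \<in> carrier G" "y \<in> carrier G"
  then have "(inv a \<otimes> x \<otimes> a) \<otimes> (inv a \<otimes> y \<otimes> a) = inv a \<otimes> x \<otimes> (a \<otimes> inv a) \<otimes> y \<otimes> a"
    by (simp only: m_assoc m_closed inv_closed)
  then show "inv a \<otimes> (x \<otimes> y) \<otimes> a = (inv a \<otimes> x \<otimes> a) \<otimes> (inv a \<otimes> y \<otimes> a)"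
    using \<open>a \<in> carrier G\<close> \<open>x \<in> carrier G\<close> \<open>y \<in> carrier G\<close> by (simp add: m_assoc)
qed auto

section \<open>The group N and its four generators\<close>

lemma hom_commuting_product:
  assumes G: "group G" "group H" "group K" and f: "f \<in> hom G K" and g: "g \<in> hom H K"
    and comm: "\<And>a b. a \<in> carrier G \<Longrightarrow> b \<in> carrier H \<Longrightarrow> f a \<otimes>\<^bsub>K\<^esub> g b = g b \<otimes>\<^bsub>K\<^esub> f a"
  shows "(\<lambda>(a,b). f a \<otimes>\<^bsub>K\<^esub> g b) \<in> hom (G \<times>\<times> H) K"
proof (rule homI)
  interpret K: group K by fact
  fix x y assume "x \<in> carrier (G \<times>\<times> H)" "y \<in> carrier (G \<times>\<times> H)"
  then obtain a b a' b' where xy: "x = (a,b)" "y = (a',b')" "a \<in> carrier G" "b \<in> carrier H" "a' \<in> carrier G" "b' \<in> carrier H"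
    by (auto simp: DirProd_def)
  note c = hom_in_carrier[OF f xy(3)] hom_in_carrier[OF f xy(5)] hom_in_carrier[OF g xy(4)] hom_in_carrier[OF g xy(6)]
  have "f a \<otimes>\<^bsub>K\<^esub> f a' \<otimes>\<^bsub>K\<^esub> (g b \<otimes>\<^bsub>K\<^esub> g b') = f a \<otimes>\<^bsub>K\<^esub> (f a' \<otimes>\<^bsub>K\<^esub> g b) \<otimes>\<^bsub>K\<^esub> g b'"
    using c by (simp add: K.m_assoc)
  also have "\<dots> = f a \<otimes>\<^bsub>K\<^esub> (g b \<otimes>\<^bsub>K\<^esub> f a') \<otimes>\<^bsub>K\<^esub> g b'" by (simp only: comm[OF xy(5,4)])
  also have "\<dots> = (f a \<otimes>\<^bsub>K\<^esub> g b) \<otimes>\<^bsub>K\<^esub> (f a' \<otimes>\<^bsub>K\<^esub> g b')" using c by (simp add: K.m_assoc)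
  finally show "(case x \<otimes>\<^bsub>G \<times>\<times> H\<^esub> y of (a, b) \<Rightarrow> f a \<otimes>\<^bsub>K\<^esub> g b) =
      (case x of (a, b) \<Rightarrow> f a \<otimes>\<^bsub>K\<^esub> g b) \<otimes>\<^bsub>K\<^esub> (case y of (a, b) \<Rightarrow> f a \<otimes>\<^bsub>K\<^esub> g b)"
    using xy hom_mult[OF f] hom_mult[OF g] by simp
  show "(case x of (a, b) \<Rightarrow> f a \<otimes>\<^bsub>K\<^esub> g b) \<in> carrier K" using xy c by simp
qed

context telescope
begin

abbreviation letters ("X") where "X \<equiv> {1..d}"
abbreviation eps where "eps \<equiv> epsilon d"
abbreviation delta_map where "delta_map \<equiv> map (delta d)"
abbreviation NN where "NN \<equiv> N_set d r"

lemma delta_apply: "delta d x = (if x = 1 then d else if x = d then 1 else if x = 2 then d - 1 else if x = d - 1 then 2 else x)"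
  using d5 by (auto simp: delta_def transpose_def)

lemma delta_involution [simp]: "delta d (delta d x) = x"
  using d5 by (auto simp: delta_apply)

lemma delta_comp: "delta d \<circ> delta d = id" by (simp add: fun_eq_iff)

lemma delta_map_involution [simp]: "delta_map (delta_map u) = u" by (simp add: comp_def)

lemma delta_X: "delta d \<in> carrier (Alt X)"
proof -
  have "transpose 1 d permutes X" "transpose 2 (d-1) permutes X" using d5 by (auto intro!: permutes_swap_id)
  then show ?thesis using d5 by (auto simp: delta_def even_comp[of X] evenperm_swap permutes_compose)
qed

lemma delta_map_words: "delta_map u \<in> words d l \<longleftrightarrow> u \<in> words d l"
proof -
  have "delta d ` A \<subseteq> X \<longleftrightarrow> A \<subseteq> X" for A
    using delta_X by (auto simp: permutes_in_image image_subset_iff subset_iff simp del: atLeastAtMost_iff)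
  then show ?thesis by (simp add: words_def)
qed

lemma eps_uniform: "eps = uniform d 1 delta_map"
  by (auto simp: epsilon_def uniform_def fun_eq_iff)

lemma preserves_delta_map: "preserves d k delta_map" by (auto simp: preserves_def delta_map_words)

lemma eps_closed: "eps \<in> carrier P"
proof -
  have "(\<lambda>s. uniform d 1 (map s)) \<in> hom (Alt X) P"
  proof (rule uniform_hom)
    show "1 \<in> X" "2 \<in> X" "1 \<noteq> (2::nat)" using d5 by auto
    show "preserves d 1 (map s)" if "s \<in> carrier (Alt X)" for s
      unfolding preserves_def words_def using that permutes_in_image[of s X] by (auto simp: subset_iff simp del: atLeastAtMost_iff)
  qed auto
  from hom_in_carrier[OF this delta_X] show ?thesis by (simp add: eps_uniform)
qed

lemma eps_eps: "eps \<cdot> eps = \<one>\<^bsub>P\<^esub>"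
proof -
  have "delta_map \<circ> delta_map = id" by (rule ext) (simp only: o_apply delta_map_involution id_apply)
  then show ?thesis unfolding eps_uniform uniform_mult[OF preserves_delta_map] by (simp only: uniform_id)
qed

lemma eps_inv: "eps\<^sup>- = eps"
  using eps_eps eps_closed by (metis P.inv_equality)

definition eps_conj :: "(nat \<Rightarrow> nat list \<Rightarrow> nat list) \<Rightarrow> nat \<Rightarrow> nat list \<Rightarrow> nat list" where
  "eps_conj x = eps\<^sup>- \<cdot> x \<cdot> eps"

lemma eps_conj_hom: "eps_conj \<in> hom P P"
  using P.conj_hom[OF eps_closed] by (simp add: eps_conj_def[abs_def])

lemma eps_conj_closed: "x \<in> carrier P \<Longrightarrow> eps_conj x \<in> carrier P"
  using hom_in_carrier[OF eps_conj_hom] .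

lemma eps_conj_involution: assumes "x \<in> carrier P" shows "eps_conj (eps_conj x) = x"
proof -
  have "eps_conj (eps_conj x) = (eps \<cdot> eps) \<cdot> x \<cdot> (eps \<cdot> eps)"
    using assms eps_closed by (simp add: eps_conj_def eps_inv P.m_assoc)
  then show ?thesis using assms by (simp add: eps_eps)
qed

lemma eps_conj_uniform: "preserves d k f \<Longrightarrow> eps_conj (uniform d k f) = uniform d k (delta_map \<circ> f \<circ> delta_map)"
proof -
  assume f: "preserves d k f"
  have "f (delta_map u) \<in> words d l" if "k \<le> l" "u \<in> words d l" for u l using presD[OF f] that delta_map_words by blast
  then show ?thesis unfolding eps_conj_def eps_inv
    by (auto simp: eps_uniform mult_P uniform_def fun_eq_iff delta_map_words delta_comp)
qed

lemma subgroup_eps_conj: "subgroup H P \<Longrightarrow> subgroup {x \<in> carrier P. eps_conj x \<in> H} P"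
  by (rule subgroup_hom_preimage[OF group_P group_P eps_conj_hom])

lemma eps_conj_Delta:
  assumes s: "s \<in> \<Omega> k" and k: "1 \<le> k"
  shows "\<exists>t\<in>\<Omega> k. eps_conj (Delta d k s) = Delta d k t"
proof (intro bexI)
  have sp: "s permutes words d k" using s by simp
  let ?t = "eps_conj (Delta d k s) k"
  show "?t \<in> \<Omega> k"
    using Delta_level[OF eps_conj_closed[OF Delta_closed[OF k s]] k] .
  show "eps_conj (Delta d k s) = Delta d k ?t"
    unfolding eps_conj_uniform[OF preserves_block[OF sp]]
  proof (rule uniform_cong)
    fix l u assume l: "k \<le> l" "u \<in> words d l"
    have tw: "take k u \<in> words d k" using take_words[OF l(2,1)] .
    then have "s (delta_map (take k u)) \<in> words d k" using sp delta_map_words by (simp add: permutes_in_image)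
    then have "length (s (delta_map (take k u))) = k" "length (take k u) = k" using tw by (auto simp: words_def)
    then show "(delta_map \<circ> block k s \<circ> delta_map) u = block k (uniform d k (delta_map \<circ> block k s \<circ> delta_map) k) u"
      using tw k by (simp add: block_def uniform_def take_map drop_map map_idI)
  qed
qed

lemma tele_eq: "telescope_group d r = generate P (Delta d 1 ` \<Omega> 1 \<union> tail d 1 ` \<B>)"
  unfolding telescope_group_def Delta1_eq B_group_eq Omega_def using g_tilde_eq by (metis (no_types, lifting) image_cong)

lemma N_set_eq: "NN = generate P (telescope_group d r \<union> eps_conj ` telescope_group d r)"
  by (simp add: N_set_def eps_conj_def[abs_def])

lemma tele_sub: "telescope_group d r \<subseteq> carrier P" "subgroup (telescope_group d r) P"
proof -
  have "Delta d 1 ` \<Omega> 1 \<union> tail d 1 ` \<B> \<subseteq> carrier P"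
    using Delta_closed[of 1] tail_closed[of _ 1] by blast
  then show "subgroup (telescope_group d r) P" unfolding tele_eq by (rule P.generate_is_subgroup)
  then show "telescope_group d r \<subseteq> carrier P" by (rule subgroup.subset)
qed

lemma N_subgroup: "subgroup NN P"
  unfolding N_set_eq using tele_sub(1) eps_conj_closed by (intro P.generate_is_subgroup) auto

lemma N_carrier: "x \<in> NN \<Longrightarrow> x \<in> carrier P"
  using subgroup.mem_carrier[OF N_subgroup] .

text \<open>The induction principle for \<open>N\<close>. Conjugates of \<open>\<Delta>\<^sub>1\<close>-elements under \<open>\<epsilon>\<close> need no case of their own: they are
\<open>\<Delta>\<^sub>1\<close>-elements again.\<close>

lemma N_least:
  assumes H: "subgroup H P"
    and D: "\<And>s. s \<in> \<Omega> 1 \<Longrightarrow> Delta d 1 s \<in> H"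
    and C: "\<And>g. g \<in> \<B> \<Longrightarrow> tail d 1 g \<in> H"
    and C': "\<And>g. g \<in> \<B> \<Longrightarrow> eps_conj (tail d 1 g) \<in> H"
  shows "NN \<subseteq> H"
proof -
  have T: "telescope_group d r \<subseteq> K" if "subgroup K P" "\<And>s. s \<in> \<Omega> 1 \<Longrightarrow> Delta d 1 s \<in> K"
    "\<And>g. g \<in> \<B> \<Longrightarrow> tail d 1 g \<in> K" for K
    unfolding tele_eq using that by (intro P.generate_subgroup_incl) auto
  have "telescope_group d r \<subseteq> {x \<in> carrier P. eps_conj x \<in> H}"
  proof (rule T[OF subgroup_eps_conj[OF H]])
    fix s assume s: "s \<in> \<Omega> 1"
    then show "Delta d 1 s \<in> {x \<in> carrier P. eps_conj x \<in> H}"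
      using eps_conj_Delta[OF s] D Delta_closed[of 1 s] by auto
  next
    fix g assume g: "g \<in> \<B>"
    then show "tail d 1 g \<in> {x \<in> carrier P. eps_conj x \<in> H}" using tail_closed[OF g] C' by blast
  qed
  then show ?thesis unfolding N_set_eq using T[OF H D C] by (intro P.generate_subgroup_incl[OF _ H]) auto
qed

lemma tele_N: "telescope_group d r \<subseteq> NN" "eps_conj ` telescope_group d r \<subseteq> NN"
  unfolding N_set_eq by (auto intro: generate.incl)

lemma Delta_N1: assumes "s \<in> \<Omega> 1" shows "Delta d 1 s \<in> NN"
proof -
  have "Delta d 1 s \<in> telescope_group d r" unfolding tele_eq
    by (rule generate.incl, rule UnI1, rule imageI[OF assms])
  then show ?thesis using tele_N(1) by blast
qed

lemma tail_tele: assumes "g \<in> \<B>" shows "tail d 1 g \<in> telescope_group d r"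
  unfolding tele_eq by (rule generate.incl, rule UnI2, rule imageI[OF assms])

lemma tail_N1: "g \<in> \<B> \<Longrightarrow> tail d 1 g \<in> NN"
  using tele_N(1) tail_tele by blast

lemma eps_conj_N: "x \<in> NN \<Longrightarrow> eps_conj x \<in> NN"
proof -
  have "NN \<subseteq> {x \<in> carrier P. eps_conj x \<in> NN}"
  proof (rule N_least[OF subgroup_eps_conj[OF N_subgroup]])
    fix s assume s: "s \<in> \<Omega> 1"
    then show "Delta d 1 s \<in> {x \<in> carrier P. eps_conj x \<in> NN}"
      using eps_conj_Delta[OF s] Delta_N1 Delta_closed[of 1 s] by auto
  next
    fix g assume g: "g \<in> \<B>"
    show "tail d 1 g \<in> {x \<in> carrier P. eps_conj x \<in> NN}"
      using tail_closed[OF g] tail_tele[OF g] tele_N(2) by blast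
    show "eps_conj (tail d 1 g) \<in> {x \<in> carrier P. eps_conj x \<in> NN}"
      using tail_closed[OF g] eps_conj_involution eps_conj_closed tail_N1[OF g] by auto
  qed
  then show "x \<in> NN \<Longrightarrow> eps_conj x \<in> NN" by blast
qed

lemma Delta_N: "1 \<le> k \<Longrightarrow> s \<in> \<Omega> k \<Longrightarrow> Delta d k s \<in> NN"
  and tail_N: "1 \<le> k \<Longrightarrow> g \<in> \<B> \<Longrightarrow> tail d k g \<in> NN"
  using Delta_tail_in[OF N_subgroup _ Delta_N1 tail_N1, of k] by blast+

lemma single_N: "1 \<le> k \<Longrightarrow> s \<in> \<Omega> k \<Longrightarrow> single k s \<in> NN"
  using single_in[OF N_subgroup _ Delta_N1 tail_N1] by blast

lemma single_hom: "1 \<le> k \<Longrightarrow> single k \<in> hom (Alt (words d k)) P"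
proof (rule homI)
  assume "1 \<le> k"
  then show "single k s \<in> carrier P" if "s \<in> \<Omega> k" for s
    using single_N[OF _ that] N_carrier by blast
qed (auto simp: single_def mult_P fun_eq_iff)

text \<open>From level 2 on, a tail acts behind the letter \<open>d\<close> and a conjugated tail behind the letter \<open>1\<close>.\<close>

lemma tails_commute:
  assumes g: "g \<in> \<B>" and h: "h \<in> \<B>"
  shows "tail d 2 g \<cdot> eps_conj (tail d 2 h) = eps_conj (tail d 2 h) \<cdot> tail d 2 g"
  unfolding eps_conj_uniform[OF preserves_tail_map[OF h]]
proof (rule uniform_commute[where A = "{u. take 1 u = [d]}"])
  show "preserves d 2 (tail_map d 2 g)" using preserves_tail_map[OF g] .
  show "preserves d 2 (delta_map \<circ> tail_map d 2 h \<circ> delta_map)" using preserves_tail_map[OF h] preserves_delta_map by (intro preserves_comp)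
  have tk: "take 1 (tail_map d 2 f u) = take 1 u" for f u using tail_map_take[of 1 f u] by (simp add: numeral_2_eq_2)
  have tk': "take 1 ((delta_map \<circ> tail_map d 2 h \<circ> delta_map) u) = take 1 u" for u
    by (simp only: o_apply take_map tk delta_map_involution)
  fix u l assume u: "u \<in> words d l"
  show "tail_map d 2 g u = u \<and> (delta_map \<circ> tail_map d 2 h \<circ> delta_map) u \<notin> {u. take 1 u = [d]}" if "u \<notin> {u. take 1 u = [d]}"
    using that tail_map_other[of 1 u g] tk' by (simp add: numeral_2_eq_2 del: o_apply)
  show "tail_map d 2 g u \<in> {u. take 1 u = [d]} \<and> (delta_map \<circ> tail_map d 2 h \<circ> delta_map) u = u" if "u \<in> {u. take 1 u = [d]}"
  proof -
    have "take 1 (delta_map u) = [1]" using that d5 by (simp add: take_map delta_apply)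
    then have "tail_map d 2 h (delta_map u) = delta_map u" using tail_map_other[of 1 "delta_map u" h] d5 by (simp add: numeral_2_eq_2)
    then show ?thesis using that tk by (simp add: delta_comp)
  qed
qed

lemma N_four_generators:
  "\<exists>S. S \<subseteq> NN \<and> finite S \<and> card S \<le> 4 \<and> generate P S = NN"
proof -
  let ?A = "Alt (words d 1)" and ?A2 = "Alt (words d 2)" and ?B = "Alt Bset"
  have GA: "group ?A" "group ?A2" "group ?B" by (auto intro: group_Alt)
  have card: "3 \<le> card (words d 1)" "9 \<le> card (words d 2)" "3 \<le> card Bset" "9 \<le> card Bset"
  proof -
    have "5 * 5 \<le> d * d" using d5 by (intro mult_le_mono) auto
    then show "9 \<le> card (words d 2)" by (simp add: card_words power2_eq_square)
  qed (use d5 card_Bset(1) in \<open>auto simp: card_words\<close>)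
  obtain s g s' g' where sg: "s \<in> carrier ?A" "g \<in> carrier ?A" "s' \<in> carrier ?A2" "g' \<in> carrier ?A2"
    and gen1: "\<forall>U. subgroup U (?A \<times>\<times> ?A2) \<and> (s,g') \<in> U \<and> (g,s') \<in> U \<longrightarrow> U = carrier (?A \<times>\<times> ?A2)"
    using Alt_product_two_generators[OF finite_words card(1) finite_words card(2)] by (elim bexE) (rule that)
  obtain t h t' h' where th: "t \<in> carrier ?B" "h \<in> carrier ?B" "t' \<in> carrier ?B" "h' \<in> carrier ?B"
    and gen2: "\<forall>U. subgroup U (?B \<times>\<times> ?B) \<and> (t,h') \<in> U \<and> (h,t') \<in> U \<longrightarrow> U = carrier (?B \<times>\<times> ?B)"
    using Alt_product_two_generators[OF finite_Bset card(3) finite_Bset card(4)] by (elim bexE) (rule that)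
  let ?y = "\<lambda>(a,b). single 1 a \<cdot> Delta d 2 b"
  let ?x = "\<lambda>(a,b). tail d 2 a \<cdot> eps_conj (tail d 2 b)"
  have comm1: "single 1 a \<cdot> Delta d 2 b = Delta d 2 b \<cdot> single 1 a" for a b
    by (auto simp: mult_P single_def uniform_def fun_eq_iff)
  have yhom: "?y \<in> hom (?A \<times>\<times> ?A2) P"
    by (rule hom_commuting_product[OF GA(1,2) group_P single_hom Delta_hom' comm1]) auto
  have cjt: "(\<lambda>b. eps_conj (tail d 2 b)) \<in> hom ?B P"
    using hom_compose[OF tail_hom eps_conj_hom] by (simp add: comp_def)
  have xhom: "?x \<in> hom (?B \<times>\<times> ?B) P"
    by (rule hom_commuting_product[OF GA(3,3) group_P tail_hom cjt tails_commute])
  \<comment> \<open>Each of the two commuting pairs contributes two generators.\<close>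
  define S where "S = {?y (s,g'), ?y (g,s'), ?x (t,h'), ?x (h,t')}"
  interpret N: subgroup NN "P" by (rule N_subgroup)
  have SN: "S \<subseteq> NN"
    using sg th by (auto simp: S_def intro!: N.m_closed single_N Delta_N tail_N eps_conj_N simp del: Alt_simps)
  define H where "H = generate P S"
  have H: "subgroup H P" unfolding H_def
    using SN N.subset by (intro P.generate_is_subgroup) auto
  interpret H: subgroup H "P" by (rule H)
  have inH: "x \<in> S \<Longrightarrow> x \<in> H" for x unfolding H_def by (rule generate.incl)
  have "{w \<in> carrier (?A \<times>\<times> ?A2). ?y w \<in> H} = carrier (?A \<times>\<times> ?A2)"
    using sg inH by (intro gen1[rule_format] conjI subgroup_hom_preimage[OF DirProd_group[OF GA(1,2)] group_P yhom H])
      (auto simp: S_def DirProd_def simp del: Alt_simps)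
  then have yH: "?y (a,b) \<in> H" if "a \<in> carrier ?A" "b \<in> carrier ?A2" for a b
    using that by (auto simp: DirProd_def simp del: Alt_simps)
  have "{w \<in> carrier (?B \<times>\<times> ?B). ?x w \<in> H} = carrier (?B \<times>\<times> ?B)"
    using th inH by (intro gen2[rule_format] conjI subgroup_hom_preimage[OF DirProd_group[OF GA(3,3)] group_P xhom H])
      (auto simp: S_def DirProd_def simp del: Alt_simps)
  then have xH: "?x (a,b) \<in> H" if "a \<in> carrier ?B" "b \<in> carrier ?B" for a b
    using that by (auto simp: DirProd_def simp del: Alt_simps)
  have idA: "id \<in> carrier ?A" "id \<in> carrier ?A2" "id \<in> carrier ?B" by (auto simp: permutes_id)
  have one: "f id = \<one>\<^bsub>P\<^esub>" if "f \<in> hom (Alt T) P" "finite T" for f and T :: "nat list set"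
    using hom_one[OF that(1) group_Alt[OF that(2)] group_P] by simp
  have ones: "single 1 id = \<one>\<^bsub>P\<^esub>" "Delta d 2 id = \<one>\<^bsub>P\<^esub>" "tail d 2 id = \<one>\<^bsub>P\<^esub>" "eps_conj (tail d 2 id) = \<one>\<^bsub>P\<^esub>"
    using one[OF single_hom] one[OF Delta_hom'[of 2]] one[OF tail_hom] one[OF cjt] by auto
  have s1: "single 1 a \<in> H" if "a \<in> carrier ?A" for a
    using yH[OF that idA(2)] ones N_carrier[OF single_N[OF _ that]] by simp
  have D2: "Delta d 2 a \<in> H" if "a \<in> carrier ?A2" for a
    using yH[OF idA(1) that] ones Delta_closed[OF _ that] by simp
  have t2: "tail d 2 a \<in> H" if "a \<in> carrier ?B" for a
    using xH[OF that idA(3)] ones tail_closed[OF that] by simp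
  have c2: "eps_conj (tail d 2 a) \<in> H" if "a \<in> carrier ?B" for a
    using xH[OF idA(3) that] ones eps_conj_closed[OF tail_closed[OF that]] by simp
  have E1: "E 1 a \<in> H" "eps_conj (E 1 a) \<in> H" if a: "a \<in> carrier ?B" for a
  proof -
    have e: "emb 1 a \<in> carrier ?A2" using emb_Omega[OF _ a, of 1] by (simp add: numeral_2_eq_2)
    show "E 1 a \<in> H" using D2[OF e] by (simp add: numeral_2_eq_2)
    show "eps_conj (E 1 a) \<in> H" using eps_conj_Delta[OF e] D2 by (auto simp: numeral_2_eq_2)
  qed
  have "NN \<subseteq> H"
  proof (rule N_least[OF H])
    fix a assume a: "a \<in> carrier ?A"
    let ?b = "Delta d 1 a 2"
    have b: "?b \<in> carrier ?A2" "uniform d 2 (block 1 a) = Delta d 2 ?b" using Delta_trunc[OF a, of 2] by auto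
    have "Delta d 1 a = single 1 a \<cdot> uniform d 2 (block 1 a)"
    proof (rule ext, rule ext)
      fix l u
      have "a permutes words d 1" using a by simp
      then have "u \<notin> words d 1 \<Longrightarrow> a u = u" by (simp add: permutes_def)
      then show "Delta d 1 a l u = (single 1 a \<cdot> uniform d 2 (block 1 a)) l u"
        by (auto simp: mult_P single_def uniform_def block_def words_def)
    qed
    then show "Delta d 1 a \<in> H" using s1[OF a] D2[OF b(1)] b(2) by simp
  next
    fix a assume a: "a \<in> carrier ?B"
    have eq: "tail d 1 a = E 1 a \<cdot> tail d 2 a" using tail_peel[OF a, of 1] by (simp add: numeral_2_eq_2)
    then show "tail d 1 a \<in> H" using E1 t2 a by simp
    have "eps_conj (tail d 1 a) = eps_conj (E 1 a) \<cdot> eps_conj (tail d 2 a)"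
      unfolding eq by (rule hom_mult[OF eps_conj_hom]) (use E1(1)[OF a] t2[OF a] H.subset in auto)
    then show "eps_conj (tail d 1 a) \<in> H" using E1 c2 a by simp
  qed
  moreover have "H \<subseteq> NN" unfolding H_def by (rule P.generate_subgroup_incl[OF SN N_subgroup])
  ultimately have "generate P S = NN" by (simp add: H_def)
  moreover have "finite S" "card S \<le> 4" by (auto simp: S_def card_insert_if)
  ultimately show ?thesis using SN by blast
qed

section \<open>Epsilon does not belong to N\<close>

text \<open>Counting occurrences of letters, rather than changed positions, makes the invariance under
products, inverses and conjugation by \<open>\<epsilon>\<close> immediate.\<close>

definition bounded_change :: "(nat \<Rightarrow> nat list \<Rightarrow> nat list) \<Rightarrow> bool" where
  "bounded_change p \<longleftrightarrow> (\<exists>m::int. \<forall>l\<ge>1. \<forall>u\<in>words d l. \<forall>a. \<bar>int (count_list (p l u) a) - int (count_list u a)\<bar> \<le> m)"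

lemma subgroup_bounded_change: "subgroup {p \<in> carrier P. bounded_change p} P"
proof (rule P.subgroupI)
  have "bounded_change \<one>\<^bsub>P\<^esub>" by (auto simp: bounded_change_def one_P)
  then show "{p \<in> carrier P. bounded_change p} \<noteq> {}" by blast
next
  fix p assume p: "p \<in> {p \<in> carrier P. bounded_change p}"
  then obtain m where m: "\<And>l u a. l \<ge> 1 \<Longrightarrow> u \<in> words d l \<Longrightarrow> \<bar>int (count_list (p l u) a) - int (count_list u a)\<bar> \<le> m"
    unfolding bounded_change_def by blast
  have "\<bar>int (count_list ((p\<^sup>-) l u) a) - int (count_list u a)\<bar> \<le> m" if l: "l \<ge> 1" and u: "u \<in> words d l" for l u a
  proof -
    have pl: "p l permutes words d l" using p l by (auto simp: carrier_P)
    have "pinv (p l) u \<in> words d l" using permutes_in_image[OF permutes_inv[OF pl]] u by blast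
    from m[OF l this, of a] show ?thesis using p l pl by (simp add: inv_P permutes_inverses)
  qed
  then show "p\<^sup>- \<in> {p \<in> carrier P. bounded_change p}" using p unfolding bounded_change_def by blast
next
  fix p q assume p: "p \<in> {p \<in> carrier P. bounded_change p}" and q: "q \<in> {p \<in> carrier P. bounded_change p}"
  then obtain m m' where m: "\<And>l u a. l \<ge> 1 \<Longrightarrow> u \<in> words d l \<Longrightarrow> \<bar>int (count_list (p l u) a) - int (count_list u a)\<bar> \<le> m"
    and m': "\<And>l u a. l \<ge> 1 \<Longrightarrow> u \<in> words d l \<Longrightarrow> \<bar>int (count_list (q l u) a) - int (count_list u a)\<bar> \<le> m'"
    unfolding bounded_change_def by blast
  have "\<bar>int (count_list ((p \<cdot> q) l u) a) - int (count_list u a)\<bar> \<le> m + m'" if l: "l \<ge> 1" and u: "u \<in> words d l" for l u a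
  proof -
    have "q l u \<in> words d l" using q l u by (auto simp: carrier_P permutes_in_image)
    from m[OF l this, of a] m'[OF l u, of a] show ?thesis using l by (simp add: mult_P)
  qed
  then show "p \<cdot> q \<in> {p \<in> carrier P. bounded_change p}" using p q unfolding bounded_change_def by blast
qed auto

lemma telescopic_count: "g \<in> \<B> \<Longrightarrow> set u \<subseteq> X \<Longrightarrow>
    \<bar>int (count_list (telescopic d g u) a) - int (count_list u a)\<bar> \<le> 2"
proof (induction u rule: induct_list012)
  case (3 x y w)
  show ?case
  proof (cases "x = d")
    case False
    then obtain x' y' where "g [x,y] = [x',y']" using 3 B_shape[of g x y] by (metis insert_subset list.simps(15))
    then show ?thesis using False by auto
  qed (use 3 in auto)
qed auto

lemma block_count: assumes s: "s \<in> \<Omega> 1" and l: "1 \<le> l" and u: "u \<in> words d l"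
  shows "\<bar>int (count_list (block 1 s u) a) - int (count_list u a)\<bar> \<le> 1"
proof -
  have t: "take 1 u \<in> words d 1" "s (take 1 u) \<in> words d 1"
    using take_words[OF u l] s by (auto simp: permutes_in_image)
  have "count_list u a = count_list (take 1 u) a + count_list (drop 1 u) a"
    by (metis append_take_drop_id count_list_append)
  moreover have "count_list (block 1 s u) a = count_list (s (take 1 u)) a + count_list (drop 1 u) a"
    by (simp add: block_def)
  moreover have "count_list (take 1 u) a \<le> 1" "count_list (s (take 1 u)) a \<le> 1"
    using t count_le_length[of "take 1 u" a] count_le_length[of "s (take 1 u)" a] by (auto simp: words_def)
  ultimately show ?thesis by linarith
qed

lemma count_delta_map: "count_list (delta_map u) a = count_list u (delta d a)"
proof -
  have "delta d x = a \<longleftrightarrow> x = delta d a" for x by (metis delta_involution)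
  then show ?thesis by (induction u) auto
qed

text \<open>A product of \<open>m\<close> generators changes each letter count by at most \<open>2m\<close>, but \<open>\<epsilon>\<close> turns the constant word
\<open>1\<dots>1\<close> of any length into the constant word \<open>d\<dots>d\<close>.\<close>

lemma eps_notin_N: "eps \<notin> NN"
proof
  assume "eps \<in> NN"
  have "NN \<subseteq> {p \<in> carrier P. bounded_change p}"
  proof (rule N_least[OF subgroup_bounded_change])
    fix s assume s: "s \<in> \<Omega> 1"
    then show "Delta d 1 s \<in> {p \<in> carrier P. bounded_change p}"
      using Delta_closed[of 1 s] block_count[OF s] by (auto simp: bounded_change_def uniform_def intro!: exI[of _ 1])
  next
    fix g assume g: "g \<in> \<B>"
    have ct1: "tail_map d (Suc 0) g u = telescopic d g u" for u by (simp add: tail_map_def)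
    have "\<bar>int (count_list (telescopic d g u) a) - int (count_list u a)\<bar> \<le> 2" if "u \<in> words d l" for u l a
      using telescopic_count[OF g] that by (auto simp: words_def)
    then have bt: "\<forall>l u a. u \<in> words d l \<longrightarrow> \<bar>int (count_list (telescopic d g u) a) - int (count_list u a)\<bar> \<le> 2" by blast
    then show "tail d 1 g \<in> {p \<in> carrier P. bounded_change p}"
      using tail_closed[OF g] by (auto simp: bounded_change_def uniform_def ct1 intro!: exI[of _ 2])
    have "\<bar>int (count_list ((delta_map \<circ> tail_map d 1 g \<circ> delta_map) u) a) - int (count_list u a)\<bar> \<le> 2" if "u \<in> words d l" for u l a
      using bt[rule_format, of "delta_map u" l "delta d a"] that by (simp add: ct1 count_delta_map delta_map_words)
    then have "bounded_change (uniform d 1 (delta_map \<circ> tail_map d 1 g \<circ> delta_map))"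
      by (auto simp: bounded_change_def uniform_def simp del: o_apply intro!: exI[of _ 2])
    then show "eps_conj (tail d 1 g) \<in> {p \<in> carrier P. bounded_change p}"
      using eps_conj_closed[OF tail_closed[OF g, of 1]] eps_conj_uniform[OF preserves_tail_map[OF g], of 1 1] by simp
  qed
  then have "bounded_change eps" using \<open>eps \<in> NN\<close> by blast
  then obtain m where m: "\<And>l u a. l \<ge> 1 \<Longrightarrow> u \<in> words d l \<Longrightarrow> \<bar>int (count_list (eps l u) a) - int (count_list u a)\<bar> \<le> m"
    unfolding bounded_change_def by blast
  let ?l = "Suc (nat m)"
  have w: "replicate ?l 1 \<in> words d ?l" using d5 by (auto simp: words_def)
  have "eps ?l (replicate ?l 1) = replicate ?l d" using w d5 by (simp add: epsilon_def delta_apply)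
  moreover have "count_list (replicate n a) b = (if a = b then n else 0)" for n and a b :: nat by (induction n) auto
  ultimately show False using m[OF _ w, of 1] d5 by (simp split: if_splits)
qed

end

lemma (in group) rcos_eqD:
  assumes "subgroup K G" "a \<in> carrier G" "b \<in> carrier G" "K #> a = K #> b"
  shows "a \<otimes> inv b \<in> K"
proof -
  have "a \<in> K #> b" using assms by (metis rcos_self)
  then obtain k where "k \<in> K" "a = k \<otimes> b" by (auto simp: r_coset_def)
  then show ?thesis using assms subgroup.mem_carrier[OF assms(1)] by (simp add: m_assoc)
qed

lemma (in group) rcos_eqI:
  assumes "subgroup K G" "a \<in> carrier G" "b \<in> carrier G" "a \<otimes> inv b \<in> K"
  shows "K #> a = K #> b"
proof -
  have "a = (a \<otimes> inv b) \<otimes> b" using assms by (simp add: m_assoc)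
  then have "a \<in> K #> b" using assms(4) by (force simp: r_coset_def)
  then show ?thesis using assms repr_independence by metis
qed

context telescope
begin

section \<open>Normal subgroups of finite index in N\<close>

definition N_invariant :: "(nat \<Rightarrow> nat list \<Rightarrow> nat list) set \<Rightarrow> bool" where
  "N_invariant K \<longleftrightarrow> subgroup K P \<and> (\<forall>n\<in>NN. \<forall>k\<in>K. n \<cdot> k \<cdot> n\<^sup>- \<in> K)"

text \<open>Modulo \<open>K\<close> the conjugating element of the commutator trick is trivial, and so is the resulting block.
Hence any two tails commute modulo \<open>K\<close>, and perfectness of \<open>B\<close> applies.\<close>

lemma tail_in_N_invariant:
  assumes K: "N_invariant K" and k: "1 \<le> k"
    and D: "\<And>j s. k \<le> j \<Longrightarrow> s \<in> \<Omega> j \<Longrightarrow> Delta d j s \<in> K"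
    and g: "g \<in> \<B>"
  shows "tail d k g \<in> K"
proof -
  have KP: "subgroup K P" using K by (simp add: N_invariant_def)
  interpret K: subgroup K "P" by fact
  have conj: "n \<cdot> x \<cdot> n\<^sup>- \<in> K" if "n \<in> NN" "x \<in> K" for n x using K that by (simp add: N_invariant_def)
  have "{g \<in> \<B>. tail d k g \<in> K} = \<B>"
  proof (rule Alt_generated_by_commutators[OF finite_Bset card_Bset(2) subgroup_tail[OF KP]])
    fix g h assume g: "g \<in> \<B>" and h: "h \<in> \<B>"
    let ?A = "tail d k g" and ?B = "tail d k h" and ?w = "Delta d k (corner_cycle k)"
    let ?x = "g \<circ> h \<circ> pinv g \<circ> pinv h"
    have gi: "pinv g \<in> \<B>" "pinv h \<in> \<B>"
      using Alt_closed[OF finite_Bset] g h by blast+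
    have x: "?x \<in> \<B>" using Alt_closed(1)[OF finite_Bset] g h gi by blast
    note c = tail_closed[OF g, of k] tail_closed[OF h, of k] Delta_closed[OF k corner_cycle_Omega[OF k]]
    have wK: "?w \<in> K" using D[OF order_refl corner_cycle_Omega[OF k]] .
    define t where "t = ?w \<cdot> ?B \<cdot> ?w\<^sup>-"
    define m where "m = ?w \<cdot> (?B \<cdot> ?w\<^sup>- \<cdot> ?B\<^sup>-)"
    have mK: "m \<in> K" unfolding m_def using wK conj[OF tail_N[OF k h]] by blast
    have mc: "m \<in> carrier P" using mK K.mem_carrier by blast
    \<comment> \<open>Conjugation by an element of \<open>K\<close> changes the tail of \<open>h\<close> only by the factor \<open>m \<in> K\<close>.\<close>
    have t: "t = m \<cdot> ?B" unfolding t_def m_def using c by (simp add: P.m_assoc)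
    have "?A \<cdot> t \<cdot> (t \<cdot> ?A)\<^sup>- \<in> K"
      unfolding t_def tail_comm[OF g h k] using D[of "k+1"] emb_Omega[OF k x] by simp
    then have "(?A \<cdot> m \<cdot> ?A\<^sup>-)\<^sup>- \<cdot> (?A \<cdot> t \<cdot> (t \<cdot> ?A)\<^sup>-) \<cdot> m \<in> K"
      using mK conj[OF tail_N[OF k g] mK] by blast
    moreover have "(?A \<cdot> m \<cdot> ?A\<^sup>-)\<^sup>- \<cdot> (?A \<cdot> t \<cdot> (t \<cdot> ?A)\<^sup>-) \<cdot> m = ?A \<cdot> ?B \<cdot> ?A\<^sup>- \<cdot> ?B\<^sup>-"
    proof -
      have l: "a\<^sup>- \<cdot> (a \<cdot> b) = b" if "a \<in> carrier P" "b \<in> carrier P" for a b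
        using that by (simp add: P.m_assoc[symmetric])
      show ?thesis unfolding t using c mc by (simp add: P.inv_mult_group P.m_assoc l)
    qed
    moreover have "tail d k ?x = ?A \<cdot> ?B \<cdot> ?A\<^sup>- \<cdot> ?B\<^sup>-"
    proof -
      have i: "tail d k (pinv f) = (tail d k f)\<^sup>-" if "f \<in> \<B>" for f
        using group_hom.hom_inv[of "Alt Bset" "P" "tail d k" f] tail_hom[of k] that
        by (simp add: group_hom_def group_hom_axioms_def group_Alt group_P inv_Alt del: Alt_simps(1))
      have m: "tail d k (a \<circ> b) = tail d k a \<cdot> tail d k b"
        if "a \<in> \<B>" "b \<in> \<B>" for a b
        using hom_mult[OF tail_hom that] by simp
      show ?thesis using g h gi Alt_closed(1)[OF finite_Bset]
        by (metis m i)
    qed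
    ultimately show "?x \<in> {g \<in> \<B>. tail d k g \<in> K}" using x by simp
  qed
  then show ?thesis using g by blast
qed

definition trunc :: "nat \<Rightarrow> (nat \<Rightarrow> nat list \<Rightarrow> nat list) \<Rightarrow> nat \<Rightarrow> nat list \<Rightarrow> nat list" where
  "trunc k p = (\<lambda>l\<in>{1..}. if k \<le> l then p l else id)"

lemma trunc_hom: "trunc k \<in> hom P P"
  by (rule homI) (auto simp: carrier_P trunc_def permutes_id mult_P fun_eq_iff)

lemma trunc_uniform: "j \<le> k \<Longrightarrow> trunc k (uniform d j f) = uniform d k f"
  by (auto simp: trunc_def uniform_def fun_eq_iff)

lemma trunc_eps_conj: "x \<in> carrier P \<Longrightarrow> trunc k (eps_conj x) = eps_conj (trunc k x)"
proof -
  assume "x \<in> carrier P"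
  have "eps l (eps l u) = u" if "1 \<le> l" for l u using fun_cong[OF fun_cong[OF eps_eps, of l], of u] that by (simp add: mult_P one_P)
  then show ?thesis unfolding eps_conj_def eps_inv by (auto simp: trunc_def mult_P fun_eq_iff)
qed

lemma trunc_Delta_in:
  assumes D: "\<And>j s. k \<le> j \<Longrightarrow> s \<in> \<Omega> j \<Longrightarrow> Delta d j s \<in> K"
    and j: "1 \<le> j" "j \<le> k" and s: "s \<in> \<Omega> j"
  shows "trunc k (Delta d j s) \<in> K"
  using D[OF order_refl Delta_trunc(1)[OF s j]] trunc_uniform[OF j(2)] Delta_trunc(2)[OF s j] by metis

text \<open>Cut off below level \<open>k\<close>, the generator becomes a product of cut-off blocks, which are blocks of
level \<open>k\<close>, and of its tail from level \<open>k\<close> on.\<close>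

lemma trunc_tail_in:
  assumes K: "N_invariant K" and k: "1 \<le> k"
    and D: "\<And>j s. k \<le> j \<Longrightarrow> s \<in> \<Omega> j \<Longrightarrow> Delta d j s \<in> K"
    and g: "g \<in> \<B>"
  shows "trunc k (tail d 1 g) \<in> K"
proof -
  have KP: "subgroup K P" using K by (simp add: N_invariant_def)
  have "1 \<le> j \<Longrightarrow> trunc k (tail d j g) \<in> K" if "j \<le> k" for j
    using that
  proof (induction j rule: inc_induct)
    case base
    then show ?case using tail_in_N_invariant[OF K k D g] by (simp add: trunc_uniform)
  next
    case (step j)
    have e: "emb j g \<in> \<Omega> (j+1)" by (rule emb_Omega[OF step.prems g])
    have "trunc k (tail d j g) = trunc k (E j g) \<cdot> trunc k (tail d (j+1) g)"
      unfolding tail_peel[OF g step.prems]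
      by (rule hom_mult[OF trunc_hom Delta_closed[OF _ e] tail_closed[OF g]]) simp
    moreover have "trunc k (E j g) \<in> K" by (rule trunc_Delta_in[OF D _ _ e]) (use step in auto)
    ultimately show ?case using step subgroup.m_closed[OF KP] by simp
  qed
  then show ?thesis using k by blast
qed

lemma N_invariant_eps_conj:
  assumes K: "N_invariant K" shows "N_invariant {x \<in> carrier P. eps_conj x \<in> K}"
  unfolding N_invariant_def
proof (intro conjI ballI)
  show "subgroup {x \<in> carrier P. eps_conj x \<in> K} P"
    using K subgroup_eps_conj by (simp add: N_invariant_def)
  fix n x assume n: "n \<in> NN" and x: "x \<in> {x \<in> carrier P. eps_conj x \<in> K}"
  interpret c: group_hom "P" "P" eps_conj
    using eps_conj_hom by (simp add: group_hom_def group_hom_axioms_def group_P)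
  have nc: "n \<in> carrier P" using N_carrier[OF n] .
  have "eps_conj n \<cdot> eps_conj x \<cdot> (eps_conj n)\<^sup>- \<in> K" using K eps_conj_N[OF n] x by (simp add: N_invariant_def)
  then show "n \<cdot> x \<cdot> n\<^sup>- \<in> {x \<in> carrier P. eps_conj x \<in> K}" using nc x by (simp add: c.hom_mult)
qed

text \<open>Truncation is an endomorphism of \<open>P\<close>, so the generators decide. For the conjugated generators,
replace \<open>K\<close> by its preimage under conjugation with \<open>\<epsilon>\<close>.\<close>

lemma trunc_N_in:
  assumes K: "N_invariant K" and k: "1 \<le> k"
    and D: "\<And>j s. k \<le> j \<Longrightarrow> s \<in> \<Omega> j \<Longrightarrow> Delta d j s \<in> K"
    and x: "x \<in> NN"
  shows "trunc k x \<in> K"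
proof -
  have KP: "subgroup K P" using K by (simp add: N_invariant_def)
  have "NN \<subseteq> {x \<in> carrier P. trunc k x \<in> K}"
  proof (rule N_least[OF subgroup_hom_preimage[OF group_P group_P trunc_hom KP]])
    fix s assume s: "s \<in> \<Omega> 1"
    then show "Delta d 1 s \<in> {x \<in> carrier P. trunc k x \<in> K}"
      using trunc_Delta_in[OF D _ k s] Delta_closed[OF _ s] by simp
  next
    fix g assume g: "g \<in> \<B>"
    show "tail d 1 g \<in> {x \<in> carrier P. trunc k x \<in> K}"
      using trunc_tail_in[OF K k D g] tail_closed[OF g] by simp
    have D': "Delta d j s \<in> {x \<in> carrier P. eps_conj x \<in> K}"
      if "k \<le> j" and s: "s \<in> \<Omega> j" for j s
      using eps_conj_Delta[OF s] D[OF that(1)] Delta_closed[OF _ s] that(1) k by fastforce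
    have "eps_conj (trunc k (tail d 1 g)) \<in> K"
      using trunc_tail_in[OF N_invariant_eps_conj[OF K] k D' g] by blast
    then show "eps_conj (tail d 1 g) \<in> {x \<in> carrier P. trunc k x \<in> K}"
      using trunc_eps_conj[OF tail_closed[OF g]] eps_conj_closed[OF tail_closed[OF g]] by simp
  qed
  then show ?thesis using x by blast
qed

lemma N_group_eq: "N = P\<lparr>carrier := NN\<rparr>" by (simp add: N_group_def)

lemma group_N: "group N"
  unfolding N_group_eq by (rule P.subgroup_imp_group[OF N_subgroup])

lemma N_simps [simp]: "carrier N = NN" "x \<otimes>\<^bsub>N\<^esub> y = x \<cdot> y" "\<one>\<^bsub>N\<^esub> = \<one>\<^bsub>P\<^esub>"
  by (simp_all add: N_group_def)

lemma inv_N: "x \<in> NN \<Longrightarrow> inv\<^bsub>N\<^esub> x = x\<^sup>-"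
  unfolding N_group_eq by (rule P.m_inv_consistent[OF N_subgroup])

lemma normal_N_invariant:
  assumes "K \<lhd> N" shows "N_invariant K"
proof -
  have "subgroup K P"
    using normal_imp_subgroup[OF assms] unfolding N_group_eq by (rule P.incl_subgroup[OF N_subgroup])
  moreover have "n \<cdot> k \<cdot> n\<^sup>- \<in> K" if "n \<in> NN" "k \<in> K" for n k
    using normal.inv_op_closed2[OF assms, of n k] that by (simp add: inv_N)
  ultimately show ?thesis by (simp add: N_invariant_def)
qed

definition level_kernel :: "nat \<Rightarrow> (nat \<Rightarrow> nat list \<Rightarrow> nat list) set" where
  "level_kernel n = {p \<in> NN. \<forall>l\<in>{1..n}. p l = id}"

text \<open>If there are more 3-cycles \<open>(p q z)\<close> than cosets of \<open>K\<close>, then two of them lie in the same coset; their quotient is a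
3-cycle in \<open>K\<close>, whose normal closure is the whole alternating group.\<close>

lemma Delta_in_finite_index:
  assumes K: "K \<in> finite_index_normal N" and k: "1 \<le> k"
    and big: "card (rcosets\<^bsub>N\<^esub> K) + 2 < card (words d k)"
    and s: "s \<in> \<Omega> k"
  shows "Delta d k s \<in> K"
proof -
  have nor: "K \<lhd> N" and fin: "finite (rcosets\<^bsub>N\<^esub> K)" using K by (auto simp: finite_index_normal_def)
  have inv: "N_invariant K" by (rule normal_N_invariant[OF nor])
  then have KP: "subgroup K P" by (simp add: N_invariant_def)
  interpret K: subgroup K "P" by fact
  interpret N: group "N" by (rule group_N)
  obtain p q where pq: "p \<in> words d k" "q \<in> words d k" "p \<noteq> q" using words_two[OF k] by blast
  let ?c = "\<lambda>z. Delta d k (cyc3 p q z)"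
  let ?Z = "words d k - {p,q}"
  have cz: "cyc3 p q z \<in> \<Omega> k" if "z \<in> ?Z" for z using that pq by (intro cyc3_Alt) auto
  have "(\<lambda>z. K #>\<^bsub>N\<^esub> ?c z) ` ?Z \<subseteq> rcosets\<^bsub>N\<^esub> K"
    using Delta_N[OF k cz] by (auto simp: RCOSETS_def)
  then have "card ((\<lambda>z. K #>\<^bsub>N\<^esub> ?c z) ` ?Z) \<le> card (rcosets\<^bsub>N\<^esub> K)"
    by (rule card_mono[OF fin])
  moreover have "card ?Z = card (words d k) - 2" using pq by (subst card_Diff_subset) auto
  ultimately have "\<not> inj_on (\<lambda>z. K #>\<^bsub>N\<^esub> ?c z) ?Z" using big by (intro pigeonhole) linarith
  then obtain z z' where z: "z \<in> ?Z" "z' \<in> ?Z" "z \<noteq> z'" "K #>\<^bsub>N\<^esub> ?c z = K #>\<^bsub>N\<^esub> ?c z'"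
    by (auto simp: inj_on_def)
  have "?c z \<cdot> (?c z')\<^sup>- \<in> K"
    using N.rcos_eqD[OF normal_imp_subgroup[OF nor] _ _ z(4)] Delta_N[OF k cz[OF z(1)]] Delta_N[OF k cz[OF z(2)]]
    by (simp add: inv_N)
  also have "?c z \<cdot> (?c z')\<^sup>- = Delta d k (cyc3 p q z \<circ> pinv (cyc3 p q z'))"
    using hom_mult[OF Delta_hom'[OF k] cz[OF z(1)] Alt_closed(2)[OF finite_words cz[OF z(2)] cz[OF z(2)]]]
    by (simp add: Delta_inv[OF k cz[OF z(2)]])
  also have "cyc3 p q z \<circ> pinv (cyc3 p q z') = cyc3 p z' z" using z pq by (intro cyc3_quotient) auto
  finally have c3: "Delta d k (cyc3 p z' z) \<in> K" .
  have "{s \<in> \<Omega> k. Delta d k s \<in> K} = \<Omega> k"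
  proof (rule normal_subgroup_with_cyc3[OF finite_words card_words_5[OF k] subgroup_Delta[OF k KP]])
    show "{p,z',z} \<subseteq> words d k" "distinct [p,z',z]" using z pq by auto
    then have "cyc3 p z' z \<in> \<Omega> k" by (intro cyc3_Alt) auto
    then show "cyc3 p z' z \<in> {s \<in> \<Omega> k. Delta d k s \<in> K}" using c3 by blast
  next
    fix h t assume h: "h \<in> {s \<in> \<Omega> k. Delta d k s \<in> K}" and t: "t \<in> \<Omega> k"
    have hc: "h \<in> \<Omega> k" using h by blast
    have ti: "pinv t \<in> \<Omega> k" "t \<circ> h \<in> \<Omega> k" using Alt_closed[OF finite_words] t hc by blast+
    have "Delta d k t \<cdot> Delta d k h \<cdot> (Delta d k t)\<^sup>- \<in> K"
      using inv Delta_N[OF k t] h by (simp add: N_invariant_def)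
    also have "Delta d k t \<cdot> Delta d k h \<cdot> (Delta d k t)\<^sup>- = Delta d k (t \<circ> h \<circ> pinv t)"
      using hom_mult[OF Delta_hom'[OF k] t hc] hom_mult[OF Delta_hom'[OF k] ti(2,1)] by (simp add: Delta_inv[OF k t])
    finally show "t \<circ> h \<circ> pinv t \<in> {s \<in> \<Omega> k. Delta d k s \<in> K}"
      using Alt_closed(1)[OF finite_words ti(2,1)] by blast
  qed
  then show ?thesis using s by blast
qed

text \<open>Elements that are trivial up to level \<open>k\<close> are not changed by truncation below \<open>k\<close>.\<close>

lemma level_kernel_cofinal:
  assumes K: "K \<in> finite_index_normal N"
  shows "\<exists>n. level_kernel n \<subseteq> K"
proof
  \<comment> \<open>From this level on there are enough words for the pigeonhole argument, as \<open>j < d\<^sup>j\<close>.\<close>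
  let ?k = "card (rcosets\<^bsub>N\<^esub> K) + 3"
  have inv: "N_invariant K" using K normal_N_invariant by (auto simp: finite_index_normal_def)
  have D: "Delta d j s \<in> K" if "?k \<le> j" "s \<in> \<Omega> j" for j s
  proof (rule Delta_in_finite_index[OF K])
    have "j < d ^ j" using d5 by (intro power_gt_expt) auto
    then show "card (rcosets\<^bsub>N\<^esub> K) + 2 < card (words d j)" using that by (simp add: card_words)
  qed (use that in auto)
  show "level_kernel ?k \<subseteq> K"
  proof
    fix p assume p: "p \<in> level_kernel ?k"
    then have "trunc ?k p \<in> K" using trunc_N_in[OF inv _ D] by (simp add: level_kernel_def)
    moreover have "trunc ?k p = p"
    proof
      fix l show "trunc ?k p l = p l"
        using p N_carrier[of p] by (cases "1 \<le> l") (auto simp: trunc_def level_kernel_def carrier_P extensional_def)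
    qed
    ultimately show "p \<in> K" by simp
  qed
qed

end

section \<open>Profinite completions\<close>

abbreviation FIN where "FIN \<equiv> finite_index_normal"
abbreviation completion where "completion \<equiv> profinite_completion"

context group
begin

lemma FIN_D: "K \<in> FIN G \<Longrightarrow> K \<lhd> G" "K \<in> FIN G \<Longrightarrow> subgroup K G" "K \<in> FIN G \<Longrightarrow> finite (rcosets K)"
  by (auto simp: finite_index_normal_def normal_imp_subgroup)

text \<open>Finite index is shown by a finite invariant \<open>\<phi>\<close> that separates the cosets of \<open>K\<close>.\<close>

lemma FIN_I:
  assumes K: "K \<lhd> G" and fin: "finite (\<phi> ` carrier G)"
    and sep: "\<And>a b. a \<in> carrier G \<Longrightarrow> b \<in> carrier G \<Longrightarrow> \<phi> a = \<phi> b \<Longrightarrow> a \<otimes> inv b \<in> K"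
  shows "K \<in> FIN G"
proof -
  have "rcosets K \<subseteq> (\<lambda>y. K #> (SOME g. g \<in> carrier G \<and> \<phi> g = y)) ` \<phi> ` carrier G"
  proof
    fix c assume "c \<in> rcosets K"
    then obtain g where g: "g \<in> carrier G" "c = K #> g" by (auto simp: RCOSETS_def)
    let ?h = "SOME h. h \<in> carrier G \<and> \<phi> h = \<phi> g"
    have h: "?h \<in> carrier G \<and> \<phi> ?h = \<phi> g" by (rule someI[of _ g]) (use g in simp)
    then have "K #> g = K #> ?h" using sep g by (intro rcos_eqI[OF normal_imp_subgroup[OF K]]) auto
    then show "c \<in> (\<lambda>y. K #> (SOME g. g \<in> carrier G \<and> \<phi> g = y)) ` \<phi> ` carrier G" using g by blast
  qed
  then show ?thesis using K fin by (auto simp: finite_index_normal_def intro: finite_subset)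
qed

lemma carrier_FIN: "carrier G \<in> FIN G"
  by (rule FIN_I[where \<phi> = "\<lambda>_. ()"]) (auto simp: normal_inv_iff subgroup_self)

lemma FIN_preimage:
  assumes H: "group H" and f: "f \<in> hom G H" and L: "L \<in> FIN H"
  shows "{g \<in> carrier G. f g \<in> L} \<in> FIN G"
proof -
  interpret H: group H by fact
  interpret f: group_hom G H f using f by unfold_locales
  have LH: "L \<lhd> H" "subgroup L H" using H.FIN_D[OF L] by auto
  have N: "{g \<in> carrier G. f g \<in> L} \<lhd> G"
    unfolding normal_inv_iff
  proof (intro conjI ballI)
    show "subgroup {g \<in> carrier G. f g \<in> L} G" by (rule subgroup_hom_preimage[OF group_axioms H f LH(2)])
    fix x h assume "x \<in> carrier G" "h \<in> {g \<in> carrier G. f g \<in> L}"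
    then show "x \<otimes> h \<otimes> inv x \<in> {g \<in> carrier G. f g \<in> L}"
      using normal.inv_op_closed2[OF LH(1), of "f x" "f h"] by simp
  qed
  show ?thesis
  proof (rule FIN_I[OF N, where \<phi> = "\<lambda>g. L #>\<^bsub>H\<^esub> f g"])
    have "(\<lambda>g. L #>\<^bsub>H\<^esub> f g) ` carrier G \<subseteq> rcosets\<^bsub>H\<^esub> L"
      using f.hom_closed by (fastforce simp: RCOSETS_def)
    then show "finite ((\<lambda>g. L #>\<^bsub>H\<^esub> f g) ` carrier G)" using H.FIN_D(3)[OF L] finite_subset by blast
    fix a b assume "a \<in> carrier G" "b \<in> carrier G" "L #>\<^bsub>H\<^esub> f a = L #>\<^bsub>H\<^esub> f b"
    then show "a \<otimes> inv b \<in> {g \<in> carrier G. f g \<in> L}" using H.rcos_eqD[OF LH(2)] by simp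
  qed
qed

lemma carrier_completion:
  "x \<in> carrier (completion G) \<longleftrightarrow> x \<in> extensional (FIN G) \<and> (\<forall>K\<in>FIN G. x K \<in> rcosets K) \<and>
     (\<forall>K\<in>FIN G. \<forall>L\<in>FIN G. K \<subseteq> L \<longrightarrow> x K \<subseteq> x L)"
  by (auto simp: profinite_completion_def FactGroup_def PiE_iff)

lemma mult_completion: "x \<otimes>\<^bsub>completion G\<^esub> y = (\<lambda>K\<in>FIN G. x K <#> y K)"
  by (simp add: profinite_completion_def FactGroup_def)

lemma one_completion: "\<one>\<^bsub>completion G\<^esub> = (\<lambda>K\<in>FIN G. K)"
  by (simp add: profinite_completion_def FactGroup_def)

lemma completion_rep:
  assumes "x \<in> carrier (completion G)" "K \<in> FIN G"
  obtains g where "g \<in> carrier G" "x K = K #> g"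
  using assms by (auto simp: carrier_completion RCOSETS_def)

text \<open>A representative of the coordinate at \<open>K\<close> represents all coordinates at larger subgroups. Every
later computation in a completion goes through such representatives.\<close>

lemma completion_rep_mono:
  assumes x: "x \<in> carrier (completion G)" and KL: "K \<in> FIN G" "L \<in> FIN G" "K \<subseteq> L"
    and g: "g \<in> carrier G" "x K = K #> g"
  shows "x L = L #> g"
proof -
  have "g \<in> x K" using g FIN_D(2)[OF KL(1)] rcos_self by simp
  then have "g \<in> x L" using x KL unfolding carrier_completion by blast
  moreover obtain h where h: "h \<in> carrier G" "x L = L #> h" using completion_rep[OF x KL(2)] by blast
  ultimately show ?thesis using repr_independence[OF _ h(1) FIN_D(2)[OF KL(2)]] by simp
qed

lemma completion_mult_at:
  assumes "K \<in> FIN G" "g \<in> carrier G" "h \<in> carrier G" "x K = K #> g" "y K = K #> h"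
  shows "(x \<otimes>\<^bsub>completion G\<^esub> y) K = K #> (g \<otimes> h)"
  using assms normal.rcos_sum[OF FIN_D(1)[OF assms(1)]] by (simp add: mult_completion)

lemma completion_I:
  assumes ext: "x \<in> extensional (FIN G)"
    and rep: "\<And>K. K \<in> FIN G \<Longrightarrow> \<exists>g\<in>carrier G. x K = K #> g"
    and mono: "\<And>K L. K \<in> FIN G \<Longrightarrow> L \<in> FIN G \<Longrightarrow> K \<subseteq> L \<Longrightarrow> \<exists>g\<in>carrier G. x K = K #> g \<and> x L = L #> g"
  shows "x \<in> carrier (completion G)"
proof -
  have "x K \<in> rcosets K" if "K \<in> FIN G" for K using rep[OF that] FIN_D(2)[OF that] by (auto simp: RCOSETS_def)
  moreover have "x K \<subseteq> x L" if KL: "K \<in> FIN G" "L \<in> FIN G" "K \<subseteq> L" for K L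
    using mono[OF KL] KL(3) unfolding r_coset_def by fastforce
  ultimately show ?thesis using ext by (simp add: carrier_completion)
qed

lemma product_Mod_group: "group (product_group (FIN G) (\<lambda>K. G Mod K))"
  using FIN_D(1) normal.factorgroup_is_group by (intro product_group) blast

lemma completion_subgroup: "subgroup (carrier (completion G)) (product_group (FIN G) (\<lambda>K. G Mod K))"
proof (rule group.subgroupI[OF product_Mod_group])
  show "carrier (completion G) \<subseteq> carrier (product_group (FIN G) (\<lambda>K. G Mod K))"
    by (simp add: carrier_completion FactGroup_def PiE_iff subset_iff)
  have one: "K #> \<one> = K" if "K \<in> FIN G" for K
    using subgroup.subset[OF FIN_D(2)[OF that]] by (rule coset_mult_one)
  have "(\<lambda>K\<in>FIN G. K) \<in> carrier (completion G)"
  proof (rule completion_I)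
    fix K L assume "K \<in> FIN G" "L \<in> FIN G" "K \<subseteq> L"
    then show "\<exists>g\<in>carrier G. (\<lambda>K\<in>FIN G. K) K = K #> g \<and> (\<lambda>K\<in>FIN G. K) L = L #> g"
      using one by (intro bexI[of _ \<one>]) simp_all
  next
    fix K assume "K \<in> FIN G"
    then show "\<exists>g\<in>carrier G. (\<lambda>K\<in>FIN G. K) K = K #> g"
      using one by (intro bexI[of _ \<one>]) simp_all
  qed auto
  then show "carrier (completion G) \<noteq> {}" by blast
next
  fix x assume x: "x \<in> carrier (completion G)"
  have xP: "x \<in> (\<Pi>\<^sub>E K\<in>FIN G. carrier (G Mod K))" using x by (auto simp: carrier_completion FactGroup_def PiE_iff)
  have inv: "inv\<^bsub>product_group (FIN G) (\<lambda>K. G Mod K)\<^esub> x = (\<lambda>K\<in>FIN G. inv\<^bsub>G Mod K\<^esub> x K)"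
    using xP FIN_D(1) normal.factorgroup_is_group by (intro inv_product_group) blast+
  have at: "inv\<^bsub>G Mod K\<^esub> x K = K #> inv g" if K: "K \<in> FIN G" and g: "g \<in> carrier G" "x K = K #> g" for K g
  proof -
    interpret K: normal K G by (rule FIN_D(1)[OF K])
    have "x K \<in> carrier (G Mod K)" using xP K by auto
    then show ?thesis using K.inv_FactGroup K.rcos_inv g by (simp add: FactGroup_def)
  qed
  show "inv\<^bsub>product_group (FIN G) (\<lambda>K. G Mod K)\<^esub> x \<in> carrier (completion G)"
    unfolding inv
  proof (rule completion_I)
    fix K assume K: "K \<in> FIN G"
    obtain g where g: "g \<in> carrier G" "x K = K #> g" using completion_rep[OF x K] by blast
    then show "\<exists>g\<in>carrier G. (\<lambda>K\<in>FIN G. inv\<^bsub>G Mod K\<^esub> x K) K = K #> g"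
      using at[OF K g] K by (intro bexI[of _ "inv g"]) auto
  next
    fix K L assume K: "K \<in> FIN G" and L: "L \<in> FIN G" and KL: "K \<subseteq> L"
    obtain g where g: "g \<in> carrier G" "x K = K #> g" using completion_rep[OF x K] by blast
    then show "\<exists>g\<in>carrier G. (\<lambda>K\<in>FIN G. inv\<^bsub>G Mod K\<^esub> x K) K = K #> g \<and> (\<lambda>K\<in>FIN G. inv\<^bsub>G Mod K\<^esub> x K) L = L #> g"
      using at[OF K g] at[OF L g(1) completion_rep_mono[OF x K L KL g]] K L by (intro bexI[of _ "inv g"]) auto
  qed auto
next
  fix x y assume x: "x \<in> carrier (completion G)" and y: "y \<in> carrier (completion G)"
  have e: "x \<otimes>\<^bsub>product_group (FIN G) (\<lambda>K. G Mod K)\<^esub> y = x \<otimes>\<^bsub>completion G\<^esub> y"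
    by (simp add: profinite_completion_def)
  show "x \<otimes>\<^bsub>product_group (FIN G) (\<lambda>K. G Mod K)\<^esub> y \<in> carrier (completion G)"
    unfolding e
  proof (rule completion_I)
    show "x \<otimes>\<^bsub>completion G\<^esub> y \<in> extensional (FIN G)" by (simp add: mult_completion)
    fix K assume K: "K \<in> FIN G"
    obtain g where g: "g \<in> carrier G" "x K = K #> g" using completion_rep[OF x K] by blast
    obtain h where h: "h \<in> carrier G" "y K = K #> h" using completion_rep[OF y K] by blast
    show "\<exists>g\<in>carrier G. (x \<otimes>\<^bsub>completion G\<^esub> y) K = K #> g"
      using completion_mult_at[where x = x and y = y, OF K g(1) h(1) g(2) h(2)] g h by blast
    fix L assume L: "L \<in> FIN G" and KL: "K \<subseteq> L"
    show "\<exists>g\<in>carrier G. (x \<otimes>\<^bsub>completion G\<^esub> y) K = K #> g \<and> (x \<otimes>\<^bsub>completion G\<^esub> y) L = L #> g"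
      using completion_mult_at[where x = x and y = y, OF K g(1) h(1) g(2) h(2)] g h
        completion_mult_at[where x = x and y = y, OF L g(1) h(1) completion_rep_mono[OF x K L KL g] completion_rep_mono[OF y K L KL h]] by blast
  qed
qed

lemma completion_eq: "completion G = (product_group (FIN G) (\<lambda>K. G Mod K))\<lparr>carrier := carrier (completion G)\<rparr>"
  by (simp add: profinite_completion_def)

lemma group_completion: "group (completion G)"
  using group.subgroup_imp_group[OF product_Mod_group completion_subgroup] completion_eq by simp

lemma completion_inv_at:
  assumes x: "x \<in> carrier (completion G)" and K: "K \<in> FIN G" and g: "g \<in> carrier G" "x K = K #> g"
  shows "(inv\<^bsub>completion G\<^esub> x) K = K #> inv g"
proof -
  interpret C: group "completion G" by (rule group_completion)
  obtain h where h: "h \<in> carrier G" "(inv\<^bsub>completion G\<^esub> x) K = K #> h"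
    using completion_rep[OF C.inv_closed[OF x] K] by blast
  have "K #> (g \<otimes> h) = (x \<otimes>\<^bsub>completion G\<^esub> inv\<^bsub>completion G\<^esub> x) K"
    using completion_mult_at[where x = x and y = "inv\<^bsub>completion G\<^esub> x", OF K g(1) h(1) g(2) h(2)] by simp
  also have "\<dots> = K" using C.r_inv[OF x] K by (simp add: one_completion)
  finally have "g \<otimes> h \<in> K" using g h FIN_D(2)[OF K] by (metis m_closed rcos_self)
  moreover have "inv g \<otimes> (g \<otimes> h) \<otimes> inv (inv g) = h \<otimes> inv (inv g)" using g h by (simp add: m_assoc[symmetric])
  ultimately have "h \<otimes> inv (inv g) \<in> K" using normal.inv_op_closed2[OF FIN_D(1)[OF K], of "inv g" "g \<otimes> h"] g by simp
  then show ?thesis using h g rcos_eqI[OF FIN_D(2)[OF K]] by simp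
qed

lemma to_completion_closed: "g \<in> carrier G \<Longrightarrow> to_completion G g \<in> carrier (completion G)"
  by (rule completion_I) (auto simp: to_completion_def)

lemma completion_eqI:
  assumes "x \<in> carrier (completion G)" "y \<in> carrier (completion G)" "\<And>K. K \<in> FIN G \<Longrightarrow> x K = y K"
  shows "x = y"
  using assms by (intro extensionalityI[of _ "FIN G"]) (auto simp: carrier_completion)

lemma completion_map_at:
  assumes H: "group H" and f: "f \<in> hom G H" and L: "L \<in> FIN H" and x: "x \<in> carrier (completion G)"
    and K: "K \<in> FIN G" "K \<subseteq> {g \<in> carrier G. f g \<in> L}" and g: "g \<in> carrier G" "x K = K #> g"
  shows "completion_map G H f x L = L #>\<^bsub>H\<^esub> f g"
proof -
  interpret H: group H by fact
  interpret f: group_hom G H f using f by unfold_locales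
  let ?K = "{g \<in> carrier G. f g \<in> L}"
  have "x ?K = ?K #> g" by (rule completion_rep_mono[OF x K(1) FIN_preimage[OF H f L] K(2) g])
  moreover have "L <#>\<^bsub>H\<^esub> (f ` (?K #> g)) = L #>\<^bsub>H\<^esub> f g"
  proof
    note LH = H.FIN_D(2)[OF L]
    show "L <#>\<^bsub>H\<^esub> (f ` (?K #> g)) \<subseteq> L #>\<^bsub>H\<^esub> f g"
    proof
      fix y assume "y \<in> L <#>\<^bsub>H\<^esub> (f ` (?K #> g))"
      then obtain l k where lk: "l \<in> L" "k \<in> ?K" "y = l \<otimes>\<^bsub>H\<^esub> f (k \<otimes> g)" by (auto simp: set_mult_def r_coset_def)
      then have "y = (l \<otimes>\<^bsub>H\<^esub> f k) \<otimes>\<^bsub>H\<^esub> f g" using g subgroup.mem_carrier[OF LH] by (simp add: H.m_assoc)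
      moreover have "l \<otimes>\<^bsub>H\<^esub> f k \<in> L" using lk subgroup.m_closed[OF LH] by simp
      ultimately show "y \<in> L #>\<^bsub>H\<^esub> f g" by (auto simp: r_coset_def)
    qed
    show "L #>\<^bsub>H\<^esub> f g \<subseteq> L <#>\<^bsub>H\<^esub> (f ` (?K #> g))"
    proof
      fix y assume "y \<in> L #>\<^bsub>H\<^esub> f g"
      then obtain l where l: "l \<in> L" "y = l \<otimes>\<^bsub>H\<^esub> f g" by (auto simp: r_coset_def)
      have "g \<in> ?K #> g" using g subgroup.one_closed[OF LH] by (force simp: r_coset_def)
      then show "y \<in> L <#>\<^bsub>H\<^esub> (f ` (?K #> g))" using l by (auto simp: set_mult_def)
    qed
  qed
  ultimately show ?thesis using L by (simp add: completion_map_def)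
qed

lemma completion_map_closed:
  assumes H: "group H" and f: "f \<in> hom G H" and x: "x \<in> carrier (completion G)"
  shows "completion_map G H f x \<in> carrier (completion H)"
proof (rule group.completion_I[OF H])
  show "completion_map G H f x \<in> extensional (FIN H)" by (simp add: completion_map_def)
  have *: "\<exists>g\<in>carrier H. completion_map G H f x K = K #>\<^bsub>H\<^esub> g \<and> completion_map G H f x L = L #>\<^bsub>H\<^esub> g"
    if K: "K \<in> FIN H" and L: "L \<in> FIN H" and KL: "K \<subseteq> L" for K L
  proof -
    have P: "{g \<in> carrier G. f g \<in> K} \<in> FIN G" by (rule FIN_preimage[OF H f K])
    obtain g where g: "g \<in> carrier G" "x {g \<in> carrier G. f g \<in> K} = {g \<in> carrier G. f g \<in> K} #> g"
      using completion_rep[OF x P] by blast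
    have "completion_map G H f x K = K #>\<^bsub>H\<^esub> f g" by (rule completion_map_at[OF H f K x P _ g]) auto
    moreover have "completion_map G H f x L = L #>\<^bsub>H\<^esub> f g"
      by (rule completion_map_at[OF H f L x P _ g]) (use KL in auto)
    ultimately show ?thesis using hom_in_carrier[OF f g(1)] by blast
  qed
  show "\<exists>g\<in>carrier H. completion_map G H f x K = K #>\<^bsub>H\<^esub> g \<and> completion_map G H f x L = L #>\<^bsub>H\<^esub> g"
    if "K \<in> FIN H" "L \<in> FIN H" "K \<subseteq> L" for K L using *[OF that] .
  show "\<exists>g\<in>carrier H. completion_map G H f x K = K #>\<^bsub>H\<^esub> g" if "K \<in> FIN H" for K
    using *[OF that that] by blast
qed

abbreviation "Mod_topology \<equiv> product_topology (\<lambda>K. discrete_topology (carrier (G Mod K))) (FIN G)"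

lemma openin_Mod_coordinate:
  assumes "K \<in> FIN G"
  shows "openin Mod_topology {x \<in> topspace Mod_topology. x K = a}"
proof (cases "a \<in> carrier (G Mod K)")
  case True
  have "openin Mod_topology {x \<in> topspace Mod_topology. x K \<in> {a}}"
    by (rule openin_continuous_map_preimage[OF continuous_map_product_projection[OF assms]]) (use True in simp)
  then show ?thesis by simp
next
  case False
  then have "{x \<in> topspace Mod_topology. x K = a} = {}" using assms by auto
  then show ?thesis by (simp only: openin_empty)
qed

lemma openin_Mod_relation:
  assumes "K \<in> FIN G" "L \<in> FIN G"
  shows "openin Mod_topology {x \<in> topspace Mod_topology. R (x K) (x L)}"
proof -
  have "{x \<in> topspace Mod_topology. R (x K) (x L)} =
    \<Union> {{x \<in> topspace Mod_topology. x K = a} \<inter> {x \<in> topspace Mod_topology. x L = b} | a b. R a b}" by blast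
  moreover have "openin Mod_topology (\<Union> {{x \<in> topspace Mod_topology. x K = a} \<inter> {x \<in> topspace Mod_topology. x L = b} | a b. R a b})"
    using openin_Mod_coordinate assms by (intro openin_Union) (auto intro!: openin_Int)
  ultimately show ?thesis by simp
qed

lemma closedin_Mod_relation:
  assumes "K \<in> FIN G" "L \<in> FIN G"
  shows "closedin Mod_topology {x \<in> topspace Mod_topology. R (x K) (x L)}"
proof -
  have "topspace Mod_topology - {x \<in> topspace Mod_topology. R (x K) (x L)} = {x \<in> topspace Mod_topology. \<not> R (x K) (x L)}" by blast
  then show ?thesis using openin_Mod_relation[OF assms, of "\<lambda>a b. \<not> R a b"] by (simp add: closedin_def)
qed

lemma completion_sub_topspace: "carrier (completion G) \<subseteq> topspace Mod_topology"
  by (simp add: carrier_completion FactGroup_def PiE_iff subset_iff)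

text \<open>Compatibility of the coordinates at \<open>K\<close> and \<open>L\<close> depends on these two coordinates only, so it is
a closed condition in the product of discrete spaces.\<close>

lemma closedin_completion: "closedin Mod_topology (carrier (completion G))"
proof -
  have "carrier (completion G) = \<Inter> {{x \<in> topspace Mod_topology. x K \<subseteq> x L} | K L. K \<in> FIN G \<and> L \<in> FIN G \<and> K \<subseteq> L}" (is "?A = ?B")
  proof
    show "?A \<subseteq> ?B" proof
      fix x assume x: "x \<in> ?A"
      then have "x K \<subseteq> x L" if "K \<in> FIN G" "L \<in> FIN G" "K \<subseteq> L" for K L
        using that unfolding carrier_completion by blast
      then show "x \<in> ?B" using x completion_sub_topspace by blast
    qed
    show "?B \<subseteq> ?A"
    proof
      fix x assume x: "x \<in> ?B"
      then have "x \<in> topspace Mod_topology" using carrier_FIN by blast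
      moreover have "x K \<subseteq> x L" if "K \<in> FIN G" "L \<in> FIN G" "K \<subseteq> L" for K L using x that by blast
      ultimately show "x \<in> ?A" by (auto simp: carrier_completion FactGroup_def PiE_iff)
    qed
  qed
  moreover have "closedin Mod_topology ?B"
    by (rule closedin_Inter) (use carrier_FIN closedin_Mod_relation in blast)+
  ultimately show ?thesis by simp
qed

lemma topspace_completion: "topspace (completion_topology G) = carrier (completion G)"
  using completion_sub_topspace by (auto simp: completion_topology_def)

lemma compact_completion: "compact_space (completion_topology G)"
proof -
  have "compact_space Mod_topology"
    by (auto simp: compact_space_product_topology compact_space_discrete_topology FactGroup_def FIN_D(3))
  then show ?thesis unfolding completion_topology_def
    by (intro compact_space_subtopology closedin_compact_space closedin_completion)
qed

lemma Hausdorff_completion: "Hausdorff_space (completion_topology G)"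
  unfolding completion_topology_def
  by (intro Hausdorff_space_subtopology) (simp add: Hausdorff_space_product_topology)

lemma closedin_completion_coordinate:
  assumes "K \<in> FIN G" shows "closedin (completion_topology G) {x \<in> carrier (completion G). x K = a}"
proof -
  have "closedin (completion_topology G) (carrier (completion G) \<inter> {x \<in> topspace Mod_topology. x K = a})"
    unfolding completion_topology_def using closedin_Mod_relation[OF assms assms, of "\<lambda>b _. b = a"]
    by (auto simp: closedin_subtopology)
  moreover have "carrier (completion G) \<inter> {x \<in> topspace Mod_topology. x K = a} = {x \<in> carrier (completion G). x K = a}"
    using completion_sub_topspace by blast
  ultimately show ?thesis by simp
qed

lemma openin_completion_coordinate:
  assumes "K \<in> FIN G" shows "openin (completion_topology G) {x \<in> carrier (completion G). Q (x K)}"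
proof -
  have "openin (completion_topology G) (carrier (completion G) \<inter> {x \<in> topspace Mod_topology. Q (x K)})"
    unfolding completion_topology_def using openin_Mod_relation[OF assms assms, of "\<lambda>b _. Q b"]
    by (auto simp: openin_subtopology)
  moreover have "carrier (completion G) \<inter> {x \<in> topspace Mod_topology. Q (x K)} = {x \<in> carrier (completion G). Q (x K)}"
    using completion_sub_topspace by blast
  ultimately show ?thesis by simp
qed

end

text \<open>A descending chain that is cofinal among the normal subgroups of finite index determines the
completion: its points are the coherent sequences along the chain.\<close>

locale completion_chain = group +
  fixes M :: "nat \<Rightarrow> 'a set"
  assumes M_FIN: "M n \<in> FIN G" and M_anti: "m \<le> n \<Longrightarrow> M n \<subseteq> M m"
    and M_cofinal: "K \<in> FIN G \<Longrightarrow> \<exists>n. M n \<subseteq> K"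
begin

lemma completion_ext:
  assumes x: "x \<in> carrier (completion G)" and y: "y \<in> carrier (completion G)" and eq: "\<And>n. x (M n) = y (M n)"
  shows "x = y"
proof (rule completion_eqI[OF x y])
  fix K assume K: "K \<in> FIN G"
  obtain n where n: "M n \<subseteq> K" using M_cofinal[OF K] by blast
  obtain g where g: "g \<in> carrier G" "x (M n) = M n #> g" using completion_rep[OF x M_FIN] by blast
  show "x K = y K"
    using completion_rep_mono[OF x M_FIN K n g] completion_rep_mono[OF y M_FIN K n g(1)] g eq by simp
qed

lemma completion_lift:
  assumes s: "\<And>n. s n \<in> carrier G" and coh: "\<And>m n. n \<le> m \<Longrightarrow> s m \<otimes> inv (s n) \<in> M n"
  shows "\<exists>x\<in>carrier (completion G). \<forall>n K. K \<in> FIN G \<longrightarrow> M n \<subseteq> K \<longrightarrow> x K = K #> s n"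
proof -
  have eq: "K #> s m = K #> s n" if K: "K \<in> FIN G" and m: "M m \<subseteq> K" and n: "M n \<subseteq> K" for K m n
  proof -
    have "s m \<otimes> inv (s n) \<in> K \<or> s n \<otimes> inv (s m) \<in> K" using coh[of m n] coh[of n m] m n by (meson in_mono linear)
    then show ?thesis using rcos_eqI[OF FIN_D(2)[OF K] s s] by metis
  qed
  define x where "x = (\<lambda>K\<in>FIN G. K #> s (SOME n. M n \<subseteq> K))"
  have at: "x K = K #> s n" if K: "K \<in> FIN G" and n: "M n \<subseteq> K" for K n
    using eq[OF K someI[of "\<lambda>n. M n \<subseteq> K", OF n] n] K by (simp add: x_def)
  have "x \<in> carrier (completion G)"
  proof (rule completion_I)
    show "x \<in> extensional (FIN G)" by (simp add: x_def)
    fix K assume K: "K \<in> FIN G"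
    obtain n where n: "M n \<subseteq> K" using M_cofinal[OF K] by blast
    show "\<exists>g\<in>carrier G. x K = K #> g" using at[OF K n] s by blast
    fix L assume L: "L \<in> FIN G" "K \<subseteq> L"
    show "\<exists>g\<in>carrier G. x K = K #> g \<and> x L = L #> g" using at[OF K n] at[OF L(1), of n] n L(2) s by blast
  qed
  then show ?thesis using at by blast
qed

end

context telescope
begin

section \<open>The completion of N and the automorphism tau\<close>

lemma level_perm: "p \<in> NN \<Longrightarrow> 1 \<le> l \<Longrightarrow> p l permutes words d l"
  using N_carrier by (simp add: carrier_P)

lemma mult_level: "1 \<le> l \<Longrightarrow> (x \<cdot> y) l = x l \<circ> y l"
  by (simp add: mult_P)

lemma inv_level: "x \<in> carrier P \<Longrightarrow> 1 \<le> l \<Longrightarrow> (x\<^sup>-) l = pinv (x l)"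
  by (simp add: inv_P)

lemma one_level: "1 \<le> l \<Longrightarrow> \<one>\<^bsub>P\<^esub> l = id"
  by (simp add: one_P)

lemma P_eqI: "x \<in> carrier P \<Longrightarrow> y \<in> carrier P \<Longrightarrow> (\<And>l. 1 \<le> l \<Longrightarrow> x l = y l) \<Longrightarrow> x = y"
  by (rule extensionalityI[of _ "{1..}"]) (auto simp: carrier_P)

lemma eps_level: "1 \<le> l \<Longrightarrow> eps l \<circ> eps l = id" "1 \<le> l \<Longrightarrow> pinv (eps l) = eps l"
proof -
  assume l: "1 \<le> l"
  show "eps l \<circ> eps l = id" using fun_cong[OF eps_eps, of l] l by (simp only: mult_level one_level)
  show "pinv (eps l) = eps l" using fun_cong[OF eps_inv, of l] l eps_closed by (simp only: inv_level)
qed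

lemma eps_conj_level: "x \<in> carrier P \<Longrightarrow> 1 \<le> l \<Longrightarrow> eps_conj x l = eps l \<circ> x l \<circ> eps l"
  by (simp only: eps_conj_def eps_inv mult_level)

lemma level_kernel_mult_inv:
  assumes "x \<in> NN" "y \<in> NN"
  shows "x \<cdot> y\<^sup>- \<in> level_kernel n \<longleftrightarrow> (\<forall>l\<in>{1..n}. x l = y l)"
proof -
  interpret N: subgroup NN "P" by (rule N_subgroup)
  have "(x \<cdot> y\<^sup>-) l = id \<longleftrightarrow> x l = y l" if l: "1 \<le> l" for l
  proof -
    have y: "y l permutes words d l" using level_perm[OF assms(2) l] .
    have e: "(x \<cdot> y\<^sup>-) l = x l \<circ> pinv (y l)" using assms N_carrier l by (simp only: mult_level inv_level)
    show ?thesis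
    proof
      assume "(x \<cdot> y\<^sup>-) l = id"
      then have "x l \<circ> pinv (y l) \<circ> y l = id \<circ> y l" using e by simp
      then show "x l = y l" using y by (simp add: o_assoc[symmetric] permutes_inv_o)
    next
      assume "x l = y l" then show "(x \<cdot> y\<^sup>-) l = id" using e y by (simp add: permutes_inv_o)
    qed
  qed
  then show ?thesis using assms by (auto simp: level_kernel_def)
qed

lemma level_kernel_normal: "level_kernel n \<lhd> N"
proof -
  interpret N: group "N" by (rule group_N)
  interpret NS: subgroup NN "P" by (rule N_subgroup)
  show ?thesis unfolding N.normal_inv_iff
  proof (intro conjI ballI)
    show "subgroup (level_kernel n) N"
    proof (rule N.subgroupI)
      show "level_kernel n \<subseteq> carrier N" by (auto simp: level_kernel_def)
      have "\<one>\<^bsub>P\<^esub> \<in> level_kernel n" using NS.one_closed by (auto simp: level_kernel_def one_P)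
      then show "level_kernel n \<noteq> {}" by blast
      fix a assume a: "a \<in> level_kernel n"
      then show "inv\<^bsub>N\<^esub> a \<in> level_kernel n"
        using N_carrier[of a] NS.m_inv_closed[of a] inv_level[of a] by (auto simp: inv_N level_kernel_def)
      fix b assume "b \<in> level_kernel n"
      then show "a \<otimes>\<^bsub>N\<^esub> b \<in> level_kernel n"
        using a NS.m_closed[of a b] by (auto simp: level_kernel_def mult_level)
    qed
    fix x h assume x: "x \<in> carrier N" and h: "h \<in> level_kernel n"
    have xN: "x \<in> NN" "x \<in> carrier P" using x N_carrier by auto
    have "(x \<cdot> h \<cdot> x\<^sup>-) l = id" if "l \<in> {1..n}" for l
      using that h xN level_perm[OF xN(1), of l]
      by (simp add: mult_level inv_level level_kernel_def permutes_inv_o)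
    moreover have "x \<cdot> h \<cdot> x\<^sup>- \<in> NN" using xN h by (auto simp: level_kernel_def)
    ultimately show "x \<otimes>\<^bsub>N\<^esub> h \<otimes>\<^bsub>N\<^esub> inv\<^bsub>N\<^esub> x \<in> level_kernel n"
      using xN by (simp add: inv_N level_kernel_def)
  qed
qed

lemma finite_levels: "finite ((\<lambda>p. restrict p {1..n}) ` NN)"
proof (rule finite_subset)
  show "(\<lambda>p. restrict p {1..n}) ` NN \<subseteq> (\<Pi>\<^sub>E l\<in>{1..n}. {q. q permutes words d l})"
    using level_perm by (auto simp: PiE_iff)
  show "finite (\<Pi>\<^sub>E l\<in>{1..n}. {q. q permutes words d l})"
    by (intro finite_PiE finite_permutations) auto
qed

lemma restrict_eq_levels: "restrict a {1..n} = restrict b {1..n} \<longleftrightarrow> (\<forall>l\<in>{1..n}. a l = b l)"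
  by (auto simp: restrict_def fun_eq_iff)

lemma level_kernel_FIN: "level_kernel n \<in> FIN N"
proof (rule group.FIN_I[OF group_N level_kernel_normal])
  show "finite ((\<lambda>p. restrict p {1..n}) ` carrier N)" using finite_levels by simp
  fix a b assume "a \<in> carrier N" "b \<in> carrier N" "restrict a {1..n} = restrict b {1..n}"
  then have ab: "a \<in> NN" "b \<in> NN" "\<forall>l\<in>{1..n}. a l = b l" by (simp_all only: restrict_eq_levels N_simps)
  show "a \<otimes>\<^bsub>N\<^esub> inv\<^bsub>N\<^esub> b \<in> level_kernel n"
    using level_kernel_mult_inv[OF ab(1,2)] ab by (simp add: inv_N)
qed

lemma N_chain: "completion_chain N level_kernel"
proof -
  interpret N: group "N" by (rule group_N)
  show ?thesis by unfold_locales (use level_kernel_FIN level_kernel_cofinal in \<open>auto simp: level_kernel_def\<close>)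
qed

sublocale N: completion_chain "N" level_kernel by (rule N_chain)

text \<open>Every element of \<open>P\<close> is approximated by elements of \<open>N\<close> that agree with it up to level \<open>n\<close>.\<close>

definition cut :: "nat \<Rightarrow> (nat \<Rightarrow> nat list \<Rightarrow> nat list) \<Rightarrow> nat \<Rightarrow> nat list \<Rightarrow> nat list" where
  "cut n p = (\<lambda>l\<in>{1..}. if l \<le> n then p l else id)"

lemma cut_N: assumes p: "p \<in> carrier P" shows "cut n p \<in> NN"
proof (induction n)
  case 0
  have "cut 0 p = \<one>\<^bsub>P\<^esub>" by (auto simp: cut_def one_P fun_eq_iff)
  then show ?case using subgroup.one_closed[OF N_subgroup] by simp
next
  case (Suc n)
  have "cut (Suc n) p = cut n p \<cdot> single (Suc n) (p (Suc n))"
    by (auto simp: cut_def single_def mult_P fun_eq_iff le_Suc_eq)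
  moreover have "single (Suc n) (p (Suc n)) \<in> NN" using Delta_level[OF p] by (intro single_N) auto
  ultimately show ?case using Suc subgroup.m_closed[OF N_subgroup] by simp
qed

lemma cut_level: "1 \<le> l \<Longrightarrow> l \<le> n \<Longrightarrow> cut n p l = p l"
  by (simp add: cut_def)

text \<open>The level \<open>l\<close> component of any representative of the coordinate at \<open>level_kernel l\<close>; all of them
have the same component there.\<close>

definition Fmap :: "((nat \<Rightarrow> nat list \<Rightarrow> nat list) set \<Rightarrow> (nat \<Rightarrow> nat list \<Rightarrow> nat list) set) \<Rightarrow> nat \<Rightarrow> nat list \<Rightarrow> nat list" where
  "Fmap x = (\<lambda>l\<in>{1..}. (SOME g. g \<in> x (level_kernel l)) l)"

abbreviation Nhat where "Nhat \<equiv> completion N"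
abbreviation rcosN (infixl "#>N" 60) where "K #>N g \<equiv> K #>\<^bsub>N\<^esub> g"

lemma Fmap_at:
  assumes x: "x \<in> carrier Nhat" and g: "g \<in> NN" "x (level_kernel n) = level_kernel n #>N g" and l: "1 \<le> l" "l \<le> n"
  shows "Fmap x l = g l"
proof -
  have "x (level_kernel l) = level_kernel l #>N g"
    by (rule N.completion_rep_mono[OF x level_kernel_FIN level_kernel_FIN N.M_anti[OF l(2)]]) (use g in simp_all)
  moreover have "g \<in> level_kernel l #>N g" using N.rcos_self[OF _ N.FIN_D(2)[OF level_kernel_FIN]] g by simp
  ultimately have "(SOME h. h \<in> x (level_kernel l)) \<in> level_kernel l #>N g" by (metis someI)
  then obtain m where "m \<in> level_kernel l" "(SOME h. h \<in> x (level_kernel l)) = m \<cdot> g" by (auto simp: r_coset_def)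
  then show ?thesis using l by (simp add: Fmap_def mult_level level_kernel_def)
qed

lemma Nhat_rep: assumes "x \<in> carrier Nhat" obtains g where "g \<in> NN" "x (level_kernel n) = level_kernel n #>N g"
  using N.completion_rep[OF assms level_kernel_FIN] by (metis N_simps(1))

lemma Fmap_hom: "Fmap \<in> hom Nhat P"
proof (rule homI)
  fix x assume x: "x \<in> carrier Nhat"
  have "Fmap x l permutes words d l \<and> evenperm (Fmap x l)" if l: "1 \<le> l" for l
  proof -
    obtain g where g: "g \<in> NN" "x (level_kernel l) = level_kernel l #>N g" using Nhat_rep[OF x] by blast
    then show ?thesis using Fmap_at[OF x g l] N_carrier[OF g(1)] l by (simp add: carrier_P)
  qed
  then show "Fmap x \<in> carrier P" by (simp add: carrier_P Fmap_def)
next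
  fix x y assume x: "x \<in> carrier Nhat" and y: "y \<in> carrier Nhat"
  have xy: "x \<otimes>\<^bsub>Nhat\<^esub> y \<in> carrier Nhat" using N.group_completion x y by (simp add: group.is_monoid monoid.m_closed)
  have "Fmap (x \<otimes>\<^bsub>Nhat\<^esub> y) l = Fmap x l \<circ> Fmap y l" if l: "1 \<le> l" for l
  proof -
    obtain g where g: "g \<in> NN" "x (level_kernel l) = level_kernel l #>N g" using Nhat_rep[OF x] by blast
    obtain h where h: "h \<in> NN" "y (level_kernel l) = level_kernel l #>N h" using Nhat_rep[OF y] by blast
    have gh: "g \<cdot> h \<in> NN" using g h subgroup.m_closed[OF N_subgroup] by blast
    have "(x \<otimes>\<^bsub>Nhat\<^esub> y) (level_kernel l) = level_kernel l #>N (g \<cdot> h)"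
      using N.completion_mult_at[where x = x and y = y, OF level_kernel_FIN _ _ g(2) h(2)] g h by simp
    from Fmap_at[OF xy gh this l order_refl] show ?thesis
      using Fmap_at[OF x g l order_refl] Fmap_at[OF y h l order_refl] l by (simp add: mult_level fun_eq_iff)
  qed
  then show "Fmap (x \<otimes>\<^bsub>Nhat\<^esub> y) = Fmap x \<cdot> Fmap y" by (auto simp: Fmap_def mult_P fun_eq_iff)
qed

lemma Fmap_incl: "g \<in> NN \<Longrightarrow> Fmap (to_completion N g) = g"
proof -
  assume g: "g \<in> NN"
  have x: "to_completion N g \<in> carrier Nhat" using N.to_completion_closed g by simp
  have "Fmap (to_completion N g) l = g l" if "1 \<le> l" for l
    by (rule Fmap_at[OF x g _ that order_refl]) (simp add: to_completion_def level_kernel_FIN)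
  then show ?thesis using N_carrier[OF g] hom_in_carrier[OF Fmap_hom x] by (intro P_eqI) auto
qed

lemma Fmap_inj: "inj_on Fmap (carrier Nhat)"
proof (rule inj_onI)
  fix x y assume x: "x \<in> carrier Nhat" and y: "y \<in> carrier Nhat" and eq: "Fmap x = Fmap y"
  show "x = y"
  proof (rule N.completion_ext[OF x y])
    fix n
    obtain g where g: "g \<in> NN" "x (level_kernel n) = level_kernel n #>N g" using Nhat_rep[OF x] by blast
    obtain h where h: "h \<in> NN" "y (level_kernel n) = level_kernel n #>N h" using Nhat_rep[OF y] by blast
    have "\<forall>l\<in>{1..n}. g l = h l" using Fmap_at[OF x g] Fmap_at[OF y h] eq by simp
    then have "g \<cdot> h\<^sup>- \<in> level_kernel n" using level_kernel_mult_inv g h by blast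
    then have "level_kernel n #>N g = level_kernel n #>N h"
      using g h by (intro N.rcos_eqI[OF N.FIN_D(2)[OF level_kernel_FIN]]) (auto simp: inv_N)
    then show "x (level_kernel n) = y (level_kernel n)" using g h by simp
  qed
qed

lemma cut_coherent: "p \<in> carrier P \<Longrightarrow> n \<le> m \<Longrightarrow> cut m p \<cdot> (cut n p)\<^sup>- \<in> level_kernel n"
  using level_kernel_mult_inv[OF cut_N[of p m] cut_N[of p n], of n] by (auto simp: cut_level)

lemma Nhat_lift:
  assumes p: "p \<in> carrier P"
  obtains x where "x \<in> carrier Nhat" "\<And>n K. K \<in> FIN N \<Longrightarrow> level_kernel n \<subseteq> K \<Longrightarrow> x K = K #>N cut n p"
proof -
  have "\<exists>x\<in>carrier Nhat. \<forall>n K. K \<in> FIN N \<longrightarrow> level_kernel n \<subseteq> K \<longrightarrow> x K = K #>N cut n p"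
    by (rule N.completion_lift) (use cut_N[OF p] cut_coherent[OF p] in \<open>auto simp: inv_N\<close>)
  then show ?thesis using that by blast
qed

lemma Fmap_surj: "Fmap ` carrier Nhat = carrier P"
proof
  show "Fmap ` carrier Nhat \<subseteq> carrier P" using hom_in_carrier[OF Fmap_hom] by blast
  show "carrier P \<subseteq> Fmap ` carrier Nhat"
  proof
    fix p assume p: "p \<in> carrier P"
    obtain x where x: "x \<in> carrier Nhat" "\<And>n K. K \<in> FIN N \<Longrightarrow> level_kernel n \<subseteq> K \<Longrightarrow> x K = K #>N cut n p"
      using Nhat_lift[OF p] by blast
    have "Fmap x l = p l" if "1 \<le> l" for l
      using Fmap_at[OF x(1) cut_N[OF p] x(2)[OF level_kernel_FIN order_refl] that order_refl] that by (simp add: cut_level)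
    then have "Fmap x = p" using p hom_in_carrier[OF Fmap_hom x(1)] by (intro P_eqI) auto
    then show "p \<in> Fmap ` carrier Nhat" using x(1) by blast
  qed
qed

text \<open>Each component of the value depends on a single coordinate of the argument.\<close>

lemma Fmap_continuous: "continuous_map (completion_topology N) (P_topology d) Fmap"
  unfolding P_topology_def continuous_map_componentwise
proof (intro conjI ballI)
  show "Fmap ` topspace (completion_topology N) \<subseteq> extensional {1..}"
    by (auto simp: Fmap_def)
  fix l :: nat assume l: "l \<in> {1..}"
  show "continuous_map (completion_topology N) (discrete_topology (carrier (Omega d l))) (\<lambda>x. Fmap x l)"
    unfolding continuous_map_def
  proof (intro conjI allI impI)
    show "(\<lambda>x. Fmap x l) \<in> topspace (completion_topology N) \<rightarrow> topspace (discrete_topology (carrier (Omega d l)))"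
      using hom_in_carrier[OF Fmap_hom] l by (auto simp: N.topspace_completion carrier_P Omega_def)
    fix U assume "openin (discrete_topology (carrier (Omega d l))) U"
    have "openin (completion_topology N) {x \<in> carrier Nhat. (SOME g. g \<in> x (level_kernel l)) l \<in> U}"
      by (rule N.openin_completion_coordinate[OF level_kernel_FIN])
    then show "openin (completion_topology N) {x \<in> topspace (completion_topology N). Fmap x l \<in> U}"
      using l by (simp add: N.topspace_completion Fmap_def)
  qed
qed

lemma Fmap_homeomorphic: "homeomorphic_map (completion_topology N) (P_topology d) Fmap"
proof (rule continuous_imp_homeomorphic_map[OF Fmap_continuous N.compact_completion])
  show "Hausdorff_space (P_topology d)" by (simp add: P_topology_def Hausdorff_space_product_topology)
  show "Fmap ` topspace (completion_topology N) = topspace (P_topology d)"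
    using Fmap_surj by (simp add: N.topspace_completion P_topology_def P_group_def)
  show "inj_on Fmap (topspace (completion_topology N))"
    using Fmap_inj by (simp add: N.topspace_completion)
qed

lemma N_completion_is_P:
  "\<exists>F. induced_on_completion N P (P_topology d) (\<lambda>n. n) F \<and>
     F \<in> iso Nhat P \<and> homeomorphic_map (completion_topology N) (P_topology d) F"
proof (intro exI conjI)
  show "induced_on_completion N P (P_topology d) (\<lambda>n. n) Fmap"
    using Fmap_hom Fmap_continuous Fmap_incl by (simp add: induced_on_completion_def)
  show "Fmap \<in> iso Nhat P" using Fmap_hom Fmap_inj Fmap_surj by (simp add: iso_def bij_betw_def)
qed (rule Fmap_homeomorphic)

abbreviation "tauN \<equiv> tau d r"

lemma tau_eq: "tauN = (\<lambda>n\<in>NN. eps_conj n)" by (simp add: tau_def eps_conj_def)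

lemma tau_auto: "tauN \<in> auto N"
  unfolding auto_def Bij_def
proof (intro IntI CollectI)
  show "tauN \<in> hom N N"
    by (rule homI) (auto simp: tau_eq eps_conj_N subgroup.m_closed[OF N_subgroup] hom_mult[OF eps_conj_hom] N_carrier)
  show "tauN \<in> extensional (carrier N)" by (simp add: tau_eq)
  have "bij_betw eps_conj NN NN"
    by (rule bij_betw_byWitness[where f' = eps_conj]) (auto simp: eps_conj_involution N_carrier eps_conj_N)
  then show "bij_betw tauN (carrier N) (carrier N)"
    by (subst bij_betw_cong[where g = eps_conj]) (auto simp: tau_eq)
qed

lemma tau_hom: "tauN \<in> hom N N"
  using tau_auto by (simp add: auto_def)

text \<open>A centralizing element commutes with the alternating group in each factor. If it moved \<open>u\<close>, then
commuting with a 3-cycle \<open>(u a a')\<close> that misses the image of \<open>u\<close> would force it to map \<open>a\<close> and \<open>u\<close> to the same word.\<close>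

lemma N_centralizer_trivial:
  assumes b: "b \<in> carrier P" and comm: "\<And>x. x \<in> NN \<Longrightarrow> b \<cdot> x = x \<cdot> b"
  shows "b = \<one>\<^bsub>P\<^esub>"
proof (rule P_eqI[OF b P.one_closed])
  fix l :: nat assume l: "1 \<le> l"
  have bl: "b l permutes words d l" using b l by (simp add: carrier_P)
  have c: "b l \<circ> s = s \<circ> b l" if "s \<in> \<Omega> l" for s
    using fun_cong[OF comm[OF single_N[OF l that]], of l] l by (simp add: mult_level single_def)
  have "b l u = u" for u
  proof (rule ccontr)
    assume ne: "b l u \<noteq> u"
    then have u: "u \<in> words d l" using bl by (metis permutes_not_in)
    then have v: "b l u \<in> words d l" using bl by (simp add: permutes_in_image)
    have "2 \<le> card (words d l - {u, b l u})" using card_words_5[OF l] u v ne by (subst card_Diff_subset) auto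
    then obtain T where "T \<subseteq> words d l - {u, b l u}" "card T = 2" by (meson obtain_subset_with_card_n)
    then obtain a a' where a: "a \<in> words d l" "a' \<in> words d l" "distinct [u, a, a']" "b l u \<noteq> a" "b l u \<noteq> a'"
      by (auto simp: card_2_iff)
    have "cyc3 u a a' \<in> \<Omega> l" using a u by (intro cyc3_Alt) auto
    from fun_cong[OF c[OF this], of u] have "b l a = b l u" using a ne by (simp add: cyc3_apply)
    then have "a = u" using bl by (metis injD permutes_inj)
    then show False using a by simp
  qed
  then show "b l = \<one>\<^bsub>P\<^esub> l" using l by (auto simp: one_level)
qed

lemma eps_central_absurd:
  assumes m: "m \<in> NN" and comm: "\<And>n. n \<in> NN \<Longrightarrow> n \<cdot> (m \<cdot> eps) = (m \<cdot> eps) \<cdot> n"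
  shows False
proof -
  have mc: "m \<in> carrier P" using N_carrier[OF m] .
  have "m \<cdot> eps = \<one>\<^bsub>P\<^esub>"
    by (rule N_centralizer_trivial) (use mc eps_closed comm in auto)
  then have "m = eps" using mc eps_closed eps_inv by (metis P.inv_equality)
  then show False using m eps_notin_N by simp
qed

lemma tau_not_inner: "\<not> is_inner N tauN"
proof
  assume "is_inner N tauN"
  then obtain a where a: "a \<in> NN" "\<And>x. x \<in> NN \<Longrightarrow> eps_conj x = a \<cdot> x \<cdot> a\<^sup>-"
    by (auto simp: is_inner_def tau_eq inv_N)
  have ac: "a \<in> carrier P" "a\<^sup>- \<in> NN" using a N_carrier subgroup.m_inv_closed[OF N_subgroup] by auto
  show False
  proof (rule eps_central_absurd[OF ac(2)])
    fix n assume n: "n \<in> NN"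
    have nc: "n \<in> carrier P" using N_carrier[OF n] .
    have "eps \<cdot> n \<cdot> eps = a \<cdot> n \<cdot> a\<^sup>-" using a(2)[OF n] by (simp add: eps_conj_def eps_inv)
    then have "a\<^sup>- \<cdot> (eps \<cdot> n \<cdot> eps) \<cdot> eps = a\<^sup>- \<cdot> (a \<cdot> n \<cdot> a\<^sup>-) \<cdot> eps" by simp
    moreover have "a\<^sup>- \<cdot> (eps \<cdot> n \<cdot> eps) \<cdot> eps = (a\<^sup>- \<cdot> eps) \<cdot> n \<cdot> (eps \<cdot> eps)"
      using ac nc eps_closed by (simp add: P.m_assoc)
    moreover have "a\<^sup>- \<cdot> (a \<cdot> n \<cdot> a\<^sup>-) \<cdot> eps = (a\<^sup>- \<cdot> a) \<cdot> n \<cdot> (a\<^sup>- \<cdot> eps)"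
      using ac nc eps_closed by (simp only: P.m_assoc P.m_closed P.inv_closed)
    ultimately show "n \<cdot> (a\<^sup>- \<cdot> eps) = (a\<^sup>- \<cdot> eps) \<cdot> n" using ac nc eps_closed by (simp add: eps_eps)
  qed
qed

lemma eps_conj_level_kernel: "x \<in> level_kernel n \<Longrightarrow> eps_conj x \<in> level_kernel n"
  using eps_conj_N eps_conj_level N_carrier eps_level(1) by (auto simp: level_kernel_def)

text \<open>The conjugating element is the point of the completion that corresponds to \<open>\<epsilon>\<close>: at every finite
stage, conjugation with an element of \<open>N\<close> close to \<open>\<epsilon>\<close> has the same effect as \<open>\<tau>\<close>.\<close>

lemma tau_completion_inner: "is_inner Nhat (completion_map N N tauN)"
  unfolding is_inner_def
proof -
  interpret C: group Nhat by (rule N.group_completion)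
  obtain e where e: "e \<in> carrier Nhat" "\<And>n K. K \<in> FIN N \<Longrightarrow> level_kernel n \<subseteq> K \<Longrightarrow> e K = K #>N cut n eps"
    using Nhat_lift[OF eps_closed] by blast
  show "\<exists>a\<in>carrier Nhat. \<forall>x\<in>carrier Nhat. completion_map N N tauN x = a \<otimes>\<^bsub>Nhat\<^esub> x \<otimes>\<^bsub>Nhat\<^esub> inv\<^bsub>Nhat\<^esub> a"
  proof (intro bexI[of _ e] ballI e(1))
    fix x assume x: "x \<in> carrier Nhat"
    show "completion_map N N tauN x = e \<otimes>\<^bsub>Nhat\<^esub> x \<otimes>\<^bsub>Nhat\<^esub> inv\<^bsub>Nhat\<^esub> e"
    proof (rule N.completion_ext)
      show "completion_map N N tauN x \<in> carrier Nhat"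
        by (rule N.completion_map_closed[OF group_N tau_hom x])
      show "e \<otimes>\<^bsub>Nhat\<^esub> x \<otimes>\<^bsub>Nhat\<^esub> inv\<^bsub>Nhat\<^esub> e \<in> carrier Nhat" using e(1) x by simp
      fix n
      let ?c = "cut n eps"
      obtain g where g: "g \<in> NN" "x (level_kernel n) = level_kernel n #>N g" using Nhat_rep[OF x] by blast
      have c: "?c \<in> NN" by (rule cut_N[OF eps_closed])
      have ci: "?c\<^sup>- \<in> NN" using c subgroup.m_inv_closed[OF N_subgroup] by blast
      have en: "e (level_kernel n) = level_kernel n #>N ?c" by (rule e(2)[OF level_kernel_FIN order_refl])
      have ei: "(inv\<^bsub>Nhat\<^esub> e) (level_kernel n) = level_kernel n #>N ?c\<^sup>-"
        using N.completion_inv_at[OF e(1) level_kernel_FIN _ en] c by (simp add: inv_N)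
      have cg: "?c \<cdot> g \<in> NN" by (rule subgroup.m_closed[OF N_subgroup c g(1)])
      note gc = cg subgroup.m_closed[OF N_subgroup cg ci] eps_conj_N[OF g(1)]
      have ex: "(e \<otimes>\<^bsub>Nhat\<^esub> x) (level_kernel n) = level_kernel n #>N (?c \<cdot> g)"
        using N.completion_mult_at[where x = e and y = x, OF level_kernel_FIN _ _ en g(2)] c g by simp
      have "(e \<otimes>\<^bsub>Nhat\<^esub> x \<otimes>\<^bsub>Nhat\<^esub> inv\<^bsub>Nhat\<^esub> e) (level_kernel n) = level_kernel n #>N (?c \<cdot> g \<cdot> ?c\<^sup>-)"
        using N.completion_mult_at[where x = "e \<otimes>\<^bsub>Nhat\<^esub> x" and y = "inv\<^bsub>Nhat\<^esub> e", OF level_kernel_FIN _ _ ex ei] ci gc by simp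
      moreover have "completion_map N N tauN x (level_kernel n) = level_kernel n #>N tauN g"
        by (rule N.completion_map_at[OF group_N tau_hom level_kernel_FIN x level_kernel_FIN _ _ g(2)])
          (use g(1) eps_conj_level_kernel in \<open>auto simp: tau_eq level_kernel_def\<close>)
      moreover have "level_kernel n #>N eps_conj g = level_kernel n #>N (?c \<cdot> g \<cdot> ?c\<^sup>-)"
      proof (rule N.rcos_eqI[OF N.FIN_D(2)[OF level_kernel_FIN]])
        have "eps_conj g l = (?c \<cdot> g \<cdot> ?c\<^sup>-) l" if "l \<in> {1..n}" for l
          using that N_carrier[OF g(1)] N_carrier[OF c]
          by (simp add: eps_conj_level mult_level inv_level cut_level eps_level(2))
        then show "eps_conj g \<otimes>\<^bsub>N\<^esub> inv\<^bsub>N\<^esub> (?c \<cdot> g \<cdot> ?c\<^sup>-) \<in> level_kernel n"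
          using level_kernel_mult_inv[OF gc(3,2)] gc by (simp add: inv_N)
      qed (use gc in auto)
      ultimately show "completion_map N N tauN x (level_kernel n) =
          (e \<otimes>\<^bsub>Nhat\<^esub> x \<otimes>\<^bsub>Nhat\<^esub> inv\<^bsub>Nhat\<^esub> e) (level_kernel n)" using g by (simp add: tau_eq)
    qed
  qed
qed

lemma eps_not_one: "eps \<noteq> \<one>\<^bsub>P\<^esub>"
  using eps_notin_N subgroup.one_closed[OF N_subgroup] by metis

lemma ord_eps: "group.ord P eps = 2"
proof -
  have "eps [^]\<^bsub>P\<^esub> (2::nat) = \<one>\<^bsub>P\<^esub>"
    using eps_closed eps_eps by (simp add: numeral_2_eq_2)
  then have "P.ord eps dvd 2" using P.pow_eq_id[OF eps_closed] by simp
  moreover have "P.ord eps \<noteq> 1" using P.ord_eq_1[OF eps_closed] eps_not_one by simp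
  moreover have "n \<le> 2 \<and> n \<noteq> 0" if "n dvd 2" for n :: nat using that by (metis dvd_imp_le dvd_0_left zero_less_numeral zero_neq_numeral)
  ultimately show ?thesis by (metis One_nat_def Suc_1 le_SucE le_zero_eq)
qed

lemma N_residually_finite: "residually_finite N"
  unfolding residually_finite_def
proof (intro conjI ballI impI group_N)
  fix g assume g: "g \<in> carrier N" "g \<noteq> \<one>\<^bsub>N\<^esub>"
  then obtain l where l: "1 \<le> l" "g l \<noteq> id"
    using P_eqI[OF N_carrier P.one_closed, of g] by (auto simp: one_level)
  then have "g \<notin> level_kernel l" by (auto simp: level_kernel_def)
  then show "\<exists>K\<in>FIN N. g \<notin> K" using level_kernel_FIN by blast
qed

lemma N_generated: "generated_by_at_most 4 N" "finitely_generated_group N"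
proof -
  obtain S where S: "S \<subseteq> NN" "finite S" "card S \<le> 4" "generate P S = NN" using N_four_generators by blast
  then have "generate N S = NN"
    unfolding N_group_eq using P.generate_consistent[OF S(1) N_subgroup] by simp
  then show "generated_by_at_most 4 N" "finitely_generated_group N"
    using S group_N unfolding generated_by_at_most_def finitely_generated_group_def by auto
qed

end

section \<open>The semidirect product\<close>

lemma (in group) coordinate_kernel_normal:
  assumes K: "K \<in> FIN G"
  shows "{x \<in> carrier (completion G). x K = K} \<lhd> completion G"
proof -
  interpret C: group "completion G" by (rule group_completion)
  note KG = FIN_D(2)[OF K]
  have memb: "x K = K \<longleftrightarrow> g \<in> K" if "g \<in> carrier G" "x K = K #> g" for x g
    using that coset_join1[OF _ that(1) KG] coset_join2[OF that(1) KG] by auto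
  show ?thesis unfolding C.normal_inv_iff
  proof (intro conjI ballI C.subgroupI)
    have "\<one>\<^bsub>completion G\<^esub> \<in> {x \<in> carrier (completion G). x K = K}" using K C.one_closed by (simp add: one_completion)
    then show "{x \<in> carrier (completion G). x K = K} \<noteq> {}" by blast
  next
    fix a assume a: "a \<in> {x \<in> carrier (completion G). x K = K}"
    then have "a K = K #> \<one>" using subgroup.subset[OF KG] by simp
    then have "(inv\<^bsub>completion G\<^esub> a) K = K #> inv \<one>" using a completion_inv_at[OF _ K, of a \<one>] by simp
    then show "inv\<^bsub>completion G\<^esub> a \<in> {x \<in> carrier (completion G). x K = K}"
      using a subgroup.subset[OF KG] by simp
  next
    fix a b assume a: "a \<in> {x \<in> carrier (completion G). x K = K}" and b: "b \<in> {x \<in> carrier (completion G). x K = K}"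
    then have "a K = K #> \<one>" "b K = K #> \<one>" using subgroup.subset[OF KG] by auto
    then have "(a \<otimes>\<^bsub>completion G\<^esub> b) K = K #> (\<one> \<otimes> \<one>)" using completion_mult_at[where x = a and y = b, OF K] by blast
    then show "a \<otimes>\<^bsub>completion G\<^esub> b \<in> {x \<in> carrier (completion G). x K = K}"
      using a b subgroup.subset[OF KG] by simp
  next
    fix x h assume x: "x \<in> carrier (completion G)" and h: "h \<in> {x \<in> carrier (completion G). x K = K}"
    obtain g where g: "g \<in> carrier G" "x K = K #> g" using completion_rep[OF x K] by blast
    have h1: "h K = K #> \<one>" using h subgroup.subset[OF KG] by simp
    have 1: "(x \<otimes>\<^bsub>completion G\<^esub> h) K = K #> (g \<otimes> \<one>)"
      by (rule completion_mult_at[where x = x and y = h, OF K g(1) one_closed g(2) h1])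
    have "(x \<otimes>\<^bsub>completion G\<^esub> h \<otimes>\<^bsub>completion G\<^esub> inv\<^bsub>completion G\<^esub> x) K = K #> (g \<otimes> \<one> \<otimes> inv g)"
      using completion_mult_at[where x = "x \<otimes>\<^bsub>completion G\<^esub> h" and y = "inv\<^bsub>completion G\<^esub> x", OF K _ _ 1 completion_inv_at[OF x K g]] g by simp
    then show "x \<otimes>\<^bsub>completion G\<^esub> h \<otimes>\<^bsub>completion G\<^esub> inv\<^bsub>completion G\<^esub> x \<in> {x \<in> carrier (completion G). x K = K}"
      using x h g subgroup.subset[OF KG] by simp
  qed auto
qed

context telescope
begin

abbreviation TT where "TT \<equiv> tau_group d r"
abbreviation GG where "GG \<equiv> G_group d r"
abbreviation incl where "incl \<equiv> N_incl d r"
abbreviation unitN where "unitN \<equiv> (\<lambda>x\<in>NN. x)"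

text \<open>The group generated by \<open>\<tau>\<close> has two elements, indexed by Booleans; inequality of Booleans is then the
multiplication.\<close>

definition tau_act :: "bool \<Rightarrow> (nat \<Rightarrow> nat list \<Rightarrow> nat list) \<Rightarrow> nat \<Rightarrow> nat list \<Rightarrow> nat list" where
  "tau_act b n = (if b then eps_conj n else n)"

definition tau_pow :: "bool \<Rightarrow> (nat \<Rightarrow> nat list \<Rightarrow> nat list) \<Rightarrow> nat \<Rightarrow> nat list \<Rightarrow> nat list" where
  "tau_pow b = (if b then tauN else unitN)"

lemma tau_pow_apply: "n \<in> NN \<Longrightarrow> tau_pow b n = tau_act b n"
  by (simp add: tau_pow_def tau_act_def tau_eq)

lemma tau_act_N: "n \<in> NN \<Longrightarrow> tau_act b n \<in> NN" by (simp add: tau_act_def eps_conj_N)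

lemma tau_tau_act_compose: "n \<in> NN \<Longrightarrow> tau_act b (tau_act c n) = tau_act (b \<noteq> c) n"
  by (auto simp: tau_act_def eps_conj_involution N_carrier)

lemma tau_act_mult: "n \<in> NN \<Longrightarrow> m \<in> NN \<Longrightarrow> tau_act b (n \<cdot> m) = tau_act b n \<cdot> tau_act b m"
  by (auto simp: tau_act_def hom_mult[OF eps_conj_hom] N_carrier)

lemma tau_pow_inj: "tau_pow b = tau_pow c \<longleftrightarrow> b = c"
proof -
  have "tauN \<noteq> unitN"
  proof
    assume e: "tauN = unitN"
    have "is_inner N tauN"
      unfolding is_inner_def
    proof (intro bexI[of _ "\<one>\<^bsub>P\<^esub>"] ballI)
      fix x assume "x \<in> carrier N"
      then show "tauN x = \<one>\<^bsub>P\<^esub> \<otimes>\<^bsub>N\<^esub> x \<otimes>\<^bsub>N\<^esub> inv\<^bsub>N\<^esub> \<one>\<^bsub>P\<^esub>"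
        using e subgroup.one_closed[OF N_subgroup] N_carrier[of x] by (simp add: inv_N)
    qed (use subgroup.one_closed[OF N_subgroup] in simp)
    then show False using tau_not_inner by blast
  qed
  then show ?thesis by (auto simp: tau_pow_def)
qed

lemma Auto_simps: "carrier (AutoGroup N) = auto N" "\<one>\<^bsub>AutoGroup N\<^esub> = unitN"
  by (simp_all add: AutoGroup_def BijGroup_def)

lemma tau_pow_auto: "tau_pow b \<in> auto N"
  using tau_auto group.id_in_auto[OF group_N] by (auto simp: tau_pow_def)

lemma tau_pow_mult: "tau_pow b \<otimes>\<^bsub>AutoGroup N\<^esub> tau_pow c = tau_pow (b \<noteq> c)"
proof -
  have "tau_pow b \<in> Bij NN" "tau_pow c \<in> Bij NN" using tau_pow_auto[of b] tau_pow_auto[of c] by (auto simp: auto_def)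
  then have "tau_pow b \<otimes>\<^bsub>AutoGroup N\<^esub> tau_pow c = compose NN (tau_pow b) (tau_pow c)" by (simp add: AutoGroup_def BijGroup_def)
  also have "\<dots> = tau_pow (b \<noteq> c)"
  proof (rule extensionalityI[of _ NN])
    show "tau_pow (b \<noteq> c) \<in> extensional NN" by (simp add: tau_pow_def tau_eq)
    fix x assume "x \<in> NN"
    then show "compose NN (tau_pow b) (tau_pow c) x = tau_pow (b \<noteq> c) x"
      using tau_tau_act_compose[of x b c] tau_act_N by (simp add: compose_def tau_pow_apply)
  qed simp
  finally show ?thesis .
qed

lemma TT_carrier: "carrier TT = range tau_pow"
proof -
  interpret A: group "AutoGroup N" by (rule group.AutoGroup[OF group_N])
  have inv: "inv\<^bsub>AutoGroup N\<^esub> tau_pow b = tau_pow b" for b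
    using tau_pow_mult[of b b] tau_pow_auto by (intro A.inv_equality) (auto simp: Auto_simps tau_pow_def)
  have "subgroup (range tau_pow) (AutoGroup N)"
    by (rule A.subgroupI) (use tau_pow_auto tau_pow_mult inv in \<open>auto simp: Auto_simps\<close>)
  moreover have "tauN \<in> range tau_pow" by (auto simp: tau_pow_def image_def)
  ultimately have "generate (AutoGroup N) {tauN} \<subseteq> range tau_pow" by (intro A.generate_subgroup_incl) auto
  moreover have "tau_pow b \<in> generate (AutoGroup N) {tauN}" for b
    using generate.one[of "AutoGroup N" "{tauN}"] generate.incl[of tauN "{tauN}" "AutoGroup N"]
    by (auto simp: tau_pow_def Auto_simps)
  ultimately show ?thesis by (auto simp: tau_group_def)
qed

lemma TT_simps: "tau_pow b \<otimes>\<^bsub>TT\<^esub> tau_pow c = tau_pow (b \<noteq> c)" "\<one>\<^bsub>TT\<^esub> = tau_pow False"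
  by (simp_all add: tau_group_def tau_pow_mult Auto_simps, simp add: tau_pow_def)

lemma GG_carrier: "carrier GG = {(n, tau_pow b) | n b. n \<in> NN}"
  by (auto simp: G_group_def semidirect_product_def TT_carrier)

lemma GG_in: "n \<in> NN \<Longrightarrow> (n, tau_pow b) \<in> carrier GG" by (auto simp: GG_carrier)

lemma GG_E: assumes "g \<in> carrier GG" obtains n b where "n \<in> NN" "g = (n, tau_pow b)"
  using assms by (auto simp: GG_carrier)

lemma GG_mult: "m \<in> NN \<Longrightarrow> (n, tau_pow b) \<otimes>\<^bsub>GG\<^esub> (m, tau_pow c) = (n \<cdot> tau_act b m, tau_pow (b \<noteq> c))"
  by (simp add: G_group_def semidirect_product_def TT_simps tau_pow_apply)

lemma GG_one: "\<one>\<^bsub>GG\<^esub> = (\<one>\<^bsub>P\<^esub>, tau_pow False)"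
  by (simp add: G_group_def semidirect_product_def TT_simps)

lemma NN_closed: "x \<in> NN \<Longrightarrow> y \<in> NN \<Longrightarrow> x \<cdot> y \<in> NN" "x \<in> NN \<Longrightarrow> x\<^sup>- \<in> NN" "\<one>\<^bsub>P\<^esub> \<in> NN"
  using subgroup.m_closed[OF N_subgroup] subgroup.m_inv_closed[OF N_subgroup] subgroup.one_closed[OF N_subgroup] by blast+

lemma tau_act_one: "tau_act b \<one>\<^bsub>P\<^esub> = \<one>\<^bsub>P\<^esub>"
  using hom_one[OF eps_conj_hom group_P group_P] by (simp add: tau_act_def)

lemma GG_left_inv: "n \<in> NN \<Longrightarrow> (tau_act b (n\<^sup>-), tau_pow b) \<otimes>\<^bsub>GG\<^esub> (n, tau_pow b) = \<one>\<^bsub>GG\<^esub>"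
  using tau_act_mult[of "n\<^sup>-" n b] by (simp add: GG_mult GG_one NN_closed N_carrier tau_act_one)

lemma group_GG: "group GG"
proof (rule groupI)
  fix x y z assume x: "x \<in> carrier GG" and y: "y \<in> carrier GG" and z: "z \<in> carrier GG"
  obtain n b where n: "n \<in> NN" "x = (n, tau_pow b)" using GG_E[OF x] .
  obtain m c where m: "m \<in> NN" "y = (m, tau_pow c)" using GG_E[OF y] .
  obtain k e where k: "k \<in> NN" "z = (k, tau_pow e)" using GG_E[OF z] .
  note cl = tau_act_N[OF m(1), of b] tau_act_N[OF k(1), of c] tau_act_N[OF k(1), of "b \<noteq> c"]
  have "(n \<cdot> tau_act b m) \<cdot> tau_act (b \<noteq> c) k = n \<cdot> tau_act b (m \<cdot> tau_act c k)"
    using n m k cl by (simp add: tau_act_mult tau_tau_act_compose P.m_assoc N_carrier)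
  moreover have "((b \<noteq> c) \<noteq> e) = (b \<noteq> (c \<noteq> e))" by auto
  ultimately show "x \<otimes>\<^bsub>GG\<^esub> y \<otimes>\<^bsub>GG\<^esub> z = x \<otimes>\<^bsub>GG\<^esub> (y \<otimes>\<^bsub>GG\<^esub> z)"
    unfolding n m k using n m k cl by (simp only: GG_mult NN_closed)
next
  fix x y assume x: "x \<in> carrier GG" and y: "y \<in> carrier GG"
  obtain n b where n: "n \<in> NN" "x = (n, tau_pow b)" using GG_E[OF x] .
  obtain m c where m: "m \<in> NN" "y = (m, tau_pow c)" using GG_E[OF y] .
  show "x \<otimes>\<^bsub>GG\<^esub> y \<in> carrier GG" using n m by (simp add: GG_mult GG_in NN_closed tau_act_N)
next
  show "\<one>\<^bsub>GG\<^esub> \<in> carrier GG" by (simp add: GG_one GG_in NN_closed)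
next
  fix x assume x: "x \<in> carrier GG"
  obtain n b where n: "n \<in> NN" "x = (n, tau_pow b)" using GG_E[OF x] .
  show "\<one>\<^bsub>GG\<^esub> \<otimes>\<^bsub>GG\<^esub> x = x" using n by (simp add: GG_one GG_mult N_carrier tau_act_def)
  show "\<exists>y\<in>carrier GG. y \<otimes>\<^bsub>GG\<^esub> x = \<one>\<^bsub>GG\<^esub>"
    using n GG_left_inv[OF n(1), of b] by (intro bexI[of _ "(tau_act b (n\<^sup>-), tau_pow b)"]) (auto simp: GG_in tau_act_N NN_closed)
qed

lemma GG_inv: "n \<in> NN \<Longrightarrow> inv\<^bsub>GG\<^esub> (n, tau_pow b) = (tau_act b (n\<^sup>-), tau_pow b)"
  by (rule group.inv_equality[OF group_GG GG_left_inv]) (auto simp: GG_in tau_act_N NN_closed)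

lemma GG_mult_inv: "n \<in> NN \<Longrightarrow> m \<in> NN \<Longrightarrow> (n, tau_pow b) \<otimes>\<^bsub>GG\<^esub> inv\<^bsub>GG\<^esub> (m, tau_pow b) = (n \<cdot> m\<^sup>-, tau_pow False)"
  by (simp add: GG_inv GG_mult tau_act_N NN_closed tau_tau_act_compose) (simp add: tau_act_def)

lemma GG_conj: "n \<in> NN \<Longrightarrow> m \<in> NN \<Longrightarrow>
    (n, tau_pow b) \<otimes>\<^bsub>GG\<^esub> (m, tau_pow False) \<otimes>\<^bsub>GG\<^esub> inv\<^bsub>GG\<^esub> (n, tau_pow b) = (n \<cdot> tau_act b m \<cdot> n\<^sup>-, tau_pow False)"
  by (simp add: GG_mult GG_mult_inv NN_closed tau_act_N)

lemma incl_eq: "incl n = (n, tau_pow False)" by (simp add: N_incl_def TT_simps)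

lemma incl_hom: "incl \<in> hom N GG"
  by (rule homI) (auto simp: incl_eq GG_in GG_mult tau_act_def)

lemma incl_inj: "inj_on incl (carrier N)"
  by (auto simp: inj_on_def incl_eq)

definition G_kernel :: "nat \<Rightarrow> ((nat \<Rightarrow> nat list \<Rightarrow> nat list) \<times> ((nat \<Rightarrow> nat list \<Rightarrow> nat list) \<Rightarrow> nat \<Rightarrow> nat list \<Rightarrow> nat list)) set" where
  "G_kernel n = incl ` level_kernel n"

lemma G_kernel_iff: "(m, tau_pow b) \<in> G_kernel n \<longleftrightarrow> m \<in> level_kernel n \<and> \<not> b"
  using tau_pow_inj[of b False] by (auto simp: G_kernel_def incl_eq image_def)

lemma normal_incl_image:
  assumes K: "K \<lhd> N" and tau_act: "\<And>m. m \<in> K \<Longrightarrow> eps_conj m \<in> K"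
  shows "incl ` K \<lhd> GG"
proof -
  interpret G: group GG by (rule group_GG)
  interpret i: group_hom "N" GG incl
    using incl_hom by (simp add: group_hom_def group_hom_axioms_def group_N group_GG)
  show ?thesis unfolding G.normal_inv_iff
  proof (intro conjI ballI)
    show "subgroup (incl ` K) GG" by (rule i.subgroup_img_is_subgroup[OF normal_imp_subgroup[OF K]])
    fix x h assume x: "x \<in> carrier GG" and "h \<in> incl ` K"
    then obtain m where m: "m \<in> K" "h = (m, tau_pow False)" by (auto simp: incl_eq)
    obtain n b where n: "n \<in> NN" "x = (n, tau_pow b)" using GG_E[OF x] .
    have mN: "m \<in> NN" using m subgroup.subset[OF normal_imp_subgroup[OF K]] by auto
    have "tau_act b m \<in> K" using m tau_act by (simp add: tau_act_def)
    then have "n \<cdot> tau_act b m \<cdot> n\<^sup>- \<in> K" using normal.inv_op_closed2[OF K, of n "tau_act b m"] n by (simp add: inv_N)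
    then show "x \<otimes>\<^bsub>GG\<^esub> h \<otimes>\<^bsub>GG\<^esub> inv\<^bsub>GG\<^esub> x \<in> incl ` K" using n m mN by (simp add: GG_conj incl_eq)
  qed
qed

abbreviation N_image where "N_image \<equiv> incl ` carrier N"

lemma N_image_iff: "(m, tau_pow b) \<in> N_image \<longleftrightarrow> m \<in> NN \<and> \<not> b"
  using tau_pow_inj[of b False] by (auto simp: incl_eq image_def)

lemma N_image_normal: "N_image \<lhd> GG"
  by (rule normal_incl_image[OF N.FIN_D(1)[OF N.carrier_FIN]]) (simp add: eps_conj_N)

lemma range_tau_pow_finite: "finite (snd ` carrier GG)"
  by (rule finite_subset[of _ "range tau_pow"]) (auto simp: GG_carrier)

lemma G_kernel_FIN: "G_kernel n \<in> FIN GG"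
proof (rule group.FIN_I[OF group_GG])
  show "G_kernel n \<lhd> GG" unfolding G_kernel_def by (rule normal_incl_image[OF level_kernel_normal eps_conj_level_kernel])
  let ?\<phi> = "\<lambda>g. (restrict (fst g) {1..n}, snd g)"
  have "?\<phi> ` carrier GG \<subseteq> ((\<lambda>p. restrict p {1..n}) ` NN) \<times> range tau_pow" by (auto simp: GG_carrier)
  moreover have "finite (((\<lambda>p. restrict p {1..n}) ` NN) \<times> range tau_pow)"
    by (rule finite_cartesian_product[OF finite_levels]) simp
  ultimately show "finite (?\<phi> ` carrier GG)" by (rule finite_subset)
  fix x y assume x: "x \<in> carrier GG" and y: "y \<in> carrier GG" and e: "?\<phi> x = ?\<phi> y"
  obtain k b where k: "k \<in> NN" "x = (k, tau_pow b)" using GG_E[OF x] .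
  obtain m c where m: "m \<in> NN" "y = (m, tau_pow c)" using GG_E[OF y] .
  have bc: "b = c" and eq: "restrict k {1..n} = restrict m {1..n}" using e k m tau_pow_inj by auto
  have "k \<cdot> m\<^sup>- \<in> level_kernel n"
    using eq k m level_kernel_mult_inv unfolding restrict_eq_levels by blast
  then show "x \<otimes>\<^bsub>GG\<^esub> inv\<^bsub>GG\<^esub> y \<in> G_kernel n" using k m bc by (simp add: GG_mult_inv G_kernel_iff)
qed

lemma N_image_FIN: "N_image \<in> FIN GG"
proof (rule group.FIN_I[OF group_GG N_image_normal range_tau_pow_finite])
  fix x y assume x: "x \<in> carrier GG" and y: "y \<in> carrier GG" and e: "snd x = snd y"
  obtain k b where k: "k \<in> NN" "x = (k, tau_pow b)" using GG_E[OF x] .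
  obtain m c where m: "m \<in> NN" "y = (m, tau_pow c)" using GG_E[OF y] .
  have "b = c" using e k m tau_pow_inj by simp
  then show "x \<otimes>\<^bsub>GG\<^esub> inv\<^bsub>GG\<^esub> y \<in> N_image" using k m by (simp add: GG_mult_inv N_image_iff NN_closed del: N_simps)
qed

lemma G_kernel_sub_N_image: "G_kernel n \<subseteq> N_image" by (auto simp: G_kernel_def level_kernel_def)

lemma G_chain: "completion_chain GG G_kernel"
proof -
  interpret G: group GG by (rule group_GG)
  show ?thesis
  proof unfold_locales
    show "G_kernel n \<in> FIN GG" for n by (rule G_kernel_FIN)
    show "m \<le> n \<Longrightarrow> G_kernel n \<subseteq> G_kernel m" for m n using N.M_anti by (auto simp: G_kernel_def)
    fix K assume "K \<in> FIN GG"
    then have "{g \<in> carrier N. incl g \<in> K} \<in> FIN N"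
      by (rule N.FIN_preimage[OF group_GG incl_hom])
    then obtain n where "level_kernel n \<subseteq> {g \<in> carrier N. incl g \<in> K}" using N.M_cofinal by blast
    then show "\<exists>n. G_kernel n \<subseteq> K" by (auto simp: G_kernel_def)
  qed
qed

sublocale G: completion_chain GG G_kernel by (rule G_chain)

lemma G_residually_finite: "residually_finite GG"
  unfolding residually_finite_def
proof (intro conjI ballI impI group_GG)
  fix g assume g: "g \<in> carrier GG" "g \<noteq> \<one>\<^bsub>GG\<^esub>"
  obtain n b where n: "n \<in> NN" "g = (n, tau_pow b)" using GG_E[OF g(1)] .
  have "\<exists>l. (n, tau_pow b) \<notin> G_kernel l"
  proof (cases b)
    case False
    then have "n \<noteq> \<one>\<^bsub>P\<^esub>" using g n by (auto simp: GG_one)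
    then obtain l where "1 \<le> l" "n l \<noteq> id"
      using P_eqI[OF N_carrier[OF n(1)] P.one_closed] by (auto simp: one_level)
    then show ?thesis by (intro exI[of _ l]) (auto simp: G_kernel_iff level_kernel_def)
  qed (simp add: G_kernel_iff)
  then show "\<exists>K\<in>FIN GG. g \<notin> K" using G_kernel_FIN n by blast
qed

lemma G_finitely_generated: "finitely_generated_group GG"
proof -
  obtain S where S: "S \<subseteq> NN" "finite S" "generate N S = NN"
    using N_generated(2) by (auto simp: finitely_generated_group_def)
  interpret i: group_hom "N" GG incl
    using incl_hom by (simp add: group_hom_def group_hom_axioms_def group_N group_GG)
  let ?t = "(\<one>\<^bsub>P\<^esub>, tau_pow True)"
  let ?S = "insert ?t (incl ` S)"
  have sub: "?S \<subseteq> carrier GG" using S by (auto simp: GG_in incl_eq NN_closed)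
  have gsub: "subgroup (generate GG ?S) GG" by (rule G.generate_is_subgroup[OF sub])
  have N: "incl ` NN \<subseteq> generate GG ?S"
    using i.generate_img[of S] S G.mono_generate[of "incl ` S" ?S] by auto
  have "carrier GG \<subseteq> generate GG ?S"
  proof
    fix g assume "g \<in> carrier GG"
    then obtain n b where n: "n \<in> NN" "g = (n, tau_pow b)" by (rule GG_E)
    have i: "(n, tau_pow False) \<in> generate GG ?S" using N n by (auto simp: incl_eq)
    show "g \<in> generate GG ?S"
    proof (cases b)
      case True
      have "?t \<in> generate GG ?S" by (rule generate.incl) simp
      then have "(n, tau_pow False) \<otimes>\<^bsub>GG\<^esub> ?t \<in> generate GG ?S" using i subgroup.m_closed[OF gsub] by blast
      then show ?thesis using n True by (simp add: GG_mult NN_closed tau_act_def N_carrier)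
    qed (use i n in simp)
  qed
  then have "generate GG ?S = carrier GG" using subgroup.subset[OF gsub] by blast
  then show ?thesis using sub S(2) group_GG unfolding finitely_generated_group_def by blast
qed

text \<open>A complement contains an element \<open>(m,\<tau>)\<close>. It centralizes \<open>N\<close> since two normal subgroups with trivial
intersection commute, and then \<open>m\<epsilon>\<close> centralizes \<open>N\<close> in \<open>P\<close>.\<close>

lemma N_not_direct_factor: "\<not> direct_factor GG N_image"
proof
  assume "direct_factor GG N_image"
  then obtain K where K: "K \<lhd> GG" "N_image \<inter> K = {\<one>\<^bsub>GG\<^esub>}" "N_image <#>\<^bsub>GG\<^esub> K = carrier GG"
    by (auto simp: direct_factor_def direct_complement_def)
  have KG: "subgroup K GG" by (rule normal_imp_subgroup[OF K(1)])
  have "(\<one>\<^bsub>P\<^esub>, tau_pow True) \<in> N_image <#>\<^bsub>GG\<^esub> K" using K(3) GG_in NN_closed by simp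
  then obtain a k where ak: "a \<in> NN" "k \<in> K" "(\<one>\<^bsub>P\<^esub>, tau_pow True) = (a, tau_pow False) \<otimes>\<^bsub>GG\<^esub> k"
    by (auto simp: set_mult_def incl_eq)
  obtain m b where m: "m \<in> NN" "k = (m, tau_pow b)" using GG_E[of k] subgroup.mem_carrier[OF KG ak(2)] by blast
  have b: "b" using ak m tau_pow_inj by (auto simp: GG_mult)
  show False
  proof (rule eps_central_absurd[OF m(1)])
    fix n assume n: "n \<in> NN"
    let ?n = "(n, tau_pow False)"
    have nc: "?n \<in> carrier GG" "k \<in> carrier GG" using n m by (auto simp: GG_in)
    have "?n \<in> N_image" using n N_image_iff[of n False] by blast
    have 1: "?n \<otimes>\<^bsub>GG\<^esub> k \<otimes>\<^bsub>GG\<^esub> inv\<^bsub>GG\<^esub> ?n \<in> K" by (rule normal.inv_op_closed2[OF K(1) nc(1) ak(2)])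
    have 2: "k \<otimes>\<^bsub>GG\<^esub> inv\<^bsub>GG\<^esub> ?n \<otimes>\<^bsub>GG\<^esub> inv\<^bsub>GG\<^esub> k \<in> N_image"
      by (rule normal.inv_op_closed2[OF N_image_normal nc(2) subgroup.m_inv_closed[OF normal_imp_subgroup[OF N_image_normal] \<open>?n \<in> N_image\<close>]])
    let ?c = "?n \<otimes>\<^bsub>GG\<^esub> k \<otimes>\<^bsub>GG\<^esub> inv\<^bsub>GG\<^esub> ?n \<otimes>\<^bsub>GG\<^esub> inv\<^bsub>GG\<^esub> k"
    have "?c \<in> K" using 1 ak(2) subgroup.m_closed[OF KG] subgroup.m_inv_closed[OF KG] by blast
    moreover have "?c = ?n \<otimes>\<^bsub>GG\<^esub> (k \<otimes>\<^bsub>GG\<^esub> inv\<^bsub>GG\<^esub> ?n \<otimes>\<^bsub>GG\<^esub> inv\<^bsub>GG\<^esub> k)" using nc by (simp add: G.m_assoc)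
    then have "?c \<in> N_image" using subgroup.m_closed[OF normal_imp_subgroup[OF N_image_normal] \<open>?n \<in> N_image\<close> 2] by simp
    ultimately have "?c = \<one>\<^bsub>GG\<^esub>" using K(2) by blast
    then have "(?n \<otimes>\<^bsub>GG\<^esub> k) \<otimes>\<^bsub>GG\<^esub> inv\<^bsub>GG\<^esub> (k \<otimes>\<^bsub>GG\<^esub> ?n) = \<one>\<^bsub>GG\<^esub>"
      using nc by (simp add: G.inv_mult_group G.m_assoc)
    then have "?n \<otimes>\<^bsub>GG\<^esub> k = k \<otimes>\<^bsub>GG\<^esub> ?n"
      using nc by (metis G.inv_closed G.inv_equality G.inv_inv G.m_closed)
    then have "n \<cdot> m = m \<cdot> eps_conj n" using n m b by (simp add: GG_mult tau_act_def)
    then have e: "n \<cdot> m = m \<cdot> (eps \<cdot> n \<cdot> eps)" by (simp add: eps_conj_def eps_inv)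
    have c: "n \<in> carrier P" "m \<in> carrier P" using n m N_carrier by auto
    have "n \<cdot> (m \<cdot> eps) = (n \<cdot> m) \<cdot> eps" using c eps_closed by (simp add: P.m_assoc)
    also have "\<dots> = m \<cdot> (eps \<cdot> n \<cdot> eps) \<cdot> eps" by (simp only: e)
    also have "\<dots> = (m \<cdot> eps) \<cdot> n \<cdot> (eps \<cdot> eps)" using c eps_closed by (simp only: P.m_assoc P.m_closed)
    finally show "n \<cdot> (m \<cdot> eps) = (m \<cdot> eps) \<cdot> n" using c eps_closed by (simp add: eps_eps)
  qed
qed

abbreviation Ghat where "Ghat \<equiv> completion GG"
abbreviation rcosG (infixl "#>G" 60) where "K #>G g \<equiv> K #>\<^bsub>GG\<^esub> g"
abbreviation imN where "imN \<equiv> completion_map N GG incl ` carrier Nhat"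

section \<open>The completion of the semidirect product\<close>

text \<open>A point of the completion of \<open>G\<close> whose coordinate at \<open>N\<close> is trivial has all its representatives
along the chain in \<open>N\<close>, and these define a point of the completion of \<open>N\<close>.\<close>

lemma imN_eq: "imN = {x \<in> carrier Ghat. x N_image = N_image}"
proof
  have NMG: "subgroup N_image GG" using G.FIN_D(2)[OF N_image_FIN] .
  show "imN \<subseteq> {x \<in> carrier Ghat. x N_image = N_image}"
  proof
    fix y assume "y \<in> imN"
    then obtain x where x: "x \<in> carrier Nhat" "y = completion_map N GG incl x" by blast
    obtain g where g: "g \<in> carrier N" "x (carrier N) = carrier N #>N g"
      using N.completion_rep[OF x(1) N.carrier_FIN] by blast
    have "y N_image = N_image #>G incl g" unfolding x(2)
      by (rule N.completion_map_at[OF group_GG incl_hom N_image_FIN x(1) N.carrier_FIN _ g]) auto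
    also have "\<dots> = N_image" by (rule G.coset_join2[OF _ NMG]) (use g hom_in_carrier[OF incl_hom g(1)] in auto)
    finally show "y \<in> {x \<in> carrier Ghat. x N_image = N_image}"
      using N.completion_map_closed[OF group_GG incl_hom x(1)] x(2) by simp
  qed
  show "{x \<in> carrier Ghat. x N_image = N_image} \<subseteq> imN"
  proof
    fix y assume "y \<in> {x \<in> carrier Ghat. x N_image = N_image}"
    then have y: "y \<in> carrier Ghat" "y N_image = N_image" by auto
    have "\<exists>s. s \<in> NN \<and> y (G_kernel n) = G_kernel n #>G incl s" for n
    proof -
      obtain g where g: "g \<in> carrier GG" "y (G_kernel n) = G_kernel n #>G g" using G.completion_rep[OF y(1) G_kernel_FIN] by blast
      have "N_image #>G g = N_image" using G.completion_rep_mono[OF y(1) G_kernel_FIN N_image_FIN G_kernel_sub_N_image g] y(2) by simp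
      then have "g \<in> N_image" by (rule G.coset_join1[OF _ g(1) NMG])
      then show ?thesis using g by auto
    qed
    then obtain s where s: "\<And>n. s n \<in> NN" "\<And>n. y (G_kernel n) = G_kernel n #>G incl (s n)" by metis
    have "\<exists>x\<in>carrier Nhat. \<forall>n K. K \<in> FIN N \<longrightarrow> level_kernel n \<subseteq> K \<longrightarrow> x K = K #>N s n"
    proof (rule N.completion_lift)
      show "s n \<in> carrier N" for n using s by simp
      fix m n :: nat assume nm: "n \<le> m"
      have i: "incl (s k) \<in> carrier GG" for k using hom_in_carrier[OF incl_hom] s by simp
      have "y (G_kernel n) = G_kernel n #>G incl (s m)"
        by (rule G.completion_rep_mono[OF y(1) G_kernel_FIN G_kernel_FIN G.M_anti[OF nm] i s(2)])
      then have "incl (s m) \<otimes>\<^bsub>GG\<^esub> inv\<^bsub>GG\<^esub> incl (s n) \<in> G_kernel n"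
        using s(2)[of n] by (intro G.rcos_eqD[OF G.FIN_D(2)[OF G_kernel_FIN] i i]) simp
      then show "s m \<otimes>\<^bsub>N\<^esub> inv\<^bsub>N\<^esub> s n \<in> level_kernel n"
        using s by (simp add: incl_eq GG_mult_inv G_kernel_iff inv_N)
    qed
    then obtain x where x: "x \<in> carrier Nhat" "\<And>n. x (level_kernel n) = level_kernel n #>N s n" using level_kernel_FIN by blast
    have "completion_map N GG incl x = y"
    proof (rule G.completion_ext[OF N.completion_map_closed[OF group_GG incl_hom x(1)] y(1)])
      fix n
      have "completion_map N GG incl x (G_kernel n) = G_kernel n #>G incl (s n)"
        by (rule N.completion_map_at[OF group_GG incl_hom G_kernel_FIN x(1) level_kernel_FIN _ _ x(2)])
          (use s in \<open>auto simp: G_kernel_def level_kernel_def\<close>)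
      then show "completion_map N GG incl x (G_kernel n) = y (G_kernel n)" using s(2) by simp
    qed
    then show "y \<in> imN" using x(1) by blast
  qed
qed

text \<open>The complement is generated by the limit \<open>z\<close> of the elements \<open>(e\<^sub>n, \<tau>)\<close>, where \<open>e\<^sub>n \<in> N\<close> agrees with \<open>\<epsilon>\<close>
up to level \<open>n\<close>. Modulo the \<open>n\<close>-th kernel, \<open>(e\<^sub>n, \<tau>)\<close> acts on \<open>N\<close> like \<open>\<epsilon>\<epsilon> = 1\<close> and squares to \<open>1\<close>; hence \<open>z\<close> is
central of order two. It lies outside the completion of \<open>N\<close> because its second component is \<open>\<tau>\<close>.\<close>

lemma G_closed_direct_factor: "closed_direct_factor Ghat (completion_topology GG) imN"
proof -
  interpret C: group Ghat by (rule G.group_completion)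
  let ?c = "\<lambda>n. cut n eps" and ?s = "\<lambda>n. (cut n eps, tau_pow True)"
  have c: "?c n \<in> NN" for n by (rule cut_N[OF eps_closed])
  have s: "?s n \<in> carrier GG" for n using c GG_in by blast
  have "\<exists>z\<in>carrier Ghat. \<forall>n K. K \<in> FIN GG \<longrightarrow> G_kernel n \<subseteq> K \<longrightarrow> z K = K #>G ?s n"
  proof (rule G.completion_lift[OF s])
    fix m n :: nat assume "n \<le> m"
    then show "?s m \<otimes>\<^bsub>GG\<^esub> inv\<^bsub>GG\<^esub> ?s n \<in> G_kernel n"
      using cut_coherent[OF eps_closed] c by (simp add: GG_mult_inv G_kernel_iff)
  qed
  then obtain z where z: "z \<in> carrier Ghat" and zK: "\<And>n K. K \<in> FIN GG \<Longrightarrow> G_kernel n \<subseteq> K \<Longrightarrow> z K = K #>G ?s n" by blast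
  have zn: "z (G_kernel n) = G_kernel n #>G ?s n" for n by (rule zK[OF G_kernel_FIN order_refl])
  have zNM: "z N_image = N_image #>G ?s 0" by (rule zK[OF N_image_FIN G_kernel_sub_N_image])
  have zz: "z \<otimes>\<^bsub>Ghat\<^esub> z = \<one>\<^bsub>Ghat\<^esub>"
  proof (rule G.completion_ext)
    fix n
    have "(z \<otimes>\<^bsub>Ghat\<^esub> z) (G_kernel n) = G_kernel n #>G (?s n \<otimes>\<^bsub>GG\<^esub> ?s n)"
      by (rule G.completion_mult_at[where x = z and y = z, OF G_kernel_FIN s s zn zn])
    also have "\<dots> = G_kernel n"
    proof (rule G.coset_join2[OF _ G.FIN_D(2)[OF G_kernel_FIN]])
      have "?c n \<cdot> eps_conj (?c n) \<in> level_kernel n"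
      proof -
        have "(?c n \<cdot> eps_conj (?c n)) l = id" if "l \<in> {1..n}" for l
          using that N_carrier[OF c[of n]] eps_level(1)[of l] by (simp add: mult_level eps_conj_level cut_level)
        then show ?thesis using c eps_conj_N NN_closed by (simp add: level_kernel_def)
      qed
      then show "?s n \<otimes>\<^bsub>GG\<^esub> ?s n \<in> G_kernel n" using c by (simp add: GG_mult G_kernel_iff tau_act_def)
    qed (use s in simp)
    finally show "(z \<otimes>\<^bsub>Ghat\<^esub> z) (G_kernel n) = \<one>\<^bsub>Ghat\<^esub> (G_kernel n)" by (simp add: G.one_completion G_kernel_FIN)
  qed (use z in auto)
  have zinv: "inv\<^bsub>Ghat\<^esub> z = z" by (rule C.inv_equality[OF zz z z])
  have central: "z \<otimes>\<^bsub>Ghat\<^esub> x = x \<otimes>\<^bsub>Ghat\<^esub> z" if x: "x \<in> carrier Ghat" for x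
  proof (rule G.completion_ext)
    show "z \<otimes>\<^bsub>Ghat\<^esub> x \<in> carrier Ghat" "x \<otimes>\<^bsub>Ghat\<^esub> z \<in> carrier Ghat" using x z by auto
    fix n
    obtain g where g: "g \<in> carrier GG" "x (G_kernel n) = G_kernel n #>G g" using G.completion_rep[OF x G_kernel_FIN] by blast
    obtain m b where m: "m \<in> NN" "g = (m, tau_pow b)" using GG_E[OF g(1)] .
    have e: "G_kernel n #>G (?s n \<otimes>\<^bsub>GG\<^esub> g) = G_kernel n #>G (g \<otimes>\<^bsub>GG\<^esub> ?s n)"
    proof (rule G.rcos_eqI[OF G.FIN_D(2)[OF G_kernel_FIN]])
      show "?s n \<otimes>\<^bsub>GG\<^esub> g \<in> carrier GG" "g \<otimes>\<^bsub>GG\<^esub> ?s n \<in> carrier GG" using s g by auto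
      have N: "?c n \<cdot> eps_conj m \<in> NN" "m \<cdot> tau_act b (?c n) \<in> NN"
        using NN_closed(1)[OF c eps_conj_N[OF m(1)]] NN_closed(1)[OF m(1) tau_act_N[OF c]] by auto
      have "(?c n \<cdot> eps_conj m) l = (m \<cdot> tau_act b (?c n)) l" if l: "l \<in> {1..n}" for l
      proof -
        have l1: "1 \<le> l" "l \<le> n" using l by auto
        have "tau_act b (?c n) l = eps l"
          using l1 N_carrier[OF c[of n]] eps_level(1)[OF l1(1)]
          by (simp add: tau_act_def eps_conj_level cut_level)
        moreover have "eps l \<circ> eps_conj m l = (eps l \<circ> eps l) \<circ> m l \<circ> eps l"
          using eps_conj_level[OF N_carrier[OF m(1)] l1(1)] by (simp add: o_assoc)
        ultimately show ?thesis using l1 eps_level(1)[OF l1(1)] by (simp add: mult_level cut_level)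
      qed
      then have "(?c n \<cdot> eps_conj m) \<cdot> (m \<cdot> tau_act b (?c n))\<^sup>- \<in> level_kernel n" using level_kernel_mult_inv[OF N] by simp
      moreover have "?s n \<otimes>\<^bsub>GG\<^esub> g = (?c n \<cdot> eps_conj m, tau_pow (\<not> b))" "g \<otimes>\<^bsub>GG\<^esub> ?s n = (m \<cdot> tau_act b (?c n), tau_pow (\<not> b))"
        using m c by (simp_all add: GG_mult tau_act_def)
      ultimately show "?s n \<otimes>\<^bsub>GG\<^esub> g \<otimes>\<^bsub>GG\<^esub> inv\<^bsub>GG\<^esub> (g \<otimes>\<^bsub>GG\<^esub> ?s n) \<in> G_kernel n"
        using N by (simp add: GG_mult_inv G_kernel_iff)
    qed
    show "(z \<otimes>\<^bsub>Ghat\<^esub> x) (G_kernel n) = (x \<otimes>\<^bsub>Ghat\<^esub> z) (G_kernel n)"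
      using G.completion_mult_at[where x = z and y = x, OF G_kernel_FIN s g(1) zn g(2)]
        G.completion_mult_at[where x = x and y = z, OF G_kernel_FIN g(1) s g(2) zn] e by simp
  qed
  let ?Z = "{\<one>\<^bsub>Ghat\<^esub>, z}"
  have NMG: "subgroup N_image GG" using G.FIN_D(2)[OF N_image_FIN] .
  have memb: "(x N_image = N_image) = (\<not> b)" if "m \<in> NN" "x N_image = N_image #>G (m, tau_pow b)" for x m b
    using G.coset_join1[OF _ GG_in[OF that(1)] NMG, of b] G.coset_join2[OF GG_in[OF that(1)] NMG, of b] N_image_iff[of m b] that by auto
  have z_notin: "z N_image \<noteq> N_image" using memb[of "?c 0" z True] c zNM by simp
  have "?Z \<lhd> Ghat"
    unfolding C.normal_inv_iff
  proof (intro conjI ballI C.subgroupI)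
    show "?Z \<subseteq> carrier Ghat" using z by simp
    show "inv\<^bsub>Ghat\<^esub> a \<in> ?Z" if "a \<in> ?Z" for a using that zinv by auto
    show "a \<otimes>\<^bsub>Ghat\<^esub> b \<in> ?Z" if "a \<in> ?Z" "b \<in> ?Z" for a b using that zz z by auto
    show "x \<otimes>\<^bsub>Ghat\<^esub> h \<otimes>\<^bsub>Ghat\<^esub> inv\<^bsub>Ghat\<^esub> x \<in> ?Z" if x: "x \<in> carrier Ghat" and "h \<in> ?Z" for x h
    proof -
      have "x \<otimes>\<^bsub>Ghat\<^esub> z \<otimes>\<^bsub>Ghat\<^esub> inv\<^bsub>Ghat\<^esub> x = z" using x z by (simp add: C.m_assoc flip: central[OF x])
      then show ?thesis using that by auto
    qed
  qed auto
  moreover have "imN \<lhd> Ghat" unfolding imN_eq by (rule G.coordinate_kernel_normal[OF N_image_FIN])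
  moreover have "imN \<inter> ?Z = {\<one>\<^bsub>Ghat\<^esub>}"
  proof -
    have "\<one>\<^bsub>Ghat\<^esub> N_image = N_image" by (simp only: G.one_completion restrict_apply' N_image_FIN)
    then show ?thesis unfolding imN_eq using z_notin C.one_closed by blast
  qed
  moreover have "imN <#>\<^bsub>Ghat\<^esub> ?Z = carrier Ghat"
  proof
    have "imN \<subseteq> carrier Ghat" unfolding imN_eq by blast
    then show "imN <#>\<^bsub>Ghat\<^esub> ?Z \<subseteq> carrier Ghat" using z by (intro C.setmult_subset_G) auto
    show "carrier Ghat \<subseteq> imN <#>\<^bsub>Ghat\<^esub> ?Z"
    proof
      fix x assume x: "x \<in> carrier Ghat"
      obtain g where g: "g \<in> carrier GG" "x N_image = N_image #>G g" using G.completion_rep[OF x N_image_FIN] by blast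
      obtain m b where m: "m \<in> NN" "g = (m, tau_pow b)" using GG_E[OF g(1)] .
      show "x \<in> imN <#>\<^bsub>Ghat\<^esub> ?Z"
      proof (cases b)
        case False
        then have "x \<in> imN" unfolding imN_eq using memb[OF m(1)] g m x by simp
        moreover have "x = x \<otimes>\<^bsub>Ghat\<^esub> \<one>\<^bsub>Ghat\<^esub>" using x by simp
        ultimately show ?thesis unfolding set_mult_def by blast
      next
        case True
        have "(x \<otimes>\<^bsub>Ghat\<^esub> z) N_image = N_image #>G (g \<otimes>\<^bsub>GG\<^esub> ?s 0)"
          by (rule G.completion_mult_at[where x = x and y = z, OF N_image_FIN g(1) s g(2) zNM])
        also have "g \<otimes>\<^bsub>GG\<^esub> ?s 0 = (m \<cdot> tau_act b (?c 0), tau_pow False)" using m c True by (simp add: GG_mult)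
        finally have "(x \<otimes>\<^bsub>Ghat\<^esub> z) N_image = N_image"
          using memb[of "m \<cdot> tau_act b (?c 0)" "x \<otimes>\<^bsub>Ghat\<^esub> z" False] NN_closed(1)[OF m(1) tau_act_N[OF c[of 0]]] by simp
        then have "x \<otimes>\<^bsub>Ghat\<^esub> z \<in> imN" unfolding imN_eq using x z by simp
        moreover have "x = (x \<otimes>\<^bsub>Ghat\<^esub> z) \<otimes>\<^bsub>Ghat\<^esub> z" using x z zz by (simp add: C.m_assoc)
        ultimately show ?thesis unfolding set_mult_def by blast
      qed
    qed
  qed
  ultimately have "direct_complement Ghat imN ?Z" by (simp add: direct_complement_def)
  moreover have "closedin (completion_topology GG) imN"
    unfolding imN_eq by (rule G.closedin_completion_coordinate[OF N_image_FIN])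
  moreover have "closedin (completion_topology GG) ?Z"
    by (rule closedin_Hausdorff_finite[OF G.Hausdorff_completion]) (use z in \<open>auto simp: G.topspace_completion\<close>)
  ultimately show ?thesis unfolding closed_direct_factor_def by blast
qed

end

theorem theorem5p4:
  fixes d r :: nat
  assumes "5 \<le> d" and "2 \<le> r" and "r \<le> d - 3"
  shows
    "epsilon d \<in> carrier (P_group d) \<and> group.ord (P_group d) (epsilon d) = 2 \<and>
     subgroup (N_set d r) (P_group d) \<and>
     generated_by_at_most 4 (N_group d r) \<and>
     residually_finite (N_group d r) \<and>
     (\<exists>F. induced_on_completion (N_group d r) (P_group d) (P_topology d) (\<lambda>n. n) F \<and>
          F \<in> iso (profinite_completion (N_group d r)) (P_group d) \<and>
          homeomorphic_map (completion_topology (N_group d r)) (P_topology d) F) \<and>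
     tau d r \<in> auto (N_group d r) \<and>
     \<not> is_inner (N_group d r) (tau d r) \<and>
     is_inner (profinite_completion (N_group d r))
       (completion_map (N_group d r) (N_group d r) (tau d r)) \<and>
     finitely_generated_group (G_group d r) \<and>
     residually_finite (G_group d r) \<and>
     finitely_generated_group (N_group d r) \<and>
     N_incl d r \<in> hom (N_group d r) (G_group d r) \<and>
     inj_on (N_incl d r) (carrier (N_group d r)) \<and>
     N_incl d r ` carrier (N_group d r) \<lhd> G_group d r \<and>
     closed_direct_factor (profinite_completion (G_group d r)) (completion_topology (G_group d r))
       (completion_map (N_group d r) (G_group d r) (N_incl d r)
          ` carrier (profinite_completion (N_group d r))) \<and>
     \<not> direct_factor (G_group d r) (N_incl d r ` carrier (N_group d r))"
proof -
  interpret telescope d r by unfold_locales (rule assms)+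
  show ?thesis
    by (intro conjI eps_closed ord_eps N_subgroup N_generated N_residually_finite N_completion_is_P
        tau_auto tau_not_inner tau_completion_inner G_finitely_generated G_residually_finite
        incl_hom incl_inj N_image_normal G_closed_direct_factor N_not_direct_factor)
qed

end
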